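(* Let $p_0\in(0,1)$ and the integer $d\ge1$ be constants. There is an algorithm which, given an instance $\mathcal I$ of a $d$-ary CSP on $n$ variables, a parameter $t$, and a parameter $p\in[p_0,1-p_0]$ with $pn$ an integer, runs in time $n^{O(d)}$ and either finds a kernel of $\mathcal I$ on at most $C\cdot t^2$ variables or certifies that $OPT\ge AVG+t$, under the global cardinality constraint $\sum_{i=1}^n x_i=(1-2p)n$, where $$C=160\,d^2\cdot 30^d\left(\Big(\tfrac{1-p_0}{p_0}\Big)^2+\Big(\tfrac{p_0}{1-p_0}\Big)^2\right)^d\cdot(d!)^{3d^2}\cdot\Big(\tfrac1{2p_0}\Big)^{4d}.$$
   Context: A $d$-ary CSP instance $\mathcal I$ consists of variables $x_1,\dots,x_n\in\{\pm1\}$ and constraints $C_1,\dots,C_m$, where $C_i$ consists of $d$ variables $x_{i_1},\dots,x_{i_d}$ and a predicate $P_i\subseteq\{-1,1\}^d$; an assignment satisfies $C_i$ iff $(x_{i_1},\dots,x_{i_d})\in P_i$. Let $\mathrm{val}_{\mathcal I}(\alpha)$ be the number of constraints satisfied by $\alpha\in\{\pm1\}^n$. It is given by the multilinear polynomial $f_{\mathcal I}$ of degree at most $d$ obtained from $\sum_{i=1}^m\sum_{\sigma\in P_i}2^{-d}\prod_{j=1}^d(1+\sigma_jx_{i_j})$. Under the global cardinality constraint, $OPT=\max\{\mathrm{val}_{\mathcal I}(\alpha):\alpha\in\{\pm1\}^n,\ \sum_i\alpha_i=(1-2p)n\}$, and $AVG$ is the expectation of $\mathrm{val}_{\mathcal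 I}(\alpha)$ for $\alpha$ uniformly random among all $\alpha\in\{\pm1\}^n$ with $\sum_i\alpha_i=(1-2p)n$. "Finding a kernel on at most $K$ variables" means outputting a set of at most $K$ of the variables together with a multilinear polynomial of degree at most $d$ that depends only on these variables and that equals $f_{\mathcal I}(\alpha)$ for every $\alpha\in\{\pm1\}^n$ with $\sum_i\alpha_i=(1-2p)n$.
   Formalization: The time bound is n^{O(d)} times a fixed power of (m+1) times the bit length of t (t rational), since constraints may repeat and the input must be read; it is n^{O(d)} when m and the length of t are n^{O(d)}. *)

theory Defs
  imports "HOL-Probability.Probability_Mass_Function"
begin

section \<open>Constraint satisfaction under a global cardinality constraint\<close>

text \<open>Variables are numbered \<open>0, \<dots>, n - 1\<close>. A constraint is a pair of its tuple of variables and its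
  predicate. Constraints form a list, so equal constraints may occur several times and are counted
  with multiplicity; a variable may also be repeated within one tuple.\<close>

type_synonym constr = "nat list \<times> int list set"

datatype csp = CSP (nvars: nat) (constrs: "constr list")

definition sign_vectors :: "nat \<Rightarrow> int list set" where
  "sign_vectors d = {\<sigma>. length \<sigma> = d \<and> set \<sigma> \<subseteq> {-1, 1}}"

definition csp_wf :: "nat \<Rightarrow> csp \<Rightarrow> bool" where
  "csp_wf d I \<longleftrightarrow> nvars I \<ge> 1 \<and>
     (\<forall>(xs, P)\<in>set (constrs I). length xs = d \<and> set xs \<subseteq> {..<nvars I} \<and> P \<subseteq> sign_vectors d)"

definition csp_val :: "csp \<Rightarrow> (nat \<Rightarrow> int) \<Rightarrow> nat" where
  "csp_val I \<alpha> = length (filter (\<lambda>(xs, P). map \<alpha> xs \<in> P) (constrs I))"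

text \<open>The reduction to multilinear form via \<open>x\<^sub>i\<^sup>2 = 1\<close> (relevant if a tuple repeats a variable) does not
  change the values at points with entries \<open>\<plusminus>1\<close>, and only these are used.\<close>

definition csp_poly :: "nat \<Rightarrow> csp \<Rightarrow> (nat \<Rightarrow> real) \<Rightarrow> real" where
  "csp_poly d I x = (\<Sum>(xs, P)\<leftarrow>constrs I. \<Sum>\<sigma>\<in>P.
     (1 / 2 ^ d) * (\<Prod>j<d. 1 + real_of_int (\<sigma> ! j) * x (xs ! j)))"

definition slice :: "nat \<Rightarrow> real \<Rightarrow> (nat \<Rightarrow> int) set" where
  "slice n p = {\<alpha> \<in> {..<n} \<rightarrow>\<^sub>E {-1, 1}. real_of_int (\<Sum>i<n. \<alpha> i) = (1 - 2 * p) * real n}"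

definition csp_OPT :: "csp \<Rightarrow> real \<Rightarrow> nat" where
  "csp_OPT I p = Max (csp_val I ` slice (nvars I) p)"

definition csp_AVG :: "csp \<Rightarrow> real \<Rightarrow> real" where
  "csp_AVG I p = measure_pmf.expectation (pmf_of_set (slice (nvars I) p)) (\<lambda>\<alpha>. real (csp_val I \<alpha>))"

lemma sum_prod_sign_vectors:
  assumes "P \<subseteq> sign_vectors d" and "length ys = d" and "set ys \<subseteq> {-1, 1}"
  shows "(\<Sum>\<sigma>\<in>P. (1 / 2 ^ d) * (\<Prod>j<d. 1 + real_of_int (\<sigma> ! j) * real_of_int (ys ! j)))
    = (if ys \<in> P then 1 else 0)"
proof -
  have fin: "finite P"
  proof (rule finite_subset)
    show "P \<subseteq> {\<sigma>. set \<sigma> \<subseteq> {-1, 1} \<and> length \<sigma> = d}"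
      using assms(1) by (auto simp: sign_vectors_def)
    show "finite {\<sigma>. set \<sigma> \<subseteq> {-1, 1::int} \<and> length \<sigma> = d}"
      by (rule finite_lists_length_eq) simp
  qed
  have *: "(1 / 2 ^ d) * (\<Prod>j<d. 1 + real_of_int (\<sigma> ! j) * real_of_int (ys ! j))
      = (if \<sigma> = ys then 1 else 0)" if "\<sigma> \<in> P" for \<sigma>
  proof (cases "\<sigma> = ys")
    case True
    have "1 + real_of_int (ys ! j) * real_of_int (ys ! j) = 2" if "j < d" for j
    proof -
      have "ys ! j \<in> set ys" using that assms(2) by simp
      hence "ys ! j \<in> {-1, 1}" using assms(3) by blast
      thus ?thesis by auto
    qed
    hence "(\<Prod>j<d. 1 + real_of_int (ys ! j) * real_of_int (ys ! j)) = 2 ^ d" by simp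
    thus ?thesis using True by simp
  next
    case False
    have \<sigma>: "length \<sigma> = d" "set \<sigma> \<subseteq> {-1, 1}"
      using that assms(1) by (auto simp: sign_vectors_def)
    then obtain j where j: "j < d" "\<sigma> ! j \<noteq> ys ! j"
      using False assms(2) nth_equalityI[of \<sigma> ys] by auto
    have "\<sigma> ! j \<in> set \<sigma>" "ys ! j \<in> set ys" using j(1) \<sigma>(1) assms(2) by simp_all
    hence "\<sigma> ! j \<in> {-1, 1}" "ys ! j \<in> {-1, 1}" using \<sigma>(2) assms(3) by blast+
    hence "1 + real_of_int (\<sigma> ! j) * real_of_int (ys ! j) = 0" using j by auto
    hence "(\<Prod>j<d. 1 + real_of_int (\<sigma> ! j) * real_of_int (ys ! j)) = 0"
      using j(1) by (intro prod_zero) auto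
    thus ?thesis using False by simp
  qed
  have "(\<Sum>\<sigma>\<in>P. (1 / 2 ^ d) * (\<Prod>j<d. 1 + real_of_int (\<sigma> ! j) * real_of_int (ys ! j)))
      = (\<Sum>\<sigma>\<in>P. if \<sigma> = ys then 1 else 0)"
    by (intro sum.cong refl *)
  thus ?thesis using fin by simp
qed

lemma csp_poly_eq_val:
  assumes "csp_wf d I" and "\<And>i. i < nvars I \<Longrightarrow> \<alpha> i \<in> {-1, 1}"
  shows "csp_poly d I (\<lambda>i. real_of_int (\<alpha> i)) = real (csp_val I \<alpha>)"
proof -
  have "(\<Sum>\<sigma>\<in>P. (1 / 2 ^ d) * (\<Prod>j<d. 1 + real_of_int (\<sigma> ! j) * real_of_int (\<alpha> (xs ! j))))
      = (if map \<alpha> xs \<in> P then 1 else 0)" if "(xs, P) \<in> set (constrs I)" for xs P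
  proof -
    have wf: "length xs = d" "set xs \<subseteq> {..<nvars I}" "P \<subseteq> sign_vectors d"
      using that assms(1) by (auto simp: csp_wf_def)
    have "set (map \<alpha> xs) \<subseteq> {-1, 1}" using wf(2) assms(2) by auto
    from sum_prod_sign_vectors[OF wf(3) _ this] show ?thesis using wf(1) by simp
  qed
  hence "csp_poly d I (\<lambda>i. real_of_int (\<alpha> i))
      = (\<Sum>(xs, P)\<leftarrow>constrs I. if map \<alpha> xs \<in> P then 1 else 0)"
    unfolding csp_poly_def by (intro arg_cong[where f = sum_list] map_cong) auto
  also have "\<dots> = real (csp_val I \<alpha>)"
  proof -
    have "(\<Sum>(xs, P)\<leftarrow>cs. if map \<alpha> xs \<in> P then 1 else 0)
        = real (length (filter (\<lambda>(xs, P). map \<alpha> xs \<in> P) cs))" for cs :: "constr list"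
      by (induction cs) auto
    thus ?thesis by (simp add: csp_val_def)
  qed
  finally show ?thesis .
qed

lemma length_constrs_le:
  assumes "csp_wf d I" and "distinct (constrs I)"
  shows "length (constrs I) \<le> 2 ^ (2 ^ d) * nvars I ^ d"
proof -
  let ?X = "{xs. set xs \<subseteq> {..<nvars I} \<and> length xs = d}"
  let ?S = "{xs. set xs \<subseteq> {-1, 1::int} \<and> length xs = d}"
  have fin: "finite ?X" "finite ?S" by (simp_all add: finite_lists_length_eq)
  have "set (constrs I) \<subseteq> ?X \<times> Pow ?S"
    using assms(1) unfolding csp_wf_def sign_vectors_def by fastforce
  hence "card (set (constrs I)) \<le> card (?X \<times> Pow ?S)"
    using fin by (intro card_mono) simp_all
  also have "card (?X \<times> Pow ?S) = nvars I ^ d * 2 ^ (2 ^ d)"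
    using fin by (simp add: card_cartesian_product card_Pow card_lists_length_eq numeral_2_eq_2)
  finally show ?thesis using assms(2) by (simp add: distinct_card mult.commute)
qed

section \<open>Kernels\<close>

text \<open>Multilinear polynomials with rational coefficients are lists of terms. A term consists of the
  variables of its monomial and a coefficient, given as numerator and denominator.\<close>

type_synonym frac = "int \<times> nat"
type_synonym mlpoly = "(nat list \<times> frac) list"

definition frac_val :: "frac \<Rightarrow> real" where
  "frac_val q = real_of_int (fst q) / real (snd q)"

definition mlpoly_eval :: "mlpoly \<Rightarrow> (nat \<Rightarrow> real) \<Rightarrow> real" where
  "mlpoly_eval g x = (\<Sum>(S, q)\<leftarrow>g. frac_val q * (\<Prod>i\<in>set S. x i))"

definition is_mlpoly :: "nat \<Rightarrow> nat set \<Rightarrow> mlpoly \<Rightarrow> bool" where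
  "is_mlpoly d V g \<longleftrightarrow>
     (\<forall>(S, q)\<in>set g. distinct S \<and> length S \<le> d \<and> set S \<subseteq> V \<and> snd q > 0)"

definition is_kernel :: "nat \<Rightarrow> csp \<Rightarrow> real \<Rightarrow> nat set \<Rightarrow> mlpoly \<Rightarrow> bool" where
  "is_kernel d I p V g \<longleftrightarrow> V \<subseteq> {..<nvars I} \<and> is_mlpoly d V g \<and>
     (\<forall>\<alpha>\<in>slice (nvars I) p. mlpoly_eval g (\<lambda>i. real_of_int (\<alpha> i)) = csp_poly d I (\<lambda>i. real_of_int (\<alpha> i)))"

datatype outcome = Kernel "nat list" mlpoly | Certified

fun correct_outcome :: "nat \<Rightarrow> real \<Rightarrow> csp \<Rightarrow> rat \<Rightarrow> real \<Rightarrow> outcome \<Rightarrow> bool" where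
  "correct_outcome d C I t p (Kernel V g) \<longleftrightarrow>
     is_kernel d I p (set V) g \<and> real (card (set V)) \<le> C * (of_rat t)\<^sup>2"
| "correct_outcome d C I t p Certified \<longleftrightarrow> real (csp_OPT I p) \<ge> csp_AVG I p + of_rat t"

section \<open>The model of computation\<close>

text \<open>Algorithms are programs of a first-order call-by-value functional language over binary trees
  (essentially the language F of N. D. Jones, Computability and Complexity from a Programming
  Perspective, 1997). Every evaluation step costs one unit. Trees are immutable and can only be
  inspected by taking one of the two immediate subtrees and by testing for a leaf, so with subtrees
  represented by pointers each step takes constant time on a random access machine: time is
  polynomially related to that of Turing machines. A program is a finite list of function bodies;
  \<open>ECall i\<close> calls the \<open>i\<close>-th one, \<open>EVar\<close> refers to the environment (arguments and values bound by
  \<open>ELet\<close>) by de Bruijn index.\<close>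

datatype btree = BLeaf | BNode btree btree

fun bleft :: "btree \<Rightarrow> btree" where
  "bleft BLeaf = BLeaf" | "bleft (BNode a b) = a"

fun bright :: "btree \<Rightarrow> btree" where
  "bright BLeaf = BLeaf" | "bright (BNode a b) = b"

datatype exp =
    EVar nat
  | ELeaf
  | ENode exp exp
  | ELeft exp
  | ERight exp
  | EIf exp exp exp
  | ELet exp exp
  | ECall nat "exp list"

type_synonym program = "exp list"

inductive eval :: "program \<Rightarrow> btree list \<Rightarrow> exp \<Rightarrow> btree \<Rightarrow> nat \<Rightarrow> bool"
  and evals :: "program \<Rightarrow> btree list \<Rightarrow> exp list \<Rightarrow> btree list \<Rightarrow> nat \<Rightarrow> bool"
  for F :: program where
  eval_Var: "i < length env \<Longrightarrow> eval F env (EVar i) (env ! i) 1"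
| eval_Leaf: "eval F env ELeaf BLeaf 1"
| eval_Node: "eval F env e1 v1 T1 \<Longrightarrow> eval F env e2 v2 T2 \<Longrightarrow>
    eval F env (ENode e1 e2) (BNode v1 v2) (T1 + T2 + 1)"
| eval_Left: "eval F env e v T \<Longrightarrow> eval F env (ELeft e) (bleft v) (T + 1)"
| eval_Right: "eval F env e v T \<Longrightarrow> eval F env (ERight e) (bright v) (T + 1)"
| eval_If_Node: "eval F env e v T \<Longrightarrow> v \<noteq> BLeaf \<Longrightarrow> eval F env e1 v1 T1 \<Longrightarrow>
    eval F env (EIf e e1 e2) v1 (T + T1 + 1)"
| eval_If_Leaf: "eval F env e BLeaf T \<Longrightarrow> eval F env e2 v2 T2 \<Longrightarrow>
    eval F env (EIf e e1 e2) v2 (T + T2 + 1)"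
| eval_Let: "eval F env e1 v1 T1 \<Longrightarrow> eval F (v1 # env) e2 v2 T2 \<Longrightarrow>
    eval F env (ELet e1 e2) v2 (T1 + T2 + 1)"
| eval_Call: "i < length F \<Longrightarrow> evals F env es vs T1 \<Longrightarrow> eval F vs (F ! i) v T2 \<Longrightarrow>
    eval F env (ECall i es) v (T1 + T2 + 1)"
| evals_Nil: "evals F env [] [] 0"
| evals_Cons: "eval F env e v T1 \<Longrightarrow> evals F env es vs T2 \<Longrightarrow>
    evals F env (e # es) (v # vs) (T1 + T2)"

lemma eval_deterministic:
  "eval F env e v T \<Longrightarrow> eval F env e v' T' \<Longrightarrow> v' = v \<and> T' = T"
  "evals F env es vs T \<Longrightarrow> evals F env es vs' T' \<Longrightarrow> vs' = vs \<and> T' = T"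
proof (induction arbitrary: v' T' and vs' T' rule: eval_evals.inducts)
  case (eval_Var i env) from eval_Var.prems show ?case by cases auto
next
  case (eval_Leaf env) from eval_Leaf.prems show ?case by cases auto
next
  case (eval_Node env e1 v1 T1 e2 v2 T2)
  from eval_Node.prems show ?case by cases (use eval_Node.IH in blast)+
next
  case (eval_Left env e v T) from eval_Left.prems show ?case by cases (use eval_Left.IH in blast)+
next
  case (eval_Right env e v T) from eval_Right.prems show ?case by cases (use eval_Right.IH in blast)+
next
  case (eval_If_Node env e v T e1 v1 T1 e2)
  from eval_If_Node.prems show ?case by cases (use eval_If_Node.IH eval_If_Node.hyps in blast)+
next
  case (eval_If_Leaf env e T e2 v2 T2 e1)
  from eval_If_Leaf.prems show ?case by cases (use eval_If_Leaf.IH in blast)+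
next
  case (eval_Let env e1 v1 T1 e2 v2 T2)
  from eval_Let.prems show ?case by cases (use eval_Let.IH in blast)+
next
  case (eval_Call i env es vs T1 v T2)
  from eval_Call.prems show ?case by cases (use eval_Call.IH in blast)+
next
  case (evals_Nil env) from evals_Nil.prems show ?case by cases auto
next
  case (evals_Cons env e v T1 es vs T2)
  from evals_Cons.prems show ?case by cases (use evals_Cons.IH in blast)+
qed

definition runs_in :: "program \<Rightarrow> btree \<Rightarrow> btree \<Rightarrow> nat \<Rightarrow> bool" where
  "runs_in F x y T \<longleftrightarrow> eval F [x] (ECall 0 [EVar 0]) y T"

section \<open>Encoding of inputs and outputs\<close>

definition enc_bool :: "bool \<Rightarrow> btree" where
  "enc_bool b = (if b then BNode BLeaf BLeaf else BLeaf)"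

fun enc_list :: "btree list \<Rightarrow> btree" where
  "enc_list [] = BLeaf" | "enc_list (x # xs) = BNode x (enc_list xs)"

text \<open>Binary representation without leading zeros, least significant bit first.\<close>

fun enc_nat :: "nat \<Rightarrow> btree" where
  "enc_nat n = (if n = 0 then BLeaf else BNode (enc_bool (odd n)) (enc_nat (n div 2)))"

declare enc_nat.simps [simp del]

definition enc_int :: "int \<Rightarrow> btree" where
  "enc_int z = BNode (enc_bool (z < 0)) (enc_nat (nat \<bar>z\<bar>))"

definition enc_frac :: "frac \<Rightarrow> btree" where
  "enc_frac q = BNode (enc_int (fst q)) (enc_nat (snd q))"

definition enc_rat :: "rat \<Rightarrow> btree" where
  "enc_rat t = (case quotient_of t of (a, b) \<Rightarrow> enc_frac (a, nat b))"

definition enc_nats :: "nat list \<Rightarrow> btree" where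
  "enc_nats xs = enc_list (map enc_nat xs)"

text \<open>Predicates are given by their truth tables.\<close>

definition enc_constr :: "nat \<Rightarrow> constr \<Rightarrow> btree" where
  "enc_constr d c = BNode (enc_nats (fst c))
     (enc_list (map (\<lambda>\<sigma>. enc_bool (\<sigma> \<in> snd c)) (List.n_lists d [-1, 1])))"

definition enc_csp :: "nat \<Rightarrow> csp \<Rightarrow> btree" where
  "enc_csp d I = BNode (enc_nat (nvars I)) (enc_list (map (enc_constr d) (constrs I)))"

text \<open>The parameter \<open>p\<close> is given by the integer \<open>k = p n\<close>.\<close>

definition enc_input :: "nat \<Rightarrow> csp \<Rightarrow> rat \<Rightarrow> nat \<Rightarrow> btree" where
  "enc_input d I t k = BNode (enc_csp d I) (BNode (enc_rat t) (enc_nat k))"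

definition enc_mlpoly :: "mlpoly \<Rightarrow> btree" where
  "enc_mlpoly g = enc_list (map (\<lambda>(S, q). BNode (enc_nats S) (enc_frac q)) g)"

fun enc_outcome :: "outcome \<Rightarrow> btree" where
  "enc_outcome (Kernel V g) = BNode (enc_nats V) (enc_mlpoly g)"
| "enc_outcome Certified = BLeaf"

lemma enc_bool_inj: "enc_bool a = enc_bool b \<Longrightarrow> a = b"
  by (auto simp: enc_bool_def split: if_splits)

lemma enc_nat_inj: "enc_nat m = enc_nat n \<Longrightarrow> m = n"
proof (induction m arbitrary: n rule: less_induct)
  case (less m)
  show ?case
  proof (cases "m = 0 \<or> n = 0")
    case True
    with less.prems show ?thesis
      by (auto simp: enc_nat.simps[of m] enc_nat.simps[of n] split: if_splits)
  next
    case False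
    hence "enc_bool (odd m) = enc_bool (odd n)" "enc_nat (m div 2) = enc_nat (n div 2)"
      using less.prems by (auto simp: enc_nat.simps[of m] enc_nat.simps[of n])
    moreover from this(2) have "m div 2 = n div 2" using less.IH[of "m div 2"] False by simp
    ultimately show ?thesis using enc_bool_inj by (metis bit_eq_rec)
  qed
qed

lemma enc_list_map_inj:
  assumes "\<And>x y. f x = f y \<Longrightarrow> x = y"
  shows "enc_list (map f xs) = enc_list (map f ys) \<Longrightarrow> xs = ys"
proof (induction xs arbitrary: ys)
  case Nil then show ?case by (cases ys) auto
next
  case (Cons x xs) then show ?case by (cases ys) (auto dest: assms)
qed

lemma enc_int_inj: "enc_int a = enc_int b \<Longrightarrow> a = b"
  unfolding enc_int_def by (auto dest!: enc_bool_inj enc_nat_inj)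

lemma enc_frac_inj: "enc_frac q = enc_frac r \<Longrightarrow> q = r"
  unfolding enc_frac_def by (auto dest!: enc_int_inj enc_nat_inj intro: prod_eqI)

lemma enc_nats_inj: "enc_nats xs = enc_nats ys \<Longrightarrow> xs = ys"
  unfolding enc_nats_def by (rule enc_list_map_inj) (rule enc_nat_inj)

lemma enc_mlpoly_inj: "enc_mlpoly g = enc_mlpoly h \<Longrightarrow> g = h"
  unfolding enc_mlpoly_def
  by (rule enc_list_map_inj) (auto dest: enc_nats_inj enc_frac_inj)

lemma enc_outcome_inj: "enc_outcome r = enc_outcome s \<Longrightarrow> r = s"
  by (cases r; cases s) (auto dest: enc_nats_inj enc_mlpoly_inj)

end

theory Submission
  imports Defs "HOL-Combinatorics.Permutations"
begin

text \<open>
  Let \<open>f\<close> be the number of satisfied constraints on the slice of points with \<open>k = p n\<close> negative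
  coordinates, and call \<open>i\<close> and \<open>j\<close> interchangeable if the transposition \<open>(i j)\<close> does not change \<open>f\<close> on
  the slice. Since \<open>f\<close> has degree at most \<open>d\<close>, this can be decided by evaluating \<open>f\<close> at the \<open>n\<^sup>O\<^sup>(\<^sup>d\<^sup>)\<close>
  points within \<open>d\<close> swaps of a fixed one. If \<open>V\<close> is the complement of a class of at least \<open>k\<close>
  interchangeable variables, then \<open>f\<close> on the slice is a function of the variables in \<open>V\<close>, and its
  Moebius expansion stops at degree \<open>d\<close>; this is the kernel.

  Suppose that every class has at least \<open>s\<close> variables outside, with equality for some class. If \<open>i\<close> and
  \<open>j\<close> are not interchangeable, then \<open>f\<close> changes under \<open>(i j)\<close> at a constant fraction of the slice. Pair up
  coordinates of opposite sign at random. Flipping pairs gives a function of degree at most \<open>d\<close> on a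
  cube; its total influence has expectation of order \<open>s\<close> at least, and never exceeds \<open>s\<close>, because a pair
  inside the class with \<open>s\<close> variables outside has no influence. By hypercontractivity on the cube the
  mean absolute deviation of \<open>f\<close> from its average is at least of order \<open>sqrt s\<close>, hence so is the
  difference of the maximum and the average.
\<close>

section \<open>Functions of low degree on slices\<close>

text \<open>The delicate point is the passage from influence to deviation. On one cube, a number
  \<open>J\<close> of sensitive pairs bounds the mean deviation below only by a multiple of sqrt
  \<open>J\<close>, and averaging a square root over pairings goes the wrong way: a large
  expectation of \<open>J\<close> might come from a few pairings. The cap \<open>J \<le> s\<close>
  repairs this, since then sqrt \<open>J\<close> is at least \<open>J / sqrt s\<close>, which is
  linear in \<open>J\<close>. Absolute deviations are used because positive and negative ones
  balance, so maximum minus average is at least half of their mean. Two thresholds appear because a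
  class can complete points only if it has at least \<open>k\<close> members. If \<open>n\<close> is
  at most \<open>K1\<close> times the square of \<open>t\<close>, all variables are kept. Otherwise
  a class with at most \<open>K2\<close> times that square outside misses at most
  \<open>p0 * n \<le> n - k\<close> variables, provided \<open>K2 \<le> p0 * K1\<close>. If every
  class misses more, \<open>threshold p0 d \<le> K2\<close> gives the certificate. The constant of
  the theorem leaves room for both thresholds and their rounding.\<close>

text \<open>A point of the slice is represented by the set \<open>M\<close> of its coordinates equal to \<open>-1\<close>.\<close>

abbreviation (input) transp :: "'a \<Rightarrow> 'a \<Rightarrow> 'a \<Rightarrow> 'a" where
  "transp \<equiv> Transposition.transpose"

text \<open>These are the polynomials of degree at most \<open>d\<close> in the indicators of
  \<open>i \<in> M\<close>. The inductive form spares a choice of coefficients: a property preserved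
  by sums has to be checked only for functions of at most \<open>d\<close> coordinates.\<close>

inductive junta_sum :: "nat \<Rightarrow> ('a set \<Rightarrow> real) \<Rightarrow> bool" for d where
  junta: "finite S \<Longrightarrow> card S \<le> d \<Longrightarrow> (\<And>M. f M = f (M \<inter> S)) \<Longrightarrow> junta_sum d f"
| add: "junta_sum d f \<Longrightarrow> junta_sum d g \<Longrightarrow> junta_sum d (\<lambda>M. f M + g M)"

lemma junta_sum_uminus: "junta_sum d f \<Longrightarrow> junta_sum d (\<lambda>M. - f M)"
proof (induction rule: junta_sum.induct)
  case (junta S f)
  show ?case by (rule junta_sum.junta[OF junta(1,2)]) (subst junta(3), simp)
next
  case (add f g)
  thus ?case using junta_sum.add[OF add.IH] by simp
qed

lemma junta_sum_diff: "junta_sum d f \<Longrightarrow> junta_sum d g \<Longrightarrow> junta_sum d (\<lambda>M. f M - g M)"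
  using junta_sum.add[OF _ junta_sum_uminus] by simp

lemma junta_sum_image:
  assumes "junta_sum d f" "inj \<pi>"
  shows "junta_sum d (\<lambda>M. f (\<pi> ` M))"
  using assms(1)
proof induction
  case (junta S f)
  have "card (\<pi> -` S) \<le> card S"
    using junta(1) by (metis assms(2) card_vimage_inj_on_le Int_UNIV_right)
  moreover have "finite (\<pi> -` S)" using junta(1) assms(2) by (simp add: finite_vimageI)
  moreover have "f (\<pi> ` M) = f (\<pi> ` (M \<inter> \<pi> -` S))" for M
  proof -
    have "\<pi> ` M \<inter> S = \<pi> ` (M \<inter> \<pi> -` S) \<inter> S" by auto
    thus ?thesis using junta(3)[of "\<pi> ` M"] junta(3)[of "\<pi> ` (M \<inter> \<pi> -` S)"] by simp
  qed
  ultimately show ?case using junta(2) by (intro junta_sum.junta[of "\<pi> -` S"]) auto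
next
  case (add f g)
  thus ?case by (intro junta_sum.add)
qed

section \<open>Alternating sums as a notion of degree on a slice\<close>

lemma sum_Pow_insert:
  assumes "finite A" "a \<notin> A"
  shows "(\<Sum>Y\<in>Pow (insert a A). F Y) = (\<Sum>Y\<in>Pow A. F Y + F (insert a Y) :: 'b :: comm_monoid_add)"
proof -
  have "inj_on (insert a) (Pow A)" using assms(2) by (auto simp: inj_on_def)
  moreover have "Pow A \<inter> insert a ` Pow A = {}" using assms(2) by auto
  ultimately show ?thesis using assms(1)
    by (simp add: Pow_insert sum.union_disjoint sum.reindex sum.distrib)
qed

text \<open>The terms of \<open>Y\<close> and \<open>insert a Y\<close> have opposite signs and
  cancel.\<close>

lemma alternating_sum_eq_0:
  fixes F :: "'a set \<Rightarrow> real"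
  assumes "finite A" "a \<in> A" "\<And>Y. Y \<subseteq> A - {a} \<Longrightarrow> F (insert a Y) = F Y"
  shows "(\<Sum>Y\<in>Pow A. (-1) ^ card Y * F Y) = 0"
proof -
  have "(\<Sum>Y\<in>Pow (insert a (A - {a})). (-1) ^ card Y * F Y)
      = (\<Sum>Y\<in>Pow (A - {a}). (-1) ^ card Y * F Y + (-1) ^ card (insert a Y) * F (insert a Y))"
    using assms(1) by (intro sum_Pow_insert) auto
  also have "\<dots> = (\<Sum>Y\<in>Pow (A - {a}). 0)"
  proof (intro sum.cong refl)
    fix Y assume Y: "Y \<in> Pow (A - {a})"
    hence "finite Y" "a \<notin> Y" using assms(1) finite_subset by auto
    thus "(-1) ^ card Y * F Y + (-1) ^ card (insert a Y) * F (insert a Y) = 0"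
      using assms(3)[of Y] Y by simp
  qed
  finally show ?thesis using assms(2) by (simp add: insert_absorb)
qed

text \<open>Degree is expressed by alternating sums over swaps along disjoint pairs \<open>(a, \<beta> a)\<close>, which depends
  on the values on the slice only, unlike the degree of a representing polynomial.\<close>

definition deg_le :: "nat \<Rightarrow> 'a set \<Rightarrow> nat \<Rightarrow> ('a set \<Rightarrow> real) \<Rightarrow> bool" where
  "deg_le D N k h \<longleftrightarrow> (\<forall>M A \<beta>. M \<subseteq> N \<longrightarrow> card M = k \<longrightarrow> A \<subseteq> M \<longrightarrow> card A > D \<longrightarrow>
     inj_on \<beta> A \<longrightarrow> \<beta> ` A \<subseteq> N - M \<longrightarrow>
     (\<Sum>Y\<in>Pow A. (-1) ^ card Y * h ((M - Y) \<union> \<beta> ` Y)) = 0)"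

lemma deg_leD:
  assumes "deg_le D N k h" "M \<subseteq> N" "card M = k" "A \<subseteq> M" "D < card A" "inj_on \<beta> A" "\<beta> ` A \<subseteq> N - M"
  shows "(\<Sum>Y\<in>Pow A. (-1) ^ card Y * h ((M - Y) \<union> \<beta> ` Y)) = 0"
  using assms unfolding deg_le_def by blast

lemma deg_leI:
  assumes "\<And>M A \<beta>. M \<subseteq> N \<Longrightarrow> card M = k \<Longrightarrow> A \<subseteq> M \<Longrightarrow> D < card A \<Longrightarrow> inj_on \<beta> A \<Longrightarrow>
    \<beta> ` A \<subseteq> N - M \<Longrightarrow> (\<Sum>Y\<in>Pow A. (-1) ^ card Y * h ((M - Y) \<union> \<beta> ` Y)) = 0"
  shows "deg_le D N k h"
  using assms unfolding deg_le_def by blast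

text \<open>By the pigeonhole principle one of the more than \<open>d\<close> disjoint pairs misses
  all relevant coordinates of a junta. Swapping this pair does not change the value, so the sum
  cancels along it.\<close>

lemma junta_sum_alternating:
  assumes "junta_sum d f" "finite A" "card A > d" "inj_on \<beta> A" "\<beta> ` A \<inter> A = {}"
  shows "(\<Sum>Y\<in>Pow A. (-1) ^ card Y * f ((M - Y) \<union> \<beta> ` Y)) = 0"
  using assms(1)
proof induction
  case (junta S f)
  have "\<exists>a\<in>A. a \<notin> S \<and> \<beta> a \<notin> S"
  proof (rule ccontr)
    assume "\<not> ?thesis"
    hence sub: "(\<lambda>a. if a \<in> S then a else \<beta> a) ` A \<subseteq> S" by auto
    have "inj_on (\<lambda>a. if a \<in> S then a else \<beta> a) A"
      using assms(4,5) unfolding inj_on_def by (auto split: if_splits)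
    hence "card A \<le> card S" using sub junta(1) card_inj_on_le by blast
    thus False using junta(2) assms(3) by simp
  qed
  then obtain a where a: "a \<in> A" "a \<notin> S" "\<beta> a \<notin> S" by blast
  show ?case
  proof (rule alternating_sum_eq_0[OF assms(2) a(1)])
    fix Y assume "Y \<subseteq> A - {a}"
    have "((M - insert a Y) \<union> \<beta> ` insert a Y) \<inter> S = ((M - Y) \<union> \<beta> ` Y) \<inter> S" using a by auto
    thus "f ((M - insert a Y) \<union> \<beta> ` insert a Y) = f ((M - Y) \<union> \<beta> ` Y)"
      using junta(3) by metis
  qed
next
  case (add f g)
  thus ?case by (simp add: algebra_simps sum.distrib)
qed

lemma junta_sum_deg_le: "finite N \<Longrightarrow> junta_sum d f \<Longrightarrow> deg_le d N k f"
proof (intro deg_leI junta_sum_alternating)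
  fix M A \<beta>
  assume *: "finite N" "M \<subseteq> N" "A \<subseteq> M" "\<beta> ` A \<subseteq> N - M"
  show "finite A" using * by (meson finite_subset)
  show "\<beta> ` A \<inter> A = {}" using * by blast
qed

text \<open>The swapped elements lie in \<open>M\<close> and their partners outside, so a sum with
  more than \<open>min k (card N - k)\<close> swaps does not exist. This supplies the size
  assumptions of the count of nonzero points.\<close>

lemma deg_le_min:
  assumes "finite N" "deg_le d N k f" "k \<le> card N"
  shows "deg_le (min d (min k (card N - k))) N k f"
proof (rule deg_leI)
  fix M A \<beta>
  assume *: "M \<subseteq> N" "card M = k" "A \<subseteq> M" "min d (min k (card N - k)) < card A" "inj_on \<beta> A" "\<beta> ` A \<subseteq> N - M"
  have "finite M" using *(1) assms(1) finite_subset by blast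
  hence "card A \<le> k" using *(2,3) card_mono by blast
  moreover have "card A \<le> card N - k"
    using card_inj_on_le[OF *(5,6)] assms(1) *(1,2) by (simp add: card_Diff_subset \<open>finite M\<close>)
  ultimately have "d < card A" using *(4) by auto
  thus "(\<Sum>Y\<in>Pow A. (-1) ^ card Y * f ((M - Y) \<union> \<beta> ` Y)) = 0"
    using deg_leD[OF assms(2) *(1-3) _ *(5,6)] by blast
qed

text \<open>A vanishing alternating sum over the swaps that lead from \<open>M0\<close> to \<open>M\<close> expresses \<open>h M\<close> by values
  at points closer to \<open>M0\<close>.\<close>

lemma deg_le_hitting:
  assumes "finite N" "deg_le D N k h" "M0 \<subseteq> N" "card M0 = k"
    and zero: "\<And>M. M \<subseteq> N \<Longrightarrow> card M = k \<Longrightarrow> card (M0 - M) \<le> D \<Longrightarrow> h M = 0"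
    and "M \<subseteq> N" "card M = k"
  shows "h M = 0"
  using assms(6,7)
proof (induction "card (M0 - M)" arbitrary: M rule: less_induct)
  case less
  show ?case
  proof (cases "card (M0 - M) \<le> D")
    case True
    thus ?thesis using zero less.prems by blast
  next
    case False
    have fin: "finite M0" "finite M" using assms(1,3) less.prems finite_subset by auto
    have "card (M0 - M) = card (M - M0)"
      using fin assms(4) less.prems(2) by (simp add: card_Diff_subset_Int Int_commute)
    then obtain \<beta> where \<beta>: "bij_betw \<beta> (M0 - M) (M - M0)"
      using fin by (metis finite_Diff finite_same_card_bij)
    let ?A = "M0 - M"
    have inj: "inj_on \<beta> ?A" and img: "\<beta> ` ?A = M - M0" using \<beta> by (auto simp: bij_betw_def)
    have 0: "(\<Sum>Y\<in>Pow ?A. (-1) ^ card Y * h ((M0 - Y) \<union> \<beta> ` Y)) = 0"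
      using False inj img less.prems by (intro deg_leD[OF assms(2,3,4)]) auto
    \<comment> \<open>A proper subset \<open>Y\<close> of the swaps leads to a point at distance
      \<open>card Y\<close> from \<open>M0\<close>, where the induction hypothesis applies. Only the
      full swap, which yields \<open>M\<close>, survives.\<close>
    have "(\<Sum>Y\<in>Pow ?A - {?A}. (-1) ^ card Y * h ((M0 - Y) \<union> \<beta> ` Y)) = 0"
    proof (intro sum.neutral ballI)
      fix Y assume Y: "Y \<in> Pow ?A - {?A}"
      let ?M = "(M0 - Y) \<union> \<beta> ` Y"
      have sub: "\<beta> ` Y \<subseteq> M - M0" using Y img by blast
      have finY: "finite Y" using Y fin finite_subset by auto
      have "card ?M = card (M0 - Y) + card (\<beta> ` Y)"
        using sub fin finY by (intro card_Un_disjoint) auto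
      also have "card (\<beta> ` Y) = card Y" using Y inj by (intro card_image) (auto intro: inj_on_subset)
      also have "card Y \<le> card M0" using Y fin by (intro card_mono) auto
      hence "card (M0 - Y) + card Y = k"
        using Y finY assms(4) by (subst card_Diff_subset) auto
      finally have cM: "card ?M = k" .
      have "M0 - ?M = Y" using Y sub by auto
      moreover have "card Y < card ?A" using Y fin by (intro psubset_card_mono) auto
      moreover have "?M \<subseteq> N" using assms(3) less.prems sub by auto
      ultimately have "h ?M = 0" using less.hyps cM by simp
      thus "(-1) ^ card Y * h ?M = 0" by simp
    qed
    hence "(-1) ^ card ?A * h ((M0 - ?A) \<union> \<beta> ` ?A) = 0"
      using 0 fin by (subst (asm) sum.remove[of _ ?A]) auto
    moreover have "(M0 - ?A) \<union> \<beta> ` ?A = M" using img by auto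
    ultimately show ?thesis by simp
  qed
qed

text \<open>Applying Pascal's rule twice to the coefficient for \<open>m\<close> exhibits the one
  for \<open>Suc m\<close> as a summand.\<close>

lemma choose_le_choose_diag: "(n - 2 * D) choose (k - D) \<le> (n - 2 * e) choose (k - e)"
  if "e \<le> D" "D \<le> k" "D + k \<le> n"
  using that
proof (induction rule: dec_induct)
  case (step m)
  have "n - 2 * m = Suc (Suc (n - 2 * Suc m))" "k - m = Suc (k - Suc m)" using step.prems by auto
  hence "(n - 2 * Suc m) choose (k - Suc m) \<le> (n - 2 * m) choose (k - m)"
    by (simp only: binomial_Suc_Suc)
  thus ?case using step by simp
qed simp

text \<open>Take a nonzero alternating sum with as many swaps as possible. Adding one more swap gives zero,
  so the sum does not change when the point moves outside the pairs that are involved, and the sum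
  is nonzero for all those points.\<close>

lemma deg_le_count_nonzero:
  fixes N :: "'a set"
  assumes "finite N" "deg_le D N k h" "D \<le> k" "D + k \<le> card N"
    and "M \<subseteq> N" "card M = k" "h M \<noteq> 0"
  shows "((card N - 2 * D) choose (k - D)) \<le> card {M. M \<subseteq> N \<and> card M = k \<and> h M \<noteq> 0}"
proof -
  define s where "s = (\<lambda>M A \<beta>. \<Sum>Y\<in>Pow A. (-1) ^ card Y * h ((M - Y) \<union> \<beta> ` Y))"
  define ok where "ok = (\<lambda>M A (\<beta> :: 'a \<Rightarrow> 'a). M \<subseteq> N \<and> card M = k \<and> A \<subseteq> M \<and> inj_on \<beta> A \<and> \<beta> ` A \<subseteq> N - M)"
  define Q where "Q = (\<lambda>e. \<exists>M A \<beta>. ok M A \<beta> \<and> card A = e \<and> s M A \<beta> \<noteq> 0)"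
  have "Q 0" unfolding Q_def using assms(5-7)
    by (intro exI[of _ M] exI[of _ "{}"] exI[of _ id]) (auto simp: ok_def s_def)
  have QD: "e \<le> D" if Q: "Q e" for e
  proof (rule ccontr)
    obtain M A \<beta> where *: "ok M A \<beta>" "card A = e" "s M A \<beta> \<noteq> 0" using Q unfolding Q_def by blast
    assume "\<not> e \<le> D"
    hence "s M A \<beta> = 0"
      unfolding s_def using * by (intro deg_leD[OF assms(2)]) (auto simp: ok_def)
    thus False using *(3) by simp
  qed
  define e where "e = Max (Collect Q)"
  have fin: "finite (Collect Q)" by (rule finite_subset[of _ "{..D}"]) (auto dest: QD)
  hence "Q e" and max: "\<And>e'. Q e' \<Longrightarrow> e' \<le> e"
    using Max_in[OF fin] \<open>Q 0\<close> unfolding e_def by auto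
  obtain M A \<beta> where ok: "ok M A \<beta>" and A: "card A = e" and nz: "s M A \<beta> \<noteq> 0"
    using \<open>Q e\<close> unfolding Q_def by blast
  have e: "e \<le> D" using QD \<open>Q e\<close> .
  have finM: "finite M" if "ok M A \<beta>" for M using that assms(1) finite_subset unfolding ok_def by blast
  have finA: "finite A" using finM[OF ok] ok finite_subset unfolding ok_def by blast
  have step: "s (insert v (M - {j})) A \<beta> = s M A \<beta>"
    if M: "ok M A \<beta>" and jv: "j \<in> M - A" "v \<in> N - M - \<beta> ` A" for M j v
  proof -
    define \<gamma> where "\<gamma> = \<beta>(j := v)"
    have \<gamma>: "\<gamma> ` Y = \<beta> ` Y" "\<gamma> ` insert j Y = insert v (\<beta> ` Y)" if "Y \<subseteq> A" for Y
      using that jv by (auto simp: \<gamma>_def)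
    have "ok M (insert j A) \<gamma>"
      using M jv \<gamma>[of A] unfolding ok_def by (auto simp: \<gamma>_def inj_on_def)
    moreover have "\<not> card (insert j A) \<le> e" using A finA jv by simp
    ultimately have "s M (insert j A) \<gamma> = 0" using max[of "card (insert j A)"] unfolding Q_def by blast
    also have "s M (insert j A) \<gamma> = (\<Sum>Y\<in>Pow A. (-1) ^ card Y * h ((M - Y) \<union> \<gamma> ` Y) +
        (-1) ^ card (insert j Y) * h ((M - insert j Y) \<union> \<gamma> ` insert j Y))"
      unfolding s_def using finA jv by (intro sum_Pow_insert) auto
    also have "\<dots> = (\<Sum>Y\<in>Pow A. (-1) ^ card Y * h ((M - Y) \<union> \<beta> ` Y) -
        (-1) ^ card Y * h ((insert v (M - {j}) - Y) \<union> \<beta> ` Y))"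
    proof (intro sum.cong refl)
      fix Y assume Y: "Y \<in> Pow A"
      have "(M - insert j Y) \<union> \<gamma> ` insert j Y = (insert v (M - {j}) - Y) \<union> \<beta> ` Y"
        using Y jv M \<gamma>(2)[of Y] unfolding ok_def by auto
      moreover have "finite Y" "j \<notin> Y" using Y finA jv finite_subset by auto
      ultimately show "(-1) ^ card Y * h ((M - Y) \<union> \<gamma> ` Y) +
          (-1) ^ card (insert j Y) * h ((M - insert j Y) \<union> \<gamma> ` insert j Y)
        = (-1) ^ card Y * h ((M - Y) \<union> \<beta> ` Y) - (-1) ^ card Y * h ((insert v (M - {j}) - Y) \<union> \<beta> ` Y)"
        using \<gamma>(1)[of Y] Y by simp
    qed
    finally show ?thesis by (simp add: s_def sum_subtractf)
  qed
  \<comment> \<open>Two points that contain \<open>A\<close> and avoid its partners are joined by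
    single exchanges, each of which brings \<open>M'\<close> closer to \<open>M\<close>.\<close>
  have all_nz: "s M' A \<beta> \<noteq> 0" if "ok M' A \<beta>" for M'
    using that
  proof (induction "card (M' - M)" arbitrary: M' rule: less_induct)
    case less
    have eq: "card M' = card M" using less.prems ok by (simp add: ok_def)
    show ?case
    proof (cases "M' \<subseteq> M")
      case True
      hence "M' = M" using finM[OF ok] eq by (simp add: card_subset_eq)
      thus ?thesis using nz by simp
    next
      case False
      then obtain j where j: "j \<in> M'" "j \<notin> M" by blast
      have "\<not> M \<subseteq> M'" using False finM[OF less.prems] eq by (metis card_subset_eq order_refl)
      then obtain v where v: "v \<in> M" "v \<notin> M'" by blast
      have jv: "j \<in> M' - A" "v \<in> N - M' - \<beta> ` A" using j v ok unfolding ok_def by auto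
      let ?M = "insert v (M' - {j})"
      have "card ?M = Suc (card (M' - {j}))" using finM[OF less.prems] v by simp
      also have "\<dots> = card M'" by (rule card_Suc_Diff1[OF finM[OF less.prems] j(1)])
      finally have "card ?M = k" using less.prems by (simp add: ok_def)
      hence "ok ?M A \<beta>" using less.prems jv unfolding ok_def by auto
      moreover have "?M - M \<subset> M' - M" using j v by auto
      hence "card (?M - M) < card (M' - M)" using finM[OF less.prems] by (intro psubset_card_mono) auto
      ultimately have "s ?M A \<beta> \<noteq> 0" using less.hyps by blast
      thus ?thesis using step[OF less.prems jv] by simp
    qed
  qed
  define R where "R = N - A - \<beta> ` A"
  have sub: "A \<subseteq> N" "\<beta> ` A \<subseteq> N" "A \<inter> \<beta> ` A = {}" and inj: "inj_on \<beta> A"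
    using ok unfolding ok_def by auto
  have finR: "finite R" using assms(1) by (simp add: R_def)
  have "R = N - (A \<union> \<beta> ` A)" by (auto simp: R_def)
  hence "card R = card N - card (A \<union> \<beta> ` A)" using sub finA by (simp add: card_Diff_subset)
  also have "card (A \<union> \<beta> ` A) = 2 * e" using sub(3) finA A card_image[OF inj] by (simp add: card_Un_disjoint)
  finally have cR: "card R = card N - 2 * e" .
  let ?Z = "{Z. Z \<subseteq> R \<and> card Z = k - e}" and ?C = "{M. M \<subseteq> N \<and> card M = k \<and> h M \<noteq> 0}"
  \<comment> \<open>The free coordinates \<open>R\<close> may be filled by any \<open>Z\<close>. The
    nonzero sum at \<open>Z \<union> A\<close> has a nonzero term, and its point has trace
    \<open>Z\<close> on \<open>R\<close>; so different \<open>Z\<close> give different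
    points.\<close>
  have "\<exists>M'\<in>?C. M' \<inter> R = Z" if Z: "Z \<in> ?Z" for Z
  proof -
    have finZ: "finite Z" using Z finR finite_subset by auto
    have "Z \<inter> A = {}" "Z \<inter> \<beta> ` A = {}" "Z \<subseteq> N" using Z by (auto simp: R_def)
    hence ok': "ok (Z \<union> A) A \<beta>"
      using Z finZ finA A e assms(3) sub inj by (auto simp: ok_def card_Un_disjoint)
    obtain Y where Y: "Y \<subseteq> A" "h ((Z \<union> A - Y) \<union> \<beta> ` Y) \<noteq> 0"
      using all_nz[OF ok'] unfolding s_def by (metis (no_types, lifting) Pow_iff mult_zero_right sum.neutral)
    let ?M = "(Z \<union> A - Y) \<union> \<beta> ` Y"
    have finY: "finite Y" using Y finA finite_subset by blast
    have "\<beta> ` Y \<inter> (Z \<union> A - Y) = {}" using Y \<open>Z \<inter> \<beta> ` A = {}\<close> sub by blast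
    hence "card ?M = card (Z \<union> A - Y) + card (\<beta> ` Y)"
      using finZ finA finY by (intro card_Un_disjoint) auto
    also have "card (\<beta> ` Y) = card Y" using Y inj by (intro card_image) (auto intro: inj_on_subset)
    also have "card Y \<le> card (Z \<union> A)" using Y finZ finA by (intro card_mono) auto
    hence "card (Z \<union> A - Y) + card Y = k"
      using Y finY ok' by (subst card_Diff_subset) (auto simp: ok_def)
    finally have "?M \<in> ?C" using Y sub \<open>Z \<subseteq> N\<close> by auto
    moreover have "?M \<inter> R = Z" using Y Z by (auto simp: R_def)
    ultimately show ?thesis by blast
  qed
  hence "?Z \<subseteq> (\<lambda>M'. M' \<inter> R) ` ?C" by blast
  moreover have "finite ?C" using assms(1) by simp
  ultimately have "card ?Z \<le> card ?C" by (rule surj_card_le[rotated])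
  hence "(card N - 2 * e) choose (k - e) \<le> card ?C" using n_subsets[OF finR] cR by simp
  thus ?thesis using choose_le_choose_diag[OF e assms(3,4)] by linarith
qed

section \<open>Low degree functions on the cube\<close>

definition cube_avg :: "nat \<Rightarrow> (nat set \<Rightarrow> real) \<Rightarrow> real" where
  "cube_avg m g = (\<Sum>Y\<in>Pow {..<m}. g Y) / 2 ^ m"

lemma cube_avg_0: "cube_avg 0 g = g {}"
  by (simp add: cube_avg_def)

lemma cube_avg_Suc:
  "cube_avg (Suc m) g = cube_avg m (\<lambda>Y. (g Y + g (insert m Y)) / 2)"
proof -
  have "(\<Sum>Y\<in>Pow {..<Suc m}. g Y) = (\<Sum>Y\<in>Pow {..<m}. g Y + g (insert m Y))"
    unfolding lessThan_Suc by (intro sum_Pow_insert) auto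
  thus ?thesis by (simp add: cube_avg_def sum_divide_distrib[symmetric])
qed

lemma cube_avg_cong: "(\<And>Y. Y \<subseteq> {..<m} \<Longrightarrow> f Y = g Y) \<Longrightarrow> cube_avg m f = cube_avg m g"
  unfolding cube_avg_def by (auto intro!: sum.cong arg_cong[where f = "\<lambda>x. x / _"])

lemma cube_avg_mono: "(\<And>Y. Y \<subseteq> {..<m} \<Longrightarrow> f Y \<le> g Y) \<Longrightarrow> cube_avg m f \<le> cube_avg m g"
  unfolding cube_avg_def by (intro divide_right_mono sum_mono) auto

lemma cube_avg_add: "cube_avg m (\<lambda>Y. f Y + g Y) = cube_avg m f + cube_avg m g"
  by (simp add: cube_avg_def sum.distrib add_divide_distrib)

lemma cube_avg_cmult: "cube_avg m (\<lambda>Y. c * f Y) = c * cube_avg m f"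
  by (simp add: cube_avg_def sum_distrib_left)

lemma cube_avg_divide: "cube_avg m (\<lambda>Y. f Y / c) = cube_avg m f / c"
  by (simp add: cube_avg_def sum_divide_distrib[symmetric] ac_simps)

lemma cube_avg_const [simp]: "cube_avg m (\<lambda>Y. c) = c"
  by (simp add: cube_avg_def card_Pow)

lemma cube_avg_nonneg: "(\<And>Y. f Y \<ge> 0) \<Longrightarrow> cube_avg m f \<ge> 0"
  using cube_avg_mono[of m "\<lambda>_. 0" f] by simp

lemma cube_avg_Cauchy_Schwarz:
  "(cube_avg m (\<lambda>Y. f Y * g Y))\<^sup>2 \<le> cube_avg m (\<lambda>Y. (f Y)\<^sup>2) * cube_avg m (\<lambda>Y. (g Y)\<^sup>2)"
proof -
  have "(cube_avg m (\<lambda>Y. f Y * g Y))\<^sup>2 = (\<Sum>Y\<in>Pow {..<m}. f Y * g Y)\<^sup>2 / (2 ^ m)\<^sup>2"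
    by (simp add: cube_avg_def power_divide)
  also have "\<dots> \<le> ((\<Sum>Y\<in>Pow {..<m}. (f Y)\<^sup>2) * (\<Sum>Y\<in>Pow {..<m}. (g Y)\<^sup>2)) / (2 ^ m)\<^sup>2"
    by (intro divide_right_mono Cauchy_Schwarz_ineq_sum) auto
  also have "\<dots> = cube_avg m (\<lambda>Y. (f Y)\<^sup>2) * cube_avg m (\<lambda>Y. (g Y)\<^sup>2)"
    by (simp add: cube_avg_def power2_eq_square)
  finally show ?thesis .
qed

text \<open>The Fourier degree on the cube of subsets of \<open>{0, \<dots>, m - 1}\<close> is at most \<open>d\<close>, phrased by
  splitting off the last coordinate.\<close>

fun cube_deg :: "nat \<Rightarrow> nat \<Rightarrow> (nat set \<Rightarrow> real) \<Rightarrow> bool" where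
  "cube_deg 0 d g = True"
| "cube_deg (Suc m) d g = (cube_deg m d (\<lambda>Y. (g Y + g (insert m Y)) / 2) \<and>
     (case d of 0 \<Rightarrow> (\<forall>Y\<subseteq>{..<m}. g (insert m Y) = g Y)
      | Suc e \<Rightarrow> cube_deg m e (\<lambda>Y. (g Y - g (insert m Y)) / 2)))"

text \<open>If \<open>m\<close> is irrelevant, the difference along \<open>m\<close> vanishes. If it
  is relevant, both parts depend on one coordinate less, as the smaller degree of the difference
  part requires.\<close>

lemma cube_deg_junta:
  assumes "finite S" "card S \<le> d" "\<And>Y. Y \<subseteq> {..<m} \<Longrightarrow> g Y = g (Y \<inter> S)"
  shows "cube_deg m d g"
  using assms
proof (induction m arbitrary: S d g)
  case 0
  show ?case by simp
next
  case (Suc m)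
  have sub: "Y \<subseteq> {..<Suc m}" "insert m Y \<subseteq> {..<Suc m}" if "Y \<subseteq> {..<m}" for Y using that by auto
  have eq: "g (insert m Y) = g (insert m Y \<inter> S)" "g Y = g (Y \<inter> S)" if "Y \<subseteq> {..<m}" for Y
    using Suc.prems(3) sub[OF that] by blast+
  show ?case
  proof (cases "m \<in> S")
    case False
    have same: "g (insert m Y) = g Y" if "Y \<subseteq> {..<m}" for Y
      using eq[OF that] False by simp
    have "cube_deg m d (\<lambda>Y. (g Y + g (insert m Y)) / 2)"
    proof (rule Suc.IH[OF Suc.prems(1,2)])
      fix Y assume Y: "Y \<subseteq> {..<m}"
      hence "Y \<inter> S \<subseteq> {..<m}" by auto
      thus "(g Y + g (insert m Y)) / 2 = (g (Y \<inter> S) + g (insert m (Y \<inter> S))) / 2"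
        using same[of Y] same[of "Y \<inter> S"] Y eq(2)[OF Y] by simp
    qed
    moreover have "cube_deg m e (\<lambda>Y. (g Y - g (insert m Y)) / 2)" for e
      by (rule Suc.IH[of "{}"]) (use same[of "{}"] same in auto)
    ultimately show ?thesis using same by (simp split: nat.split)
  next
    case True
    then obtain e where e: "d = Suc e" using Suc.prems(1,2) by (cases d) auto
    have c: "finite (S - {m})" "card (S - {m}) \<le> e" "card (S - {m}) \<le> d"
      using Suc.prems True e by auto
    have 1: "g Y = g (Y \<inter> (S - {m}))" if "Y \<subseteq> {..<m}" for Y
    proof -
      have "Y \<inter> S = Y \<inter> (S - {m})" using that by auto
      thus ?thesis using eq(2)[OF that] by simp
    qed
    have 2: "g (insert m Y) = g (insert m (Y \<inter> (S - {m})))" if "Y \<subseteq> {..<m}" for Y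
    proof -
      have "insert m Y \<inter> S = insert m (Y \<inter> (S - {m})) \<inter> S" using that by auto
      moreover have "Y \<inter> (S - {m}) \<subseteq> {..<m}" using that by auto
      ultimately show ?thesis using eq(1)[OF that] eq(1)[of "Y \<inter> (S - {m})"] by simp
    qed
    have "cube_deg m d (\<lambda>Y. (g Y + g (insert m Y)) / 2)"
      by (rule Suc.IH[OF c(1,3)]) (metis 1 2)
    moreover have "cube_deg m e (\<lambda>Y. (g Y - g (insert m Y)) / 2)"
      by (rule Suc.IH[OF c(1,2)]) (metis 1 2)
    ultimately show ?thesis by (simp add: e)
  qed
qed

lemma cube_deg_add:
  "cube_deg m d f \<Longrightarrow> cube_deg m d g \<Longrightarrow> cube_deg m d (\<lambda>Y. f Y + g Y)"
proof (induction m arbitrary: d f g)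
  case (Suc m)
  have "(\<lambda>Y. (f Y + g Y + (f (insert m Y) + g (insert m Y))) / 2)
      = (\<lambda>Y. (f Y + f (insert m Y)) / 2 + (g Y + g (insert m Y)) / 2)"
    by (auto simp: field_simps)
  moreover have "(\<lambda>Y. (f Y + g Y - (f (insert m Y) + g (insert m Y))) / 2)
      = (\<lambda>Y. (f Y - f (insert m Y)) / 2 + (g Y - g (insert m Y)) / 2)"
    by (auto simp: field_simps)
  ultimately show ?case using Suc by (auto split: nat.splits)
qed simp

lemma cube_deg_diff_const: "cube_deg m d g \<Longrightarrow> cube_deg m d (\<lambda>Y. g Y - c)"
  using cube_deg_add[of m d g "\<lambda>_. - c"] cube_deg_junta[of "{}" d m "\<lambda>_. - c"] by simp

text \<open>Hypercontractivity (Bonami's lemma).\<close>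

lemma cube_avg_fourth_moment:
  "cube_deg m d g \<Longrightarrow> cube_avg m (\<lambda>Y. g Y ^ 4) \<le> 9 ^ d * (cube_avg m (\<lambda>Y. (g Y)\<^sup>2))\<^sup>2"
proof (induction m arbitrary: d g)
  case 0
  have "g {} ^ 4 * 1 \<le> g {} ^ 4 * 9 ^ d" by (intro mult_left_mono) auto
  thus ?case by (simp add: cube_avg_0 mult.commute)
next
  case (Suc m)
  \<comment> \<open>In the sign \<open>x\<close> of the last coordinate, \<open>g\<close> is
    \<open>p + x * q\<close>; the factor \<open>q\<close> has degree one less than
    \<open>g\<close>.\<close>
  define p where "p = (\<lambda>Y. (g Y + g (insert m Y)) / 2)"
  define q where "q = (\<lambda>Y. (g Y - g (insert m Y)) / 2)"
  define a where "a = cube_avg m (\<lambda>Y. (p Y)\<^sup>2)"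
  define b where "b = cube_avg m (\<lambda>Y. (q Y)\<^sup>2)"
  define c where "c = cube_avg m (\<lambda>Y. (p Y)\<^sup>2 * (q Y)\<^sup>2)"
  have g: "g Y = p Y + q Y" "g (insert m Y) = p Y - q Y" for Y
    by (simp_all add: p_def q_def field_simps)
  have nonneg: "a \<ge> 0" "b \<ge> 0" by (simp_all add: a_def b_def cube_avg_nonneg)
  have e4: "(g Y ^ 4 + g (insert m Y) ^ 4) / 2 = p Y ^ 4 + 6 * ((p Y)\<^sup>2 * (q Y)\<^sup>2) + q Y ^ 4" for Y
    unfolding g(1)[of Y] g(2)[of Y] by (simp add: power4_eq_xxxx power2_eq_square algebra_simps)
  have 4: "cube_avg (Suc m) (\<lambda>Y. g Y ^ 4)
      = cube_avg m (\<lambda>Y. p Y ^ 4) + 6 * c + cube_avg m (\<lambda>Y. q Y ^ 4)"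
    unfolding cube_avg_Suc e4 by (simp add: cube_avg_add cube_avg_cmult c_def)
  have e2: "((g Y)\<^sup>2 + (g (insert m Y))\<^sup>2) / 2 = (p Y)\<^sup>2 + (q Y)\<^sup>2" for Y
    unfolding g(1)[of Y] g(2)[of Y] by (simp add: power2_eq_square algebra_simps)
  have 2: "cube_avg (Suc m) (\<lambda>Y. (g Y)\<^sup>2) = a + b"
    unfolding cube_avg_Suc e2 by (simp add: cube_avg_add a_def b_def)
  have p4: "cube_avg m (\<lambda>Y. p Y ^ 4) \<le> 9 ^ d * a\<^sup>2"
    unfolding a_def by (rule Suc.IH) (use Suc.prems in \<open>simp add: p_def\<close>)
  show ?case
  proof (cases d)
    case 0
    hence q0: "q Y = 0" if "Y \<subseteq> {..<m}" for Y using Suc.prems that by (simp add: q_def)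
    have "c = 0" "cube_avg m (\<lambda>Y. q Y ^ 4) = 0" "b = 0"
      unfolding c_def b_def using q0 by (simp_all cong: cube_avg_cong)
    thus ?thesis using p4 unfolding 4 2 by simp
  next
    case (Suc e)
    have q4: "cube_avg m (\<lambda>Y. q Y ^ 4) \<le> 9 ^ e * b\<^sup>2"
      unfolding b_def by (rule Suc.IH) (use Suc.prems \<open>d = Suc e\<close> in \<open>simp add: q_def\<close>)
    \<comment> \<open>Cauchy-Schwarz on the mixed term; the geometric mean of \<open>9 ^ d\<close>
      and \<open>9 ^ e\<close> is \<open>3 * 9 ^ e\<close>.\<close>
    have "c\<^sup>2 \<le> cube_avg m (\<lambda>Y. p Y ^ 4) * cube_avg m (\<lambda>Y. q Y ^ 4)"
      using cube_avg_Cauchy_Schwarz[of m "\<lambda>Y. (p Y)\<^sup>2" "\<lambda>Y. (q Y)\<^sup>2"]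
      by (simp add: c_def power_mult[symmetric])
    also have "\<dots> \<le> (9 ^ d * a\<^sup>2) * (9 ^ e * b\<^sup>2)"
      using p4 q4 by (intro mult_mono) (auto intro!: cube_avg_nonneg)
    also have "\<dots> = (3 * 9 ^ e * a * b)\<^sup>2"
      by (simp add: Suc power2_eq_square algebra_simps)
    finally have "c\<^sup>2 \<le> (3 * 9 ^ e * a * b)\<^sup>2" .
    hence "c \<le> 3 * 9 ^ e * a * b"
      by (rule power2_le_imp_le) (use nonneg in auto)
    hence "cube_avg (Suc m) (\<lambda>Y. g Y ^ 4) \<le> 9 ^ d * a\<^sup>2 + 6 * (3 * 9 ^ e * a * b) + 9 ^ e * b\<^sup>2"
      using p4 q4 unfolding 4 by linarith
    \<comment> \<open>Giving away a factor 9 on the last term completes the square of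
      \<open>a + b\<close>.\<close>
    also have "\<dots> \<le> 9 ^ d * a\<^sup>2 + 6 * (3 * 9 ^ e * a * b) + 9 * (9 ^ e * b\<^sup>2)"
      by simp
    also have "\<dots> = 9 ^ d * (a + b)\<^sup>2" by (simp add: Suc power2_eq_square algebra_simps)
    finally show ?thesis unfolding 2 .
  qed
qed

text \<open>Interpolation between first and fourth moments without fractional powers: two
  applications of Cauchy-Schwarz give \<open>e2 ^ 4 \<le> e1\<^sup>2 * e2 * e4\<close>. After the
  fourth moment bound, \<open>e2 ^ 3\<close> can be cancelled.\<close>

lemma cube_avg_square_le:
  assumes "cube_deg m d g"
  shows "cube_avg m (\<lambda>Y. (g Y)\<^sup>2) \<le> 9 ^ d * (cube_avg m (\<lambda>Y. \<bar>g Y\<bar>))\<^sup>2"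
proof -
  define e1 e2 e3 e4 where "e1 = cube_avg m (\<lambda>Y. \<bar>g Y\<bar>)" and "e2 = cube_avg m (\<lambda>Y. (g Y)\<^sup>2)"
    and "e3 = cube_avg m (\<lambda>Y. \<bar>g Y\<bar> ^ 3)" and "e4 = cube_avg m (\<lambda>Y. g Y ^ 4)"
  note defs = e1_def e2_def e3_def e4_def
  have nonneg: "e1 \<ge> 0" "e2 \<ge> 0" "e3 \<ge> 0" unfolding defs by (auto intro!: cube_avg_nonneg)
  have "e2\<^sup>2 \<le> e1 * e3"
  proof -
    have 1: "sqrt \<bar>x\<bar> * (\<bar>x\<bar> * sqrt \<bar>x\<bar>) = x\<^sup>2" "(\<bar>x\<bar> * sqrt \<bar>x\<bar>)\<^sup>2 = \<bar>x\<bar> ^ 3" for x :: real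
      by (simp_all add: power2_eq_square power3_eq_cube mult_ac)
    show ?thesis
      using cube_avg_Cauchy_Schwarz[of m "\<lambda>Y. sqrt \<bar>g Y\<bar>" "\<lambda>Y. \<bar>g Y\<bar> * sqrt \<bar>g Y\<bar>"]
      unfolding 1 by (simp add: defs)
  qed
  hence "(e2\<^sup>2)\<^sup>2 \<le> (e1 * e3)\<^sup>2" by (intro power_mono) auto
  also have "\<dots> = e1\<^sup>2 * e3\<^sup>2" by (simp add: power_mult_distrib)
  also have "e3\<^sup>2 \<le> e2 * e4"
  proof -
    have 1: "\<bar>x\<bar> * x\<^sup>2 = \<bar>x\<bar> ^ 3" "(x\<^sup>2)\<^sup>2 = x ^ 4" "\<bar>x\<bar>\<^sup>2 = x\<^sup>2" for x :: real
      by (simp_all add: power3_eq_cube power2_eq_square power4_eq_xxxx abs_if)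
    show ?thesis
      using cube_avg_Cauchy_Schwarz[of m "\<lambda>Y. \<bar>g Y\<bar>" "\<lambda>Y. (g Y)\<^sup>2"]
      unfolding 1 by (simp add: defs)
  qed
  also have "e4 \<le> 9 ^ d * e2\<^sup>2" using cube_avg_fourth_moment[OF assms] by (simp add: defs)
  finally have "(e2\<^sup>2)\<^sup>2 \<le> e1\<^sup>2 * (e2 * (9 ^ d * e2\<^sup>2))"
    using nonneg by (simp add: mult_left_mono)
  hence *: "e2 ^ 3 * e2 \<le> e2 ^ 3 * (9 ^ d * e1\<^sup>2)"
    by (simp add: power2_eq_square power3_eq_cube mult_ac)
  show ?thesis
  proof (cases "e2 = 0")
    case True
    thus ?thesis by (simp add: defs)
  next
    case False
    hence "e2 ^ 3 > 0" using nonneg by simp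
    with * have "e2 \<le> 9 ^ d * e1\<^sup>2" by simp
    thus ?thesis by (simp add: defs)
  qed
qed

section \<open>Total influence on the cube\<close>

definition flip :: "nat \<Rightarrow> nat set \<Rightarrow> nat set" where
  "flip r Y = (if r \<in> Y then Y - {r} else insert r Y)"

lemma flip_subset: "Y \<subseteq> {..<m} \<Longrightarrow> r < m \<Longrightarrow> flip r Y \<subseteq> {..<m}"
  by (auto simp: flip_def)

text \<open>In Fourier terms the left side weights the squared coefficient of a set by its size,
  which is at most \<open>d\<close>, and the variance omits only the empty set. The induction
  replaces coefficients by the parts \<open>p\<close> and \<open>q\<close>: the last coordinate
  contributes the second moment \<open>b\<close> of \<open>q\<close>, and the influences of
  \<open>q\<close> at most \<open>(d - 1) * b\<close>.\<close>

lemma cube_influence_le: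
  "cube_deg m d g \<Longrightarrow> (\<Sum>r<m. cube_avg m (\<lambda>Y. ((g Y - g (flip r Y)) / 2)\<^sup>2))
     \<le> d * (cube_avg m (\<lambda>Y. (g Y)\<^sup>2) - (cube_avg m g)\<^sup>2)"
proof (induction m arbitrary: d g)
  case 0
  thus ?case by (simp add: cube_avg_0)
next
  case (Suc m)
  define p where "p = (\<lambda>Y. (g Y + g (insert m Y)) / 2)"
  define q where "q = (\<lambda>Y. (g Y - g (insert m Y)) / 2)"
  define b where "b = cube_avg m (\<lambda>Y. (q Y)\<^sup>2)"
  let ?I = "\<lambda>m g. \<Sum>r<m. cube_avg m (\<lambda>Y. ((g Y - g (flip r Y)) / 2)\<^sup>2)"
  have g: "g Y = p Y + q Y" "g (insert m Y) = p Y - q Y" for Y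
    by (simp_all add: p_def q_def field_simps)
  have last: "cube_avg (Suc m) (\<lambda>Y. ((g Y - g (flip m Y)) / 2)\<^sup>2) = b"
    unfolding cube_avg_Suc b_def
  proof (rule cube_avg_cong)
    fix Y assume "Y \<subseteq> {..<m}"
    hence "flip m Y = insert m Y" "flip m (insert m Y) = Y" by (auto simp: flip_def)
    thus "(((g Y - g (flip m Y)) / 2)\<^sup>2 + ((g (insert m Y) - g (flip m (insert m Y))) / 2)\<^sup>2) / 2
        = (q Y)\<^sup>2"
      by (simp add: g(1)[of Y] g(2)[of Y] power2_eq_square field_simps)
  qed
  have other: "cube_avg (Suc m) (\<lambda>Y. ((g Y - g (flip r Y)) / 2)\<^sup>2)
      = cube_avg m (\<lambda>Y. ((p Y - p (flip r Y)) / 2)\<^sup>2) + cube_avg m (\<lambda>Y. ((q Y - q (flip r Y)) / 2)\<^sup>2)"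
    if "r < m" for r
    unfolding cube_avg_Suc cube_avg_add[symmetric]
  proof (rule cube_avg_cong)
    fix Y assume "Y \<subseteq> {..<m}"
    hence "flip r (insert m Y) = insert m (flip r Y)" using that by (auto simp: flip_def)
    thus "(((g Y - g (flip r Y)) / 2)\<^sup>2 + ((g (insert m Y) - g (flip r (insert m Y))) / 2)\<^sup>2) / 2
        = ((p Y - p (flip r Y)) / 2)\<^sup>2 + ((q Y - q (flip r Y)) / 2)\<^sup>2"
      by (simp add: g(1)[of Y] g(2)[of Y] g(1)[of "flip r Y"] g(2)[of "flip r Y"]
          power2_eq_square field_simps)
  qed
  have I: "?I (Suc m) g = ?I m p + ?I m q + b"
    by (simp add: last other sum.distrib)
  have e2: "((g Y)\<^sup>2 + (g (insert m Y))\<^sup>2) / 2 = (p Y)\<^sup>2 + (q Y)\<^sup>2" for Y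
    unfolding g(1)[of Y] g(2)[of Y] by (simp add: power2_eq_square algebra_simps)
  have 2: "cube_avg (Suc m) (\<lambda>Y. (g Y)\<^sup>2) = cube_avg m (\<lambda>Y. (p Y)\<^sup>2) + b"
    unfolding cube_avg_Suc e2 by (simp add: cube_avg_add b_def)
  have 1: "cube_avg (Suc m) g = cube_avg m p" by (simp add: cube_avg_Suc p_def)
  have Ip: "?I m p \<le> d * (cube_avg m (\<lambda>Y. (p Y)\<^sup>2) - (cube_avg m p)\<^sup>2)"
    by (rule Suc.IH) (use Suc.prems in \<open>simp add: p_def\<close>)
  have "?I m q + b \<le> d * b"
  proof (cases d)
    case 0
    hence q0: "q Y = 0" if "Y \<subseteq> {..<m}" for Y using Suc.prems that by (simp add: q_def)
    have "b = 0" unfolding b_def using q0 by (simp cong: cube_avg_cong)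
    moreover have "?I m q = 0"
      using q0 flip_subset by (intro sum.neutral ballI) (simp cong: cube_avg_cong)
    ultimately show ?thesis by simp
  next
    case (Suc e)
    have "?I m q \<le> e * (b - (cube_avg m q)\<^sup>2)"
      unfolding b_def by (rule Suc.IH) (use Suc.prems \<open>d = Suc e\<close> in \<open>simp add: q_def\<close>)
    also have "\<dots> \<le> e * b" by (intro mult_left_mono) auto
    finally show ?thesis by (simp add: Suc algebra_simps)
  qed
  with Ip show ?case unfolding I 1 2 by (simp add: algebra_simps)
qed

text \<open>Influences do not see an additive constant, so \<open>\<mu>\<close> is arbitrary. It
  will be the average over the whole slice, not the one over this cube.\<close>

lemma cube_influence_le_abs_deviation:
  assumes "cube_deg m d g"
  shows "(\<Sum>r<m. cube_avg m (\<lambda>Y. ((g Y - g (flip r Y)) / 2)\<^sup>2))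
    \<le> d * 9 ^ d * (cube_avg m (\<lambda>Y. \<bar>g Y - \<mu>\<bar>))\<^sup>2"
proof -
  let ?h = "\<lambda>Y. g Y - \<mu>"
  have "(\<Sum>r<m. cube_avg m (\<lambda>Y. ((g Y - g (flip r Y)) / 2)\<^sup>2))
      = (\<Sum>r<m. cube_avg m (\<lambda>Y. ((?h Y - ?h (flip r Y)) / 2)\<^sup>2))" by simp
  also have "\<dots> \<le> d * (cube_avg m (\<lambda>Y. (?h Y)\<^sup>2) - (cube_avg m ?h)\<^sup>2)"
    by (intro cube_influence_le cube_deg_diff_const assms)
  also have "\<dots> \<le> d * cube_avg m (\<lambda>Y. (?h Y)\<^sup>2)" by (intro mult_left_mono) auto
  also have "\<dots> \<le> d * (9 ^ d * (cube_avg m (\<lambda>Y. \<bar>?h Y\<bar>))\<^sup>2)"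
    by (intro mult_left_mono cube_avg_square_le cube_deg_diff_const assms) auto
  finally show ?thesis by (simp add: mult.assoc)
qed

section \<open>Averages over permutations\<close>

definition kslice :: "nat \<Rightarrow> nat \<Rightarrow> nat set set" where
  "kslice n k = {M. M \<subseteq> {..<n} \<and> card M = k}"

text \<open>A flag records a point together with an oriented pair of coordinates of opposite sign.
  Permutations act transitively on flags, so a randomly permuted flag is uniformly
  distributed.\<close>

definition flags :: "nat \<Rightarrow> nat \<Rightarrow> (nat set \<times> nat \<times> nat) set" where
  "flags n k = Sigma (kslice n k) (\<lambda>M. M \<times> ({..<n} - M))"

definition perm_avg :: "nat \<Rightarrow> ((nat \<Rightarrow> nat) \<Rightarrow> real) \<Rightarrow> real" where
  "perm_avg n F = (\<Sum>\<pi> | \<pi> permutes {..<n}. F \<pi>) / fact n"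

definition kslice_avg :: "nat \<Rightarrow> nat \<Rightarrow> (nat set \<Rightarrow> real) \<Rightarrow> real" where
  "kslice_avg n k \<Phi> = (\<Sum>M\<in>kslice n k. \<Phi> M) / (n choose k)"

lemma finite_kslice [simp]: "finite (kslice n k)"
  unfolding kslice_def by (rule finite_subset[of _ "Pow {..<n}"]) auto

lemma card_kslice: "card (kslice n k) = n choose k"
  unfolding kslice_def using n_subsets[of "{..<n}" k] by simp

lemma kslice_finite: "M \<in> kslice n k \<Longrightarrow> finite M"
  unfolding kslice_def using finite_subset by blast

lemma kslice_image:
  assumes "\<pi> permutes {..<n}" "M \<in> kslice n k"
  shows "\<pi> ` M \<in> kslice n k"
proof -
  have "\<pi> ` M \<subseteq> {..<n}" using assms permutes_image[OF assms(1)] unfolding kslice_def by blast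
  moreover have "card (\<pi> ` M) = card M"
    using permutes_inj_on[OF assms(1)] by (rule card_image)
  ultimately show ?thesis using assms(2) by (simp add: kslice_def)
qed

lemma sum_flags:
  fixes \<Phi> :: "nat set \<Rightarrow> nat \<Rightarrow> nat \<Rightarrow> real"
  shows "(\<Sum>(M, a, b)\<in>flags n k. \<Phi> M a b) = (\<Sum>M\<in>kslice n k. \<Sum>a\<in>M. \<Sum>b\<in>{..<n} - M. \<Phi> M a b)"
proof -
  have "(\<Sum>M\<in>kslice n k. \<Sum>a\<in>M. \<Sum>b\<in>{..<n} - M. \<Phi> M a b)
      = (\<Sum>M\<in>kslice n k. \<Sum>(a, b)\<in>M \<times> ({..<n} - M). \<Phi> M a b)"
    by (simp add: sum.cartesian_product)
  also have "\<dots> = (\<Sum>(M, a, b)\<in>flags n k. \<Phi> M a b)"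
    unfolding flags_def by (rule sum.Sigma) (auto dest: kslice_finite)
  finally show ?thesis by simp
qed

lemma finite_flags [simp]: "finite (flags n k)"
  unfolding flags_def using kslice_finite by (intro finite_SigmaI) auto

lemma card_flags: "card (flags n k) = (n choose k) * (k * (n - k))"
proof -
  have "card (M \<times> ({..<n} - M)) = k * (n - k)" if "M \<in> kslice n k" for M
    using that kslice_finite[OF that] by (simp add: kslice_def card_cartesian_product card_Diff_subset)
  thus ?thesis unfolding flags_def by (simp add: card_SigmaI kslice_finite card_kslice)
qed

text \<open>The blocks \<open>{a}\<close>, \<open>M - {a}\<close>, \<open>{b}\<close> and the rest
  have equal sizes for both flags, so bijections between them can be glued.\<close>

lemma flags_transitive:
  assumes "(M, a, b) \<in> flags n k" "(M', a', b') \<in> flags n k"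
  obtains \<sigma> where "\<sigma> permutes {..<n}" "\<sigma> ` M = M'" "\<sigma> a = a'" "\<sigma> b = b'"
proof -
  have M: "M \<subseteq> {..<n}" "card M = k" "a \<in> M" "b < n" "b \<notin> M" "finite M"
    and M': "M' \<subseteq> {..<n}" "card M' = k" "a' \<in> M'" "b' < n" "b' \<notin> M'" "finite M'"
    using assms kslice_finite[of M n k] kslice_finite[of M' n k]
    by (auto simp: flags_def kslice_def)
  have "card (M - {a}) = card (M' - {a'})" using M M' by simp
  then obtain f where f: "bij_betw f (M - {a}) (M' - {a'})"
    using finite_same_card_bij[of "M - {a}" "M' - {a'}"] M M' by auto
  have "card ({..<n} - M - {b}) = card ({..<n} - M' - {b'})"
    using M M' by (simp add: card_Diff_subset)
  then obtain g where g: "bij_betw g ({..<n} - M - {b}) ({..<n} - M' - {b'})"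
    by (meson finite_Diff finite_lessThan finite_same_card_bij)
  define \<sigma> where "\<sigma> = (\<lambda>x. if x = a then a' else if x = b then b' else if x \<in> M then f x
    else if x < n then g x else x)"
  have "bij_betw \<sigma> (M - {a}) (M' - {a'})"
    by (rule bij_betw_cong[THEN iffD1, OF _ f]) (use M in \<open>auto simp: \<sigma>_def\<close>)
  moreover have "bij_betw \<sigma> {a} {a'}" by (auto simp: \<sigma>_def)
  ultimately have "bij_betw \<sigma> ((M - {a}) \<union> {a}) ((M' - {a'}) \<union> {a'})"
    by (rule bij_betw_combine) auto
  hence 1: "bij_betw \<sigma> M M'" using M M' by (simp add: insert_absorb)
  have "bij_betw \<sigma> ({..<n} - M - {b}) ({..<n} - M' - {b'})"
    by (rule bij_betw_cong[THEN iffD1, OF _ g]) (use M in \<open>auto simp: \<sigma>_def\<close>)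
  moreover have "bij_betw \<sigma> {b} {b'}" using M by (auto simp: \<sigma>_def)
  ultimately have "bij_betw \<sigma> (({..<n} - M - {b}) \<union> {b}) (({..<n} - M' - {b'}) \<union> {b'})"
    by (rule bij_betw_combine) auto
  moreover have "({..<n} - M - {b}) \<union> {b} = {..<n} - M" "({..<n} - M' - {b'}) \<union> {b'} = {..<n} - M'"
    using M M' by auto
  ultimately have "bij_betw \<sigma> ({..<n} - M) ({..<n} - M')" by simp
  with 1 have "bij_betw \<sigma> (M \<union> ({..<n} - M)) (M' \<union> ({..<n} - M'))"
    by (rule bij_betw_combine) auto
  moreover have "M \<union> ({..<n} - M) = {..<n}" "M' \<union> ({..<n} - M') = {..<n}" using M M' by auto
  ultimately have "bij_betw \<sigma> {..<n} {..<n}" by simp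
  moreover have "\<sigma> x = x" if "x \<notin> {..<n}" for x using that M by (auto simp: \<sigma>_def)
  ultimately have "\<sigma> permutes {..<n}" by (rule bij_imp_permutes)
  moreover have "\<sigma> ` M = M'" using 1 by (simp add: bij_betw_def)
  moreover have "\<sigma> a = a'" "\<sigma> b = b'" using M by (auto simp: \<sigma>_def)
  ultimately show ?thesis using that by blast
qed

lemma sum_flags_image:
  assumes "\<pi> permutes {..<n}"
  shows "(\<Sum>(M, a, b)\<in>flags n k. \<Phi> (\<pi> ` M) (\<pi> a) (\<pi> b)) = (\<Sum>(M, a, b)\<in>flags n k. \<Phi> M a b :: real)"
proof -
  let ?F = "\<lambda>\<pi> (M, a, b). (\<pi> ` M, \<pi> a, \<pi> b)"
  have in_flags: "?F \<pi> z \<in> flags n k" if "\<pi> permutes {..<n}" "z \<in> flags n k" for \<pi> z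
  proof -
    obtain M a b where z: "z = (M, a, b)" by (cases z)
    have "\<pi> ` M \<in> kslice n k" using kslice_image[OF that(1)] that(2) by (auto simp: z flags_def)
    moreover have "\<pi> b \<notin> \<pi> ` M" "\<pi> b < n" "\<pi> a \<in> \<pi> ` M"
      using that(2) permutes_inj[OF that(1)] permutes_in_image[OF that(1), of b]
      by (auto simp: z flags_def inj_image_mem_iff)
    ultimately show ?thesis by (simp add: z flags_def)
  qed
  have inv: "inv \<pi> permutes {..<n}" using assms by (rule permutes_inv)
  have "(\<Sum>z\<in>flags n k. (case z of (M, a, b) \<Rightarrow> \<Phi> (\<pi> ` M) (\<pi> a) (\<pi> b)))
      = (\<Sum>z\<in>flags n k. (case z of (M, a, b) \<Rightarrow> \<Phi> M a b))"
    by (rule sum.reindex_bij_witness[of _ "?F (inv \<pi>)" "?F \<pi>"])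
      (use in_flags[OF assms] in_flags[OF inv] permutes_inverses[OF assms] in
        \<open>auto simp: image_comp comp_def\<close>)
  thus ?thesis .
qed

text \<open>By transitivity the sum over permutations is the same for every starting flag. Averaging
  over starting flags and exchanging sums suffices, since each single permutation only rearranges
  the flags.\<close>

lemma perm_avg_flags:
  assumes "(M0, a0, b0) \<in> flags n k"
  shows "perm_avg n (\<lambda>\<pi>. \<Phi> (\<pi> ` M0) (\<pi> a0) (\<pi> b0)) = (\<Sum>(M, a, b)\<in>flags n k. \<Phi> M a b) / card (flags n k)"
proof -
  let ?P = "{\<pi>. \<pi> permutes {..<n}}"
  let ?S = "\<lambda>(M, a, b). \<Sum>\<pi>\<in>?P. \<Phi> (\<pi> ` M) (\<pi> a) (\<pi> b)"
  have "?S z = ?S (M0, a0, b0)" if z: "z \<in> flags n k" for z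
  proof -
    obtain M a b where zz: "z = (M, a, b)" by (cases z)
    obtain \<sigma> where \<sigma>: "\<sigma> permutes {..<n}" "\<sigma> ` M0 = M" "\<sigma> a0 = a" "\<sigma> b0 = b"
      using flags_transitive[OF assms z[unfolded zz]] .
    have "(\<Sum>\<pi>\<in>?P. \<Phi> (\<pi> ` M) (\<pi> a) (\<pi> b)) = (\<Sum>\<pi>\<in>?P. \<Phi> ((\<pi> \<circ> \<sigma>) ` M0) ((\<pi> \<circ> \<sigma>) a0) ((\<pi> \<circ> \<sigma>) b0))"
      unfolding \<sigma>(2-4)[symmetric] image_comp comp_apply ..
    also have "\<dots> = (\<Sum>\<pi>\<in>?P. \<Phi> (\<pi> ` M0) (\<pi> a0) (\<pi> b0))"
      using sum_permutations_compose_right[OF \<sigma>(1), of "\<lambda>\<pi>. \<Phi> (\<pi> ` M0) (\<pi> a0) (\<pi> b0)"]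
      by simp
    finally show ?thesis by (simp add: zz)
  qed
  hence "card (flags n k) * ?S (M0, a0, b0) = (\<Sum>z\<in>flags n k. ?S z)" by simp
  also have "\<dots> = (\<Sum>\<pi>\<in>?P. \<Sum>(M, a, b)\<in>flags n k. \<Phi> (\<pi> ` M) (\<pi> a) (\<pi> b))"
    by (subst sum.swap) (simp add: split_beta')
  also have "\<dots> = (\<Sum>\<pi>\<in>?P. \<Sum>(M, a, b)\<in>flags n k. \<Phi> M a b)"
    by (intro sum.cong refl sum_flags_image) auto
  also have "\<dots> = fact n * (\<Sum>(M, a, b)\<in>flags n k. \<Phi> M a b)"
    using card_permutations[of "{..<n}" n] by simp
  finally have "card (flags n k) * ?S (M0, a0, b0) = fact n * (\<Sum>(M, a, b)\<in>flags n k. \<Phi> M a b)" .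
  moreover have "card (flags n k) > 0" using assms by (auto simp: card_gt_0_iff)
  hence "real (card (flags n k)) \<noteq> 0" by linarith
  moreover have "x = y / c" if "c * x = y" "c \<noteq> 0" for c x y :: real
    using that by (simp add: eq_divide_eq mult.commute)
  ultimately have "?S (M0, a0, b0) = fact n * (\<Sum>(M, a, b)\<in>flags n k. \<Phi> M a b) / card (flags n k)"
    by blast
  thus ?thesis by (simp add: perm_avg_def)
qed

text \<open>The point is extended to a flag, which \<open>0 < k\<close> and \<open>k < n\<close>
  allow, and the pair is forgotten again; every point lies in \<open>k * (n - k)\<close>
  flags.\<close>

lemma perm_avg_kslice:
  assumes "M0 \<in> kslice n k" "0 < k" "k < n"
  shows "perm_avg n (\<lambda>\<pi>. \<Phi> (\<pi> ` M0)) = kslice_avg n k \<Phi>"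
proof -
  have "M0 \<noteq> {}" "M0 \<noteq> {..<n}" using assms by (auto simp: kslice_def)
  then obtain a b where "(M0, a, b) \<in> flags n k" using assms(1) by (fastforce simp: flags_def kslice_def)
  from perm_avg_flags[OF this, of "\<lambda>M _ _. \<Phi> M"]
  have "perm_avg n (\<lambda>\<pi>. \<Phi> (\<pi> ` M0)) = (\<Sum>M\<in>kslice n k. card M * (card ({..<n} - M) * \<Phi> M)) / card (flags n k)"
    by (simp add: sum_flags)
  also have "(\<Sum>M\<in>kslice n k. card M * (card ({..<n} - M) * \<Phi> M)) = (\<Sum>M\<in>kslice n k. (k * real (n - k)) * \<Phi> M)"
    using kslice_finite by (intro sum.cong refl) (auto simp: kslice_def card_Diff_subset)
  also have "\<dots> = (k * real (n - k)) * (\<Sum>M\<in>kslice n k. \<Phi> M)" by (simp add: sum_distrib_left)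
  finally show ?thesis using assms by (simp add: card_flags kslice_avg_def)
qed

lemma perm_avg_mono:
  "(\<And>\<pi>. \<pi> permutes {..<n} \<Longrightarrow> F \<pi> \<le> G \<pi>) \<Longrightarrow> perm_avg n F \<le> perm_avg n G"
  unfolding perm_avg_def by (intro divide_right_mono sum_mono) auto

lemma perm_avg_cmult: "perm_avg n (\<lambda>\<pi>. c * F \<pi>) = c * perm_avg n F"
  by (simp add: perm_avg_def sum_distrib_left)

lemma perm_avg_sum: "perm_avg n (\<lambda>\<pi>. \<Sum>i\<in>I. F i \<pi>) = (\<Sum>i\<in>I. perm_avg n (F i))"
  unfolding perm_avg_def sum_divide_distrib[symmetric] by (subst sum.swap) simp

lemma perm_avg_cube_avg: "perm_avg n (\<lambda>\<pi>. cube_avg m (F \<pi>)) = cube_avg m (\<lambda>Y. perm_avg n (\<lambda>\<pi>. F \<pi> Y))"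
  unfolding perm_avg_def cube_avg_def sum_divide_distrib[symmetric]
  by (subst sum.swap) (simp add: mult.commute)

text \<open>For \<open>l \<le> k\<close> the sets \<open>matching k Y\<close> with \<open>Y \<subseteq> {0, \<dots>, l - 1}\<close> form a cube inside the slice:
  membership of \<open>r\<close> in \<open>Y\<close> decides which one of \<open>r\<close> and \<open>k + r\<close> is chosen.\<close>

definition matching :: "nat \<Rightarrow> nat set \<Rightarrow> nat set" where
  "matching k Y = ({..<k} - Y) \<union> (+) k ` Y"

lemma matching_kslice:
  assumes "Y \<subseteq> {..<l}" "l \<le> k" "k + l \<le> n"
  shows "matching k Y \<in> kslice n k"
proof -
  have Y: "finite Y" "Y \<subseteq> {..<k}" using assms finite_subset by auto
  have "card (matching k Y) = card ({..<k} - Y) + card ((+) k ` Y)"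
    unfolding matching_def using Y by (intro card_Un_disjoint) auto
  also have "card ((+) k ` Y) = card Y" by (intro card_image) auto
  also have "card ({..<k} - Y) = k - card Y" using Y by (simp add: card_Diff_subset)
  finally have "card (matching k Y) = k" using card_mono[OF _ Y(2)] by simp
  thus ?thesis using assms by (auto simp: kslice_def matching_def)
qed

lemma mem_matching:
  assumes "Y \<subseteq> {..<l}" "l \<le> k"
  shows "x \<in> matching k Y \<longleftrightarrow> (if x < k then x \<notin> Y else x - k \<in> Y)"
proof (cases "x < k")
  case False
  then obtain r where "x = k + r" using le_Suc_ex by (metis not_less)
  thus ?thesis by (auto simp: matching_def)
qed (auto simp: matching_def)

lemma matching_flip:
  assumes "Y \<subseteq> {..<l}" "l \<le> k" "r < l"
  shows "matching k (flip r Y) = transp r (k + r) ` matching k Y"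
proof (rule set_eqI)
  fix x
  have sub: "flip r Y \<subseteq> {..<l}" using assms by (intro flip_subset)
  have "x \<in> transp r (k + r) ` matching k Y \<longleftrightarrow>
      transp r (k + r) x \<in> matching k Y"
    by (metis (no_types, lifting) image_iff transpose_involutory)
  moreover have "x \<in> matching k (flip r Y) \<longleftrightarrow> transp r (k + r) x \<in> matching k Y"
  proof -
    consider "x = r" | "x = k + r" | "x \<noteq> r" "x \<noteq> k + r" by blast
    thus ?thesis
    proof cases
      case 3
      hence "x - k \<noteq> r \<or> x < k" by auto
      thus ?thesis using 3 unfolding mem_matching[OF sub assms(2)] mem_matching[OF assms(1,2)]
        by (auto simp: flip_def)
    qed (use assms in \<open>auto simp: matching_def flip_def\<close>)
  qed
  ultimately show "x \<in> matching k (flip r Y) \<longleftrightarrow>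
      x \<in> transp r (k + r) ` matching k Y" by blast
qed

text \<open>The pairs \<open>(r, k + r)\<close> are disjoint, so each touched pair can be charged to
  an element of \<open>S\<close> of its own. It serves twice: with the coordinates of a junta it
  bounds degrees, and with the variables outside a class it bounds the number of sensitive
  pairs.\<close>

lemma card_touched_pairs:
  fixes k l :: nat
  assumes "inj \<pi>" "finite S" "l \<le> k"
  shows "card {r. r < l \<and> (\<pi> r \<in> S \<or> \<pi> (k + r) \<in> S)} \<le> card S"
proof (rule card_inj_on_le)
  show "inj_on (\<lambda>r. if \<pi> r \<in> S then \<pi> r else \<pi> (k + r)) {r. r < l \<and> (\<pi> r \<in> S \<or> \<pi> (k + r) \<in> S)}"
  proof (rule inj_onI)
    fix x y
    assume xy: "x \<in> {r. r < l \<and> (\<pi> r \<in> S \<or> \<pi> (k + r) \<in> S)}"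
        "y \<in> {r. r < l \<and> (\<pi> r \<in> S \<or> \<pi> (k + r) \<in> S)}"
      and eq: "(if \<pi> x \<in> S then \<pi> x else \<pi> (k + x)) = (if \<pi> y \<in> S then \<pi> y else \<pi> (k + y))"
    have "\<pi> (if \<pi> x \<in> S then x else k + x) = \<pi> (if \<pi> y \<in> S then y else k + y)"
      using eq by (simp split: if_splits)
    hence "(if \<pi> x \<in> S then x else k + x) = (if \<pi> y \<in> S then y else k + y)"
      using assms(1) by (simp only: inj_eq)
    moreover have "x < l" "y < l" using xy by auto
    hence "x < k \<and> y < k" using assms(3) by linarith
    ultimately show "x = y" by (simp split: if_splits)
  qed
qed (use assms(2) in auto)

lemma cube_deg_matching:
  assumes "junta_sum d f" "inj \<pi>" "l \<le> k"
  shows "cube_deg l d (\<lambda>Y. f (\<pi> ` matching k Y))"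
  using assms(1)
proof induction
  case (junta S f)
  let ?S = "{r. r < l \<and> (\<pi> r \<in> S \<or> \<pi> (k + r) \<in> S)}"
  have "card ?S \<le> d" using card_touched_pairs[OF assms(2) junta(1) assms(3)] junta(2) by linarith
  moreover have "f (\<pi> ` matching k Y) = f (\<pi> ` matching k (Y \<inter> ?S))" if Y: "Y \<subseteq> {..<l}" for Y
  proof -
    have "x \<in> matching k Y \<longleftrightarrow> x \<in> matching k (Y \<inter> ?S)" if "\<pi> x \<in> S" for x
    proof -
      have Y': "Y \<inter> ?S \<subseteq> {..<l}" by auto
      show ?thesis
        unfolding mem_matching[OF Y assms(3)] mem_matching[OF Y' assms(3)] using that Y by auto
    qed
    hence "\<pi> ` matching k Y \<inter> S = \<pi> ` matching k (Y \<inter> ?S) \<inter> S" by auto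
    thus ?thesis by (metis junta(3))
  qed
  ultimately show ?case by (intro cube_deg_junta[of ?S]) auto
next
  case (add f g)
  thus ?case by (intro cube_deg_add)
qed

section \<open>Deviation from the average\<close>

text \<open>A discrete derivative: juntas that see neither \<open>i\<close> nor \<open>j\<close>
  contribute 0, and the others lose at least one relevant coordinate.\<close>

lemma junta_sum_swap_diff:
  assumes "junta_sum d f"
  shows "junta_sum (d - 1) (\<lambda>M. f (insert i (M - {i, j})) - f (insert j (M - {i, j})))"
  using assms
proof induction
  case (junta S f)
  let ?h = "\<lambda>M. f (insert i (M - {i, j})) - f (insert j (M - {i, j}))"
  show ?case
  proof (cases "i \<in> S \<or> j \<in> S")
    case False
    have zero: "?h M = 0" for M
    proof -
      have "insert i (M - {i, j}) \<inter> S = insert j (M - {i, j}) \<inter> S" using False by auto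
      thus ?thesis using junta(3) by (metis diff_self)
    qed
    show ?thesis
    proof (rule junta_sum.junta[of "{}"])
      show "?h M = ?h (M \<inter> {})" for M by (simp only: zero)
    qed simp_all
  next
    case True
    have "card (S - {i, j}) < card S" using True junta(1) by (intro psubset_card_mono) auto
    moreover have "?h M = ?h (M \<inter> (S - {i, j}))" for M
    proof -
      have "f (insert v (M - {i, j})) = f (insert v (M \<inter> (S - {i, j}) - {i, j}))" for v
      proof -
        have "insert v (M - {i, j}) \<inter> S = insert v (M \<inter> (S - {i, j}) - {i, j}) \<inter> S" by auto
        thus ?thesis by (metis junta(3))
      qed
      thus ?thesis by metis
    qed
    ultimately show ?thesis using junta(1,2) by (intro junta_sum.junta[of "S - {i, j}"]) auto
  qed
next
  case (add f g)
  have "(\<lambda>M. f (insert i (M - {i, j})) + g (insert i (M - {i, j})) -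
      (f (insert j (M - {i, j})) + g (insert j (M - {i, j})))) =
    (\<lambda>M. (f (insert i (M - {i, j})) - f (insert j (M - {i, j}))) +
      (g (insert i (M - {i, j})) - g (insert j (M - {i, j}))))"
    by (auto simp: algebra_simps)
  thus ?case using junta_sum.add[OF add.IH] by simp
qed

section \<open>Interchangeable variables and the number of points that tell two variables
  apart\<close>

definition asymmetric :: "nat \<Rightarrow> nat \<Rightarrow> (nat set \<Rightarrow> real) \<Rightarrow> nat \<Rightarrow> nat \<Rightarrow> bool" where
  "asymmetric n k f i j \<longleftrightarrow> (\<exists>M\<in>kslice n k. f (transp i j ` M) \<noteq> f M)"

lemma asymmetric_commute: "asymmetric n k f i j = asymmetric n k f j i"
  by (simp add: asymmetric_def transpose_commute)

lemma asymmetric_refl [simp]: "\<not> asymmetric n k f i i"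
  by (simp add: asymmetric_def)

lemma transpose_kslice:
  "i < n \<Longrightarrow> j < n \<Longrightarrow> M \<in> kslice n k \<Longrightarrow> transp i j ` M \<in> kslice n k"
  by (intro kslice_image permutes_swap_id) auto

text \<open>The transposition \<open>(a b)\<close> is the product of \<open>(i a)\<close>,
  \<open>(i b)\<close> and \<open>(i a)\<close>. Hence interchangeability is an equivalence
  relation.\<close>

lemma not_asymmetric_trans:
  assumes "\<not> asymmetric n k f i a" "\<not> asymmetric n k f i b" "i < n" "a < n" "b < n"
  shows "\<not> asymmetric n k f a b"
proof (cases "a = b \<or> i = a \<or> i = b")
  case True
  thus ?thesis using assms asymmetric_commute by (metis asymmetric_refl)
next
  case False
  have "f (transp a b ` M) = f M" if M: "M \<in> kslice n k" for M
  proof -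
    let ?ia = "transp i a" and ?ib = "transp i b"
    have "transp a b = ?ia \<circ> ?ib \<circ> ?ia"
      using False by (auto simp: fun_eq_iff Transposition.transpose_def)
    hence "transp a b ` M = ?ia ` ?ib ` ?ia ` M" by (simp add: image_comp)
    moreover have "?ia ` M \<in> kslice n k" "?ib ` ?ia ` M \<in> kslice n k"
      using assms(3-5) M transpose_kslice by metis+
    ultimately show ?thesis using assms(1,2) M unfolding asymmetric_def by metis
  qed
  thus ?thesis by (simp add: asymmetric_def)
qed

lemma transpose_image_in_out:
  "a \<in> M \<Longrightarrow> b \<notin> M \<Longrightarrow> transp a b ` M = insert b (M - {a})"
  by (auto simp: Transposition.transpose_def image_iff)

text \<open>Deleting \<open>i\<close> and \<open>j\<close> leaves the question where the swap
  difference is nonzero on sets of size \<open>k - 1\<close> in \<open>n - 2\<close> coordinates.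
  Its degree is one less, and the three decrements together leave \<open>n - 2 * D\<close> and
  \<open>k - D\<close> unchanged.\<close>

lemma count_asymmetric:
  assumes "junta_sum d f" "d \<ge> 1" "0 < k" "k < n" "i < n" "j < n" "asymmetric n k f i j"
  defines "D \<equiv> min d (min k (n - k))"
  shows "(n - 2 * D) choose (k - D)
    \<le> card {M \<in> kslice n k. i \<in> M \<and> j \<notin> M \<and> f (transp i j ` M) \<noteq> f M}"
proof -
  let ?N = "{..<n} - {i, j}"
  let ?h = "\<lambda>M. f (insert i (M - {i, j})) - f (insert j (M - {i, j}))"
  have ij: "i \<noteq> j" using assms(7) by auto
  have cN: "finite ?N" "card ?N = n - 2" using assms(5,6) ij by (auto simp: card_Diff_subset)
  have "min (d - 1) (min (k - 1) (card ?N - (k - 1))) = D - 1"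
    using assms(2-4) unfolding cN D_def by auto
  moreover have "deg_le (min (d - 1) (min (k - 1) (card ?N - (k - 1)))) ?N (k - 1) ?h"
    using assms(1,3,4) cN by (intro deg_le_min junta_sum_deg_le junta_sum_swap_diff) auto
  ultimately have deg: "deg_le (D - 1) ?N (k - 1) ?h" by simp
  obtain M where M: "M \<in> kslice n k" "f (transp i j ` M) \<noteq> f M"
    using assms(7) by (auto simp: asymmetric_def)
  have finM: "finite M" "card M = k" "M \<subseteq> {..<n}" using kslice_finite[OF M(1)] M(1) by (auto simp: kslice_def)
  \<comment> \<open>The transposition matters only at points that separate \<open>i\<close> from
    \<open>j\<close>; removing the one that is contained gives a nonzero of
    \<open>?h\<close>.\<close>
  have "\<exists>M'. M' \<subseteq> ?N \<and> card M' = k - 1 \<and> ?h M' \<noteq> 0"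
  proof -
    consider "i \<in> M" "j \<notin> M" | "j \<in> M" "i \<notin> M" | "i \<in> M \<longleftrightarrow> j \<in> M" by blast
    thus ?thesis
    proof cases
      case 1
      let ?M' = "M - {i}"
      have "insert i (?M' - {i, j}) = M" "insert j (?M' - {i, j}) = transp i j ` M"
        using transpose_image_in_out[OF 1] 1 by auto
      hence "?h ?M' \<noteq> 0" using M(2) by simp
      moreover have "?M' \<subseteq> ?N" "card ?M' = k - 1" using 1 finM by auto
      ultimately show ?thesis by blast
    next
      case 2
      let ?M' = "M - {j}"
      have "insert j (?M' - {i, j}) = M" "insert i (?M' - {i, j}) = transp i j ` M"
        using transpose_image_in_out[OF 2] 2 by (auto simp: transpose_commute)
      hence "?h ?M' \<noteq> 0" using M(2) by simp
      moreover have "?M' \<subseteq> ?N" "card ?M' = k - 1" using 2 finM by auto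
      ultimately show ?thesis by blast
    next
      case 3
      hence "transp i j ` M = M" by (rule transpose_image_eq)
      thus ?thesis using M(2) by simp
    qed
  qed
  then obtain M' where M': "M' \<subseteq> ?N" "card M' = k - 1" "?h M' \<noteq> 0" by blast
  let ?C = "{M. M \<subseteq> ?N \<and> card M = k - 1 \<and> ?h M \<noteq> 0}"
  have "(card ?N - 2 * (D - 1)) choose (k - 1 - (D - 1)) \<le> card ?C"
    by (rule deg_le_count_nonzero[OF cN(1) deg _ _ M']) (use assms(2-4) cN in \<open>auto simp: D_def\<close>)
  also have "(card ?N - 2 * (D - 1)) choose (k - 1 - (D - 1)) = (n - 2 * D) choose (k - D)"
  proof -
    have "D \<ge> 1" using assms(2-4) by (auto simp: D_def)
    hence "card ?N - 2 * (D - 1) = n - 2 * D" "k - 1 - (D - 1) = k - D" using cN by auto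
    thus ?thesis by simp
  qed
  also have "card ?C = card (insert i ` ?C)"
  proof -
    have "inj_on (insert i) ?C" by (rule inj_onI) blast
    thus ?thesis by (simp add: card_image)
  qed
  also have "\<dots> \<le> card {M \<in> kslice n k. i \<in> M \<and> j \<notin> M \<and> f (transp i j ` M) \<noteq> f M}"
  proof (rule card_mono)
    show "insert i ` ?C \<subseteq> {M \<in> kslice n k. i \<in> M \<and> j \<notin> M \<and> f (transp i j ` M) \<noteq> f M}"
    proof (rule image_subsetI)
      fix M' assume M': "M' \<in> ?C"
      have fin: "finite M'" using M' cN finite_subset by auto
      have nin: "i \<notin> M'" "j \<notin> M'" using M' by auto
      have "card (insert i M') = k" using M' fin nin assms(3) by simp
      hence "insert i M' \<in> kslice n k" using M' assms(5) by (auto simp: kslice_def)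
      moreover have "j \<notin> insert i M'" using nin ij by auto
      moreover have "f (transp i j ` insert i M') \<noteq> f (insert i M')"
      proof -
        have "transp i j ` insert i M' = insert j M'"
          using transpose_image_in_out[of i "insert i M'" j] nin ij by auto
        moreover have "M' - {i, j} = M'" using nin by auto
        ultimately show ?thesis using M' by simp
      qed
      ultimately show "insert i M' \<in> {M \<in> kslice n k. i \<in> M \<and> j \<notin> M \<and>
          f (transp i j ` M) \<noteq> f M}" by simp
    qed
  qed auto
  finally show ?thesis .
qed

text \<open>Double counting: each \<open>i\<close> has at least \<open>s\<close> partners
  \<open>j\<close>, each such pair has at least the number of points from
  \<open>count_asymmetric\<close>, and different triples are different flags.\<close>

lemma sum_flags_asymmetric:
  assumes "junta_sum d f" "d \<ge> 1" "0 < k" "k < n"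
    and "\<And>i. i < n \<Longrightarrow> s \<le> card {j. j < n \<and> asymmetric n k f i j}"
  defines "D \<equiv> min d (min k (n - k))"
  shows "real (n * s * ((n - 2 * D) choose (k - D)))
    \<le> (\<Sum>(M, a, b)\<in>flags n k. of_bool (f (transp a b ` M) \<noteq> f M))"
proof -
  let ?w = "(n - 2 * D) choose (k - D)"
  let ?V = "\<lambda>i. {j. j < n \<and> asymmetric n k f i j}"
  let ?C = "\<lambda>i j. {M \<in> kslice n k. i \<in> M \<and> j \<notin> M \<and> f (transp i j ` M) \<noteq> f M}"
  let ?A = "SIGMA i:{..<n}. SIGMA j:?V i. ?C i j"
  let ?B = "{z \<in> flags n k. case z of (M, a, b) \<Rightarrow> f (transp a b ` M) \<noteq> f M}"
  have "n * s * ?w = (\<Sum>i<n. s * ?w)" by simp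
  also have "\<dots> \<le> (\<Sum>i<n. \<Sum>j\<in>?V i. card (?C i j))"
  proof (rule sum_mono)
    fix i assume i: "i \<in> {..<n}"
    hence "s * ?w \<le> card (?V i) * ?w" using assms(5) by (intro mult_right_mono) auto
    also have "\<dots> = (\<Sum>j\<in>?V i. ?w)" by simp
    also have "\<dots> \<le> (\<Sum>j\<in>?V i. card (?C i j))"
      using count_asymmetric[OF assms(1-4)] i unfolding D_def by (intro sum_mono) auto
    finally show "s * ?w \<le> \<dots>" .
  qed
  also have "\<dots> = card ?A" by (simp add: card_SigmaI)
  also have "\<dots> = card ((\<lambda>(i, j, M). (M, i, j)) ` ?A)"
    by (intro card_image[symmetric]) (auto simp: inj_on_def)
  also have "\<dots> \<le> card ?B"
    by (intro card_mono finite_subset[OF _ finite_flags[of n k]]) (auto simp: flags_def)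
  finally have "n * s * ?w \<le> card ?B" .
  hence "real (n * s * ?w) \<le> real (card ?B)" by (simp only: of_nat_le_iff)
  also have "real (card ?B) = (\<Sum>z\<in>flags n k. of_bool (case z of (M, a, b) \<Rightarrow> f (transp a b ` M) \<noteq> f M))"
    by (simp add: sum.inter_filter[symmetric] of_bool_def)
  also have "\<dots> = (\<Sum>(M, a, b)\<in>flags n k. of_bool (f (transp a b ` M) \<noteq> f M))"
    by (intro sum.cong) auto
  finally show ?thesis .
qed

text \<open>Every permutation of the coordinates turns \<open>f\<close> into a function of low degree on a cube.
  The expected number of sensitive pairs of the cube is bounded from below, and it never exceeds the
  number of coordinates outside a class of interchangeable ones.\<close>

lemma abs_deviation_ge:
  fixes f :: "nat set \<Rightarrow> real"
  assumes f: "junta_sum d f" "\<And>M. f M \<in> \<int>" and dk: "d \<ge> 1" "0 < k" "k < n"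
    and s: "\<And>i. i < n \<Longrightarrow> s \<le> card {j. j < n \<and> asymmetric n k f i j}"
    and i0: "i0 < n" "card {j. j < n \<and> asymmetric n k f i0 j} = s" and "s > 0"
  defines "D \<equiv> min d (min k (n - k))"
  shows "sqrt s * (((n - 2 * D) choose (k - D)) / (n choose k)) / (2 * sqrt d * 3 ^ d)
    \<le> kslice_avg n k (\<lambda>M. \<bar>f M - \<mu>\<bar>)"
proof -
  \<comment> \<open>The number of pairs \<open>(r, k + r)\<close> of opposite sign that fit into the
    coordinates.\<close>
  define l where "l = min k (n - k)"
  have l: "l \<le> k" "k + l \<le> n" "0 < l" using dk by (auto simp: l_def)
  define w where "w = real ((n - 2 * D) choose (k - D)) / (n choose k)"
  define g where "g = (\<lambda>\<pi> Y. f (\<pi> ` matching k Y))"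
  define J where "J = (\<lambda>\<pi>. \<Sum>r<l. cube_avg l (\<lambda>Y. of_bool (g \<pi> (flip r Y) \<noteq> g \<pi> Y)))"
  let ?V = "{j. j < n \<and> asymmetric n k f i0 j}"
  have flip: "g \<pi> (flip r Y) = f (transp (\<pi> r) (\<pi> (k + r)) ` \<pi> ` matching k Y)"
    if "\<pi> permutes {..<n}" "Y \<subseteq> {..<l}" "r < l" for \<pi> r Y
  proof -
    have "\<pi> ` transp r (k + r) ` matching k Y
        = transp (\<pi> r) (\<pi> (k + r)) ` \<pi> ` matching k Y"
      using permutes_inj[OF that(1)] by (auto simp: image_comp Transposition.transpose_def inj_eq intro!: image_cong)
    thus ?thesis unfolding g_def matching_flip[OF that(2) l(1) that(3)] by simp
  qed
  \<comment> \<open>Two members of the class of \<open>i0\<close> are interchangeable, so a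
    sensitive pair touches one of the \<open>s\<close> variables outside, and disjoint pairs touch
    different ones.\<close>
  have J_le: "J \<pi> \<le> s" if \<pi>: "\<pi> permutes {..<n}" for \<pi>
  proof -
    let ?R = "{r. r < l \<and> (\<pi> r \<in> ?V \<or> \<pi> (k + r) \<in> ?V)}"
    have "cube_avg l (\<lambda>Y. of_bool (g \<pi> (flip r Y) \<noteq> g \<pi> Y)) \<le> of_bool (r \<in> ?R)" if r: "r < l" for r
    proof (cases "r \<in> ?R")
      case True
      have "cube_avg l (\<lambda>Y. of_bool (g \<pi> (flip r Y) \<noteq> g \<pi> Y)) \<le> cube_avg l (\<lambda>Y. 1)"
        by (intro cube_avg_mono) simp
      thus ?thesis using True by simp
    next
      case False
      have lt: "\<pi> r < n" "\<pi> (k + r) < n" using permutes_in_image[OF \<pi>] r l by auto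
      hence "\<not> asymmetric n k f (\<pi> r) (\<pi> (k + r))"
        using False r not_asymmetric_trans[OF _ _ i0(1) lt] by auto
      hence "g \<pi> (flip r Y) = g \<pi> Y" if "Y \<subseteq> {..<l}" for Y
        using flip[OF \<pi> that r] kslice_image[OF \<pi> matching_kslice[OF that l(1,2)]]
        by (auto simp: asymmetric_def g_def)
      hence "cube_avg l (\<lambda>Y. of_bool (g \<pi> (flip r Y) \<noteq> g \<pi> Y)) = cube_avg l (\<lambda>Y. 0)"
        by (intro cube_avg_cong) simp
      thus ?thesis by simp
    qed
    hence "J \<pi> \<le> (\<Sum>r<l. of_bool (r \<in> ?R))" unfolding J_def by (intro sum_mono) auto
    also have "(\<Sum>r\<in>A. of_bool (r \<in> R)) = real (card (A \<inter> R))" if "finite A" for A R :: "nat set"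
      using that by (simp add: sum.If_cases of_bool_def)
    hence "(\<Sum>r<l. of_bool (r \<in> ?R)) = real (card ({..<l} \<inter> ?R))" by blast
    also have "{..<l} \<inter> ?R = ?R" by auto
    also have "card ?R \<le> s"
      using card_touched_pairs[OF permutes_inj[OF \<pi>] _ l(1), of ?V] i0(2) by simp
    finally show ?thesis by simp
  qed
  have J_ge: "w * s \<le> perm_avg n J"
  proof -
    let ?\<Phi> = "\<lambda>M a b. of_bool (f (transp a b ` M) \<noteq> f M) :: real"
    let ?S = "\<Sum>(M, a, b)\<in>flags n k. ?\<Phi> M a b"
    have "perm_avg n (\<lambda>\<pi>. of_bool (g \<pi> (flip r Y) \<noteq> g \<pi> Y)) = ?S / card (flags n k)"
      if Y: "Y \<subseteq> {..<l}" and r: "r < l" for r Y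
    proof -
      have in_slice: "matching k Y \<in> kslice n k" by (rule matching_kslice[OF Y l(1,2)])
      \<comment> \<open>The pair \<open>r\<close>, \<open>k + r\<close> is oriented:
        \<open>a\<close> is the end contained in the point, \<open>b\<close> the other one.\<close>
      define a where "a = (if r \<in> Y then k + r else r)"
      define b where "b = (if r \<in> Y then r else k + r)"
      have ab: "(matching k Y, a, b) \<in> flags n k"
        using in_slice r l mem_matching[OF Y l(1)] by (auto simp: flags_def a_def b_def)
      have swap: "transp (\<pi> r) (\<pi> (k + r)) = transp (\<pi> a) (\<pi> b)"
        for \<pi> :: "nat \<Rightarrow> nat"
        using transpose_commute[of "\<pi> r" "\<pi> (k + r)"] by (cases "r \<in> Y") (simp_all add: a_def b_def)
      have "perm_avg n (\<lambda>\<pi>. of_bool (g \<pi> (flip r Y) \<noteq> g \<pi> Y))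
          = perm_avg n (\<lambda>\<pi>. ?\<Phi> (\<pi> ` matching k Y) (\<pi> a) (\<pi> b))"
        unfolding perm_avg_def
        by (intro arg_cong[where f = "\<lambda>x. x / _"] sum.cong refl)
          (simp only: mem_Collect_eq flip[OF _ Y r] swap, simp only: g_def)
      thus ?thesis using perm_avg_flags[OF ab, of ?\<Phi>] by simp
    qed
    hence "perm_avg n J = (\<Sum>r<l. cube_avg l (\<lambda>Y. ?S / card (flags n k)))"
      unfolding J_def perm_avg_sum perm_avg_cube_avg
      by (intro sum.cong refl cube_avg_cong) auto
    also have "\<dots> = l * (?S / card (flags n k))" by simp
    also have "\<dots> \<ge> l * (real (n * s * ((n - 2 * D) choose (k - D))) / card (flags n k))"
      unfolding D_def by (intro mult_left_mono divide_right_mono sum_flags_asymmetric f dk s) auto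
    also have "l * (real (n * s * ((n - 2 * D) choose (k - D))) / card (flags n k))
        = w * s * (real (l * n) / real (k * (n - k)))"
      by (simp add: card_flags w_def)
    finally have le: "w * s * (real (l * n) / real (k * (n - k))) \<le> perm_avg n J" .
    \<comment> \<open>The product \<open>k * (n - k)\<close> is \<open>l\<close> times the larger of
      \<open>k\<close> and \<open>n - k\<close>.\<close>
    have "1 \<le> real (l * n) / real (k * (n - k))"
    proof -
      have "k * (n - k) \<le> l * n"
      proof (cases "k \<le> n - k")
        case True
        thus ?thesis by (simp add: l_def)
      next
        case False
        hence "k * (n - k) \<le> n * (n - k)" using dk by (intro mult_right_mono) auto
        thus ?thesis using False by (simp add: l_def mult.commute)
      qed
      thus ?thesis using dk by (simp add: le_divide_eq flip: of_nat_mult)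
    qed
    hence "w * s * 1 \<le> w * s * (real (l * n) / real (k * (n - k)))"
      by (intro mult_left_mono) (simp_all add: w_def)
    with le show ?thesis by simp
  qed
  \<comment> \<open>With \<open>e\<close> the mean absolute deviation on the cube,
    \<open>J \<le> s\<close> and \<open>J \<le> 4 * d * 9 ^ d * e\<^sup>2\<close> multiply to a
    bound on \<open>J\<^sup>2\<close>. Its root is \<open>c * J \<le> e\<close>, which is linear in
    \<open>J\<close> and can be averaged over permutations.\<close>
  define c where "c = 1 / (2 * sqrt d * 3 ^ d * sqrt s)"
  have c: "c > 0" using dk \<open>s > 0\<close> by (simp add: c_def)
  have cJ: "c * J \<pi> \<le> cube_avg l (\<lambda>Y. \<bar>g \<pi> Y - \<mu>\<bar>)" if \<pi>: "\<pi> permutes {..<n}" for \<pi>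
  proof -
    let ?e = "cube_avg l (\<lambda>Y. \<bar>g \<pi> Y - \<mu>\<bar>)"
    have J0: "J \<pi> \<ge> 0" unfolding J_def by (intro sum_nonneg cube_avg_nonneg) auto
    \<comment> \<open>Values are integers, so a flip that changes the value contributes at least 1/4
      to the influence.\<close>
    have "of_bool (x \<noteq> y) / 4 \<le> ((y - x) / 2)\<^sup>2" if "x \<in> \<int>" "y \<in> \<int>" for x y :: real
    proof (cases "x = y")
      case False
      have "1 \<le> \<bar>y - x\<bar>" using that False by (intro Ints_nonzero_abs_ge1) auto
      hence "1\<^sup>2 \<le> \<bar>y - x\<bar>\<^sup>2" by (intro power_mono) auto
      thus ?thesis using False by (simp add: power_divide)
    qed simp
    hence "J \<pi> / 4 \<le> (\<Sum>r<l. cube_avg l (\<lambda>Y. ((g \<pi> Y - g \<pi> (flip r Y)) / 2)\<^sup>2))"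
      unfolding J_def sum_divide_distrib cube_avg_divide[symmetric]
      using f(2) by (intro sum_mono cube_avg_mono) (auto simp: g_def)
    also have "\<dots> \<le> real d * 9 ^ d * ?e\<^sup>2"
      unfolding g_def using f(1) permutes_inj[OF \<pi>] l(1)
      by (intro cube_influence_le_abs_deviation cube_deg_matching)
    finally have J4: "J \<pi> \<le> 4 * (real d * 9 ^ d * ?e\<^sup>2)" by simp
    have "(c * J \<pi>)\<^sup>2 = J \<pi> * J \<pi> / (4 * real d * 9 ^ d * s)"
    proof -
      have "((3::real) ^ d)\<^sup>2 = 9 ^ d" by (simp add: power2_eq_square flip: power_mult_distrib)
      hence "c\<^sup>2 = 1 / (4 * real d * 9 ^ d * s)" by (simp add: c_def power_divide power_mult_distrib)
      thus ?thesis by (simp add: power_mult_distrib power2_eq_square[of "J \<pi>"])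
    qed
    also have "\<dots> \<le> s * (4 * (real d * 9 ^ d * ?e\<^sup>2)) / (4 * real d * 9 ^ d * s)"
      using J_le[OF \<pi>] J4 J0 by (intro divide_right_mono mult_mono) auto
    also have "\<dots> = ?e\<^sup>2" using dk \<open>s > 0\<close> by simp
    finally have "(c * J \<pi>)\<^sup>2 \<le> ?e\<^sup>2" .
    thus ?thesis by (rule power2_le_imp_le) (intro cube_avg_nonneg, simp)
  qed
  have "sqrt s * w / (2 * sqrt d * 3 ^ d) = c * (w * s)"
  proof -
    have "c * (w * s) = (s / sqrt s) * w / (2 * sqrt d * 3 ^ d)" by (simp add: c_def mult_ac)
    thus ?thesis by (simp only: real_div_sqrt of_nat_0_le_iff)
  qed
  also have "\<dots> \<le> c * perm_avg n J" using J_ge c by (intro mult_left_mono) auto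
  also have "\<dots> = perm_avg n (\<lambda>\<pi>. c * J \<pi>)" by (simp add: perm_avg_cmult)
  also have "\<dots> \<le> perm_avg n (\<lambda>\<pi>. cube_avg l (\<lambda>Y. \<bar>g \<pi> Y - \<mu>\<bar>))"
    using cJ by (rule perm_avg_mono)
  also have "\<dots> = cube_avg l (\<lambda>Y. kslice_avg n k (\<lambda>M. \<bar>f M - \<mu>\<bar>))"
    unfolding perm_avg_cube_avg g_def
    by (intro cube_avg_cong perm_avg_kslice[where \<Phi> = "\<lambda>M. \<bar>f M - \<mu>\<bar>"] matching_kslice[OF _ l(1,2)] dk)
  also have "\<dots> = kslice_avg n k (\<lambda>M. \<bar>f M - \<mu>\<bar>)" by simp
  finally show ?thesis unfolding w_def .
qed

section \<open>Evaluation of programs\<close>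

text \<open>Evaluation becomes a partial function to result and cost, so that bodies can be executed
  by rewriting with \<open>run_simps\<close>. Determinism makes the choice unique.\<close>

definition run_exp :: "program \<Rightarrow> btree list \<Rightarrow> exp \<Rightarrow> (btree \<times> nat) option" where
  "run_exp F env e = (if \<exists>r. eval F env e (fst r) (snd r)
     then Some (SOME r. eval F env e (fst r) (snd r)) else None)"

definition run_exps :: "program \<Rightarrow> btree list \<Rightarrow> exp list \<Rightarrow> (btree list \<times> nat) option" where
  "run_exps F env es = (if \<exists>r. evals F env es (fst r) (snd r)
     then Some (SOME r. evals F env es (fst r) (snd r)) else None)"

lemma run_exp_eq_Some: "run_exp F env e = Some (v, t) \<longleftrightarrow> eval F env e v t"
proof (cases "\<exists>r. eval F env e (fst r) (snd r)")
  case True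
  then obtain w s where ws: "eval F env e w s" by auto
  have "(SOME r. eval F env e (fst r) (snd r)) = (w, s)"
    by (rule some_equality) (use ws in \<open>auto simp: prod_eq_iff dest: eval_deterministic(1)[OF ws]\<close>)
  with True show ?thesis using ws by (auto simp: run_exp_def dest: eval_deterministic(1)[OF ws])
qed (auto simp: run_exp_def)

lemma run_exps_eq_Some: "run_exps F env es = Some (vs, t) \<longleftrightarrow> evals F env es vs t"
proof (cases "\<exists>r. evals F env es (fst r) (snd r)")
  case True
  then obtain w s where ws: "evals F env es w s" by auto
  have "(SOME r. evals F env es (fst r) (snd r)) = (w, s)"
    by (rule some_equality) (use ws in \<open>auto simp: prod_eq_iff dest: eval_deterministic(2)[OF ws]\<close>)
  with True show ?thesis using ws by (auto simp: run_exps_def dest: eval_deterministic(2)[OF ws])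
qed (auto simp: run_exps_def)

lemma option_pair_eqI:
  assumes "\<And>v t. x = Some (v, t) \<longleftrightarrow> y = Some (v, t)"
  shows "x = y"
  using assms by (metis not_Some_eq surj_pair)

inductive_cases eval_VarE: "eval F env (EVar i) v t"
inductive_cases eval_LeafE: "eval F env ELeaf v t"
inductive_cases eval_NodeE: "eval F env (ENode e1 e2) v t"
inductive_cases eval_LeftE: "eval F env (ELeft e) v t"
inductive_cases eval_RightE: "eval F env (ERight e) v t"
inductive_cases eval_IfE: "eval F env (EIf e e1 e2) v t"
inductive_cases eval_LetE: "eval F env (ELet e1 e2) v t"
inductive_cases eval_CallE: "eval F env (ECall i es) v t"
inductive_cases evals_NilE: "evals F env [] v t"
inductive_cases evals_ConsE: "evals F env (e # es) v t"

text \<open>Calls stay folded in \<open>run_exp_Call\<close>. Substituting \<open>call_prog\<close>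
  opens just the outer call, so recursive calls remain for the induction hypothesis.\<close>

definition call :: "program \<Rightarrow> nat \<Rightarrow> btree list \<Rightarrow> (btree \<times> nat) option" where
  "call F i vs = run_exp F vs (F ! i)"

lemma run_exp_Var: "run_exp F env (EVar i) = (if i < length env then Some (env ! i, 1) else None)"
  by (rule option_pair_eqI) (auto simp: run_exp_eq_Some intro: eval_Var[simplified] elim: eval_VarE)

lemma run_exp_Leaf: "run_exp F env ELeaf = Some (BLeaf, 1)"
  by (rule option_pair_eqI) (auto simp: run_exp_eq_Some intro: eval_Leaf[simplified] elim: eval_LeafE)

lemma run_exp_Node: "run_exp F env (ENode e1 e2) = Option.bind (run_exp F env e1) (\<lambda>(v, s). Option.bind (run_exp F env e2)
     (\<lambda>(w, t). Some (BNode v w, s + t + 1)))"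
  by (rule option_pair_eqI)
    (auto simp: bind_eq_Some_conv run_exp_eq_Some elim!: eval_NodeE intro!: eval_Node[simplified])

lemma run_exp_Left: "run_exp F env (ELeft e) = Option.bind (run_exp F env e) (\<lambda>(v, s). Some (bleft v, s + 1))"
  by (rule option_pair_eqI)
    (auto simp: bind_eq_Some_conv run_exp_eq_Some elim!: eval_LeftE intro!: eval_Left[simplified])

lemma run_exp_Right: "run_exp F env (ERight e) = Option.bind (run_exp F env e) (\<lambda>(v, s). Some (bright v, s + 1))"
  by (rule option_pair_eqI)
    (auto simp: bind_eq_Some_conv run_exp_eq_Some elim!: eval_RightE intro!: eval_Right[simplified])

lemma run_exp_If: "run_exp F env (EIf e e1 e2) = Option.bind (run_exp F env e) (\<lambda>(v, s).
     Option.bind (if v = BLeaf then run_exp F env e2 else run_exp F env e1) (\<lambda>(w, t). Some (w, s + t + 1)))"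
proof (rule option_pair_eqI)
  fix v t
  have "eval F env (EIf e e1 e2) v t \<longleftrightarrow> (\<exists>w s s'. t = s + s' + 1 \<and> eval F env e w s \<and>
      (if w = BLeaf then eval F env e2 v s' else eval F env e1 v s'))" (is "?L \<longleftrightarrow> ?R")
  proof
    show "?L \<Longrightarrow> ?R" by (erule eval_IfE) force+
    show "?R \<Longrightarrow> ?L" by (auto split: if_splits intro: eval_If_Node[simplified] eval_If_Leaf[simplified])
  qed
  thus "(run_exp F env (EIf e e1 e2) = Some (v, t)) = (Option.bind (run_exp F env e) (\<lambda>(v, s).
     Option.bind (if v = BLeaf then run_exp F env e2 else run_exp F env e1) (\<lambda>(w, t). Some (w, s + t + 1))) = Some (v, t))"
    by (auto simp: bind_eq_Some_conv run_exp_eq_Some split: if_splits)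
qed

lemma run_exp_Let: "run_exp F env (ELet e1 e2) = Option.bind (run_exp F env e1) (\<lambda>(v, s). Option.bind (run_exp F (v # env) e2)
     (\<lambda>(w, t). Some (w, s + t + 1)))"
  by (rule option_pair_eqI)
    (auto simp: bind_eq_Some_conv run_exp_eq_Some elim!: eval_LetE intro!: eval_Let[simplified])

lemma run_exp_Call: "run_exp F env (ECall i es) = (if i < length F then Option.bind (run_exps F env es) (\<lambda>(vs, s).
     Option.bind (call F i vs) (\<lambda>(w, t). Some (w, s + t + 1))) else None)"
  by (rule option_pair_eqI)
    (auto simp: bind_eq_Some_conv call_def run_exp_eq_Some run_exps_eq_Some elim!: eval_CallE intro!: eval_Call[simplified])

lemma run_exps_Nil: "run_exps F env [] = Some ([], 0)"
  by (rule option_pair_eqI) (auto simp: run_exps_eq_Some intro: evals_Nil elim: evals_NilE)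

lemma run_exps_Cons: "run_exps F env (e # es) = Option.bind (run_exp F env e) (\<lambda>(v, s). Option.bind (run_exps F env es)
     (\<lambda>(vs, t). Some (v # vs, s + t)))"
  by (rule option_pair_eqI)
    (auto simp: bind_eq_Some_conv run_exp_eq_Some run_exps_eq_Some elim!: evals_ConsE intro!: evals_Cons)

lemmas run_simps = run_exp_Var run_exp_Leaf run_exp_Node run_exp_Left run_exp_Right
  run_exp_If run_exp_Let run_exp_Call run_exps_Nil run_exps_Cons

section \<open>The program\<close>

text \<open>Lists are right spines, a leaf is false and every other tree is true, and unary numbers are lists
  of leaves. A subtree of a leaf is again a leaf, so reading past the end of a list or of a
  binary number yields false or zero. The bodies are numbered by their position in
  \<open>prog\<close>; the variable \<open>EVar i\<close> is argument number \<open>i\<close>, shifted by one below \<open>ELet\<close>.\<close>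

abbreviation etrue :: exp where "etrue \<equiv> ENode ELeaf ELeaf"

definition body_eq :: exp where
  "body_eq = EIf (EVar 0)
     (EIf (EVar 1)
        (EIf (ECall 1 [ELeft (EVar 0), ELeft (EVar 1)])
           (ECall 1 [ERight (EVar 0), ERight (EVar 1)]) ELeaf)
        ELeaf)
     (EIf (EVar 1) ELeaf etrue)"

definition body_mem :: exp where
  "body_mem = EIf (EVar 1)
     (EIf (ECall 1 [EVar 0, ELeft (EVar 1)]) etrue (ECall 2 [EVar 0, ERight (EVar 1)])) ELeaf"

definition body_half :: exp where
  "body_half = EIf (EVar 0)
     (ENode (ELeft (EVar 0)) (ECall 3 [ERight (ERight (EVar 0))])) ELeaf"

text \<open>In the order of \<open>n_lists\<close> the first coordinate alternates fastest, so fixing it selects every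
  second entry of the truth table.\<close>

definition body_sat :: exp where
  "body_sat = EIf (EVar 1)
     (ECall 4 [EVar 0, ERight (EVar 1),
        ECall 3 [EIf (ECall 2 [ELeft (EVar 1), EVar 0]) (EVar 2) (ERight (EVar 2))]])
     (ELeft (EVar 2))"

definition body_inc :: exp where
  "body_inc = EIf (EVar 0)
     (EIf (ELeft (EVar 0)) (ENode ELeaf (ECall 5 [ERight (EVar 0)]))
        (ENode etrue (ERight (EVar 0))))
     (ENode etrue ELeaf)"

definition body_count :: exp where
  "body_count = EIf (EVar 1)
     (EIf (ECall 4 [EVar 0, ELeft (ELeft (EVar 1)), ERight (ELeft (EVar 1))])
        (ECall 5 [ECall 6 [EVar 0, ERight (EVar 1)]])
        (ECall 6 [EVar 0, ERight (EVar 1)]))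
     ELeaf"

definition body_swap :: exp where
  "body_swap = EIf (EVar 2)
     (ENode (EIf (ECall 1 [EVar 0, ELeft (EVar 2)]) (EVar 1)
               (EIf (ECall 1 [EVar 1, ELeft (EVar 2)]) (EVar 0) (ELeft (EVar 2))))
        (ECall 7 [EVar 0, EVar 1, ERight (EVar 2)]))
     ELeaf"

text \<open>The arguments are \<open>U\<close>, \<open>k\<close> and \<open>B\<close>; the result is \<open>U\<close> followed by \<open>k - |U|\<close> elements of \<open>B\<close>.\<close>

definition body_fill :: exp where
  "body_fill = EIf (EVar 0)
     (ENode (ELeft (EVar 0)) (ECall 8 [ERight (EVar 0), ERight (EVar 1), EVar 2]))
     (EIf (EVar 1)
        (EIf (EVar 2)
           (ENode (ELeft (EVar 2)) (ECall 8 [ELeaf, ERight (EVar 1), ERight (EVar 2)]))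
           ELeaf)
        ELeaf)"

text \<open>The arguments are the number of swaps still to be made, the current point, the transposition
  \<open>(i, j)\<close> to be tested, the pairs still to be tried for the next swap, all pairs, and the constraints.\<close>

definition body_test :: exp where
  "body_test = EIf (EVar 0)
     (EIf (EVar 4)
        (EIf (ECall 9 [ERight (EVar 0),
                ECall 7 [ELeft (ELeft (EVar 4)), ERight (ELeft (EVar 4)), EVar 1],
                EVar 2, EVar 3, EVar 5, EVar 5, EVar 6])
           (ECall 9 [EVar 0, EVar 1, EVar 2, EVar 3, ERight (EVar 4), EVar 5, EVar 6])
           ELeaf)
        etrue)
     (ECall 1 [ECall 6 [EVar 1, EVar 6], ECall 6 [ECall 7 [EVar 2, EVar 3, EVar 1], EVar 6]])"

text \<open>The arguments are the degree, \<open>i\<close>, the variables to be classified, the test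
  point, all pairs and the constraints. The left result collects the variables not interchangeable
  with \<open>i\<close>, the right one the others.\<close>

definition body_split :: exp where
  "body_split = EIf (EVar 2)
     (ELet (ECall 10 [EVar 0, EVar 1, ERight (EVar 2), EVar 3, EVar 4, EVar 5])
        (EIf (ECall 9 [EVar 1, EVar 4, EVar 2, ELeft (EVar 3), EVar 5, EVar 5, EVar 6])
           (ENode (ELeft (EVar 0)) (ENode (ELeft (EVar 3)) (ERight (EVar 0))))
           (ENode (ENode (ELeft (EVar 3)) (ELeft (EVar 0))) (ERight (EVar 0)))))
     (ENode ELeaf ELeaf)"

text \<open>The arguments are the degree still available, the remaining variables, \<open>S\<close>, \<open>U\<close>, the sign, the
  denominator, \<open>B\<close>, \<open>k\<close>, the constraints and an accumulator. A variable is skipped, or it contributes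
  one of the four terms of \<open>(1 - x) / 2 * (G (insert v U) - G U)\<close>.\<close>

definition call_terms :: "exp \<Rightarrow> exp \<Rightarrow> exp \<Rightarrow> exp \<Rightarrow> exp" where
  "call_terms S U sg acc = ECall 11 [ERight (EVar 0), ERight (EVar 1), S, U, sg,
     ENode ELeaf (EVar 5), EVar 6, EVar 7, EVar 8, acc]"

definition body_terms :: exp where
  "body_terms =
    (let v = ELeft (EVar 1); S = EVar 2; U = EVar 3; sg = EVar 4; neg = EIf sg ELeaf etrue in
     EIf (EVar 1)
       (ECall 11 [EVar 0, ERight (EVar 1), S, U, sg, EVar 5, EVar 6, EVar 7, EVar 8,
          EIf (EVar 0)
            (call_terms S (ENode v U) sg
              (call_terms (ENode v S) (ENode v U) neg
                (call_terms S U neg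
                  (call_terms (ENode v S) U sg (EVar 9)))))
            (EVar 9)])
       (ELet (ECall 6 [ECall 8 [EVar 3, EVar 7, EVar 6], EVar 8])
          (ENode
            (ENode (EVar 3)
              (ENode (ENode (EIf (EVar 0) (EVar 5) ELeaf) (EVar 0)) (EVar 6)))
            (EVar 10))))"

definition body_add :: exp where
  "body_add =
    (let x = ELeft (EVar 0); y = ELeft (EVar 1); c = EVar 2;
         rest = (\<lambda>e. ECall 12 [ERight (EVar 0), ERight (EVar 1), e]);
         one = EIf c (ENode ELeaf (rest etrue)) (ENode etrue (rest ELeaf)) in
     EIf (EIf (EVar 0) etrue (EVar 1))
       (EIf x (EIf y (ENode c (rest etrue)) one)
              (EIf y one (ENode c (rest ELeaf))))
       (EIf c (ENode etrue ELeaf) ELeaf))"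

definition body_mul :: exp where
  "body_mul = EIf (EVar 0)
     (EIf (ELeft (EVar 0))
        (ECall 12 [EVar 1, ENode ELeaf (ECall 13 [ERight (EVar 0), EVar 1]), ELeaf])
        (ENode ELeaf (ECall 13 [ERight (EVar 0), EVar 1])))
     ELeaf"

text \<open>Only the length of the first argument matters, so a list of variables can be multiplied
  by a binary number without computing its length.\<close>

definition body_umul :: exp where
  "body_umul = EIf (EVar 0) (ECall 12 [EVar 1, ECall 14 [ERight (EVar 0), EVar 1], ELeaf]) ELeaf"

text \<open>Digits come least significant first, so the third argument carries the verdict of the
  lower digits and any later difference overrides it. Starting with true gives the nonstrict
  comparison.\<close>

definition body_le :: exp where
  "body_le =
    (let x = ELeft (EVar 0); y = ELeft (EVar 1); c = EVar 2;
         rest = (\<lambda>e. ECall 15 [ERight (EVar 0), ERight (EVar 1), e]) in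
     EIf (EIf (EVar 0) etrue (EVar 1))
       (EIf x (EIf y (rest c) (rest ELeaf)) (EIf y (rest etrue) (rest c)))
       c)"

definition body_double :: exp where
  "body_double = EIf (EVar 0) (ENode ELeaf (ENode ELeaf (ECall 16 [ERight (EVar 0)]))) ELeaf"

definition body_unary :: exp where
  "body_unary = EIf (EVar 0)
     (EIf (ELeft (EVar 0)) (ENode ELeaf (ECall 16 [ECall 17 [ERight (EVar 0)]]))
        (ECall 16 [ECall 17 [ERight (EVar 0)]]))
     ELeaf"

definition body_upt :: exp where
  "body_upt = EIf (EVar 0) (ENode (EVar 1) (ECall 18 [ERight (EVar 0), ECall 5 [EVar 1]])) ELeaf"

definition body_row :: exp where
  "body_row = EIf (EVar 1)
     (ENode (ENode (EVar 0) (ELeft (EVar 1))) (ECall 19 [EVar 0, ERight (EVar 1), EVar 2]))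
     (EVar 2)"

definition body_pairs :: exp where
  "body_pairs = EIf (EVar 0)
     (ECall 19 [ELeft (EVar 0), EVar 1, ECall 20 [ERight (EVar 0), EVar 1]]) ELeaf"

text \<open>The arguments are the candidates \<open>i\<close>, all variables, the degree, the first point of the slice, all
  pairs, the constraints, \<open>k\<close>, and the two sides \<open>b\<^sup>2\<close> and \<open>K2 * a\<^sup>2\<close> of the test for \<open>t = a / b\<close>.\<close>

definition body_search :: exp where
  "body_search = EIf (EVar 0)
     (ELet (ECall 10 [EVar 2, ELeft (EVar 0), EVar 1, EVar 3, EVar 4, EVar 5])
        (EIf (ECall 15 [ECall 14 [ELeft (EVar 0), EVar 8], EVar 9, etrue])
           (ENode (ELeft (EVar 0))
              (ECall 11 [EVar 3, ELeft (EVar 0), ELeaf, ELeaf, ELeaf, ENode etrue ELeaf,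
                 ERight (EVar 0), EVar 7, EVar 6, ELeaf]))
           (ECall 21 [ERight (EVar 1), EVar 2, EVar 3, EVar 4, EVar 5, EVar 6, EVar 7, EVar 8,
              EVar 9])))
     ELeaf"

fun const_exp :: "btree \<Rightarrow> exp" where
  "const_exp BLeaf = ELeaf" | "const_exp (BNode a b) = ENode (const_exp a) (const_exp b)"

definition un :: "nat \<Rightarrow> btree" where
  "un k = enc_list (replicate k BLeaf)"

text \<open>The arguments are all variables, \<open>k\<close> in unary, the constraints,
  \<open>b\<^sup>2\<close> and \<open>a\<^sup>2\<close> for \<open>t = a / b\<close>. The constants
  \<open>d\<close>, \<open>K1\<close> and \<open>K2\<close> are compiled into the body as
  trees.\<close>

definition body_decide :: "nat \<Rightarrow> nat \<Rightarrow> nat \<Rightarrow> exp" where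
  "body_decide d K1 K2 =
     EIf (ECall 15 [ECall 14 [EVar 0, EVar 3], ECall 14 [const_exp (un K1), EVar 4], etrue])
       (ENode (EVar 0)
          (ECall 11 [const_exp (un d), EVar 0, ELeaf, ELeaf, ELeaf, ENode etrue ELeaf,
             ELeaf, EVar 1, EVar 2, ELeaf]))
       (ECall 21 [EVar 0, EVar 0, const_exp (un d), ECall 8 [ELeaf, EVar 1, EVar 0],
          ECall 20 [EVar 0, EVar 0], EVar 2, EVar 1, EVar 3, ECall 14 [const_exp (un K2), EVar 4]])"

text \<open>The sign of \<open>t\<close> is skipped, because only its square enters the
  tests.\<close>

definition body_main :: exp where
  "body_main =
    (let I = ELeft (EVar 0); t = ELeft (ERight (EVar 0)); k = ERight (ERight (EVar 0));
         num = ERight (ELeft t); den = ERight t in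
     ECall 22 [ECall 18 [ECall 17 [ELeft I], ELeaf], ECall 17 [k], ERight I,
       ECall 13 [den, den], ECall 13 [num, num]])"

definition prog :: "nat \<Rightarrow> nat \<Rightarrow> nat \<Rightarrow> program" where
  "prog d K1 K2 = [body_main, body_eq, body_mem, body_half, body_sat, body_inc, body_count,
     body_swap, body_fill, body_test, body_split, body_terms, body_add, body_mul, body_umul,
     body_le, body_double, body_unary, body_upt, body_row, body_pairs, body_search,
     body_decide d K1 K2]"

lemma length_prog [simp]: "length (prog d K1 K2) = 23"
  by (simp add: prog_def)

lemma call_prog:
  "call (prog d K1 K2) 0 vs = run_exp (prog d K1 K2) vs body_main"
  "call (prog d K1 K2) 1 vs = run_exp (prog d K1 K2) vs body_eq"
  "call (prog d K1 K2) 2 vs = run_exp (prog d K1 K2) vs body_mem"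
  "call (prog d K1 K2) 3 vs = run_exp (prog d K1 K2) vs body_half"
  "call (prog d K1 K2) 4 vs = run_exp (prog d K1 K2) vs body_sat"
  "call (prog d K1 K2) 5 vs = run_exp (prog d K1 K2) vs body_inc"
  "call (prog d K1 K2) 6 vs = run_exp (prog d K1 K2) vs body_count"
  "call (prog d K1 K2) 7 vs = run_exp (prog d K1 K2) vs body_swap"
  "call (prog d K1 K2) 8 vs = run_exp (prog d K1 K2) vs body_fill"
  "call (prog d K1 K2) 9 vs = run_exp (prog d K1 K2) vs body_test"
  "call (prog d K1 K2) 10 vs = run_exp (prog d K1 K2) vs body_split"
  "call (prog d K1 K2) 11 vs = run_exp (prog d K1 K2) vs body_terms"
  "call (prog d K1 K2) 12 vs = run_exp (prog d K1 K2) vs body_add"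
  "call (prog d K1 K2) 13 vs = run_exp (prog d K1 K2) vs body_mul"
  "call (prog d K1 K2) 14 vs = run_exp (prog d K1 K2) vs body_umul"
  "call (prog d K1 K2) 15 vs = run_exp (prog d K1 K2) vs body_le"
  "call (prog d K1 K2) 16 vs = run_exp (prog d K1 K2) vs body_double"
  "call (prog d K1 K2) 17 vs = run_exp (prog d K1 K2) vs body_unary"
  "call (prog d K1 K2) 18 vs = run_exp (prog d K1 K2) vs body_upt"
  "call (prog d K1 K2) 19 vs = run_exp (prog d K1 K2) vs body_row"
  "call (prog d K1 K2) 20 vs = run_exp (prog d K1 K2) vs body_pairs"
  "call (prog d K1 K2) 21 vs = run_exp (prog d K1 K2) vs body_search"
  "call (prog d K1 K2) 22 vs = run_exp (prog d K1 K2) vs (body_decide d K1 K2)"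
  by (simp_all add: call_def prog_def)

lemma run_exp_const_exp: "run_exp F env (const_exp v) = Some (v, 2 * size v + 1)"
  by (induction v) (auto simp: run_simps)

lemma size_un [simp]: "size (un k) = k"
  by (induction k) (auto simp: un_def)

lemma un_simps [simp]: "un 0 = BLeaf" "un (Suc k) = BNode BLeaf (un k)"
  by (auto simp: un_def)

section \<open>Results and costs of the single functions of the program\<close>

context
  fixes d K1 K2 :: nat
begin

abbreviation (input) "Prog \<equiv> prog d K1 K2"

text \<open>The comparison ends when the first argument is exhausted, so its size alone bounds the
  cost.\<close>

lemma call_eq: "\<exists>T \<le> 40 * size a + 20. call Prog 1 [a, b] = Some (enc_bool (a = b), T)"
proof (induction a arbitrary: b)
  case BLeaf
  show ?case by (subst call_prog, cases b) (auto simp: body_eq_def run_simps enc_bool_def)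
next
  case (BNode a1 a2)
  show ?case
  proof (cases b)
    case BLeaf
    thus ?thesis by (subst call_prog) (simp add: body_eq_def run_simps enc_bool_def)
  next
    case b: (BNode b1 b2)
    obtain T1 where 1: "T1 \<le> 40 * size a1 + 20" "call Prog 1 [a1, b1] = Some (enc_bool (a1 = b1), T1)"
      using BNode.IH(1) by blast
    obtain T2 where 2: "T2 \<le> 40 * size a2 + 20" "call Prog 1 [a2, b2] = Some (enc_bool (a2 = b2), T2)"
      using BNode.IH(2) by blast
    show ?thesis
      by (subst call_prog) (use 1 2 in \<open>simp add: body_eq_def run_simps enc_bool_def b\<close>)
  qed
qed

lemma call_mem:
  assumes "size x \<le> z"
  shows "\<exists>T \<le> (length M + 1) * (40 * z + 50).
    call Prog 2 [x, enc_list M] = Some (enc_bool (x \<in> set M), T)"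
proof (induction M)
  case Nil
  show ?case by (subst call_prog) (simp add: body_mem_def run_simps enc_bool_def)
next
  case (Cons y M)
  obtain T1 where 1: "T1 \<le> 40 * size x + 20" "call Prog 1 [x, y] = Some (enc_bool (x = y), T1)"
    using call_eq by blast
  obtain T2 where 2: "T2 \<le> (length M + 1) * (40 * z + 50)"
      "call Prog 2 [x, enc_list M] = Some (enc_bool (x \<in> set M), T2)"
    using Cons.IH by blast
  show ?case
    by (subst call_prog) (use 1 2 assms in \<open>auto simp: body_mem_def run_simps enc_bool_def\<close>)
qed

fun evens :: "'a list \<Rightarrow> 'a list" where
  "evens [] = []" | "evens [x] = [x]" | "evens (x # y # xs) = x # evens xs"

lemma call_half: "\<exists>T \<le> 10 * length l + 10. call Prog 3 [enc_list l] = Some (enc_list (evens l), T)"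
proof (induction l rule: evens.induct)
  case 1
  show ?case by (subst call_prog) (simp add: body_half_def run_simps)
next
  case (2 x)
  have "call Prog 3 [BLeaf] = Some (BLeaf, 3)"
    by (subst call_prog) (simp add: body_half_def run_simps)
  thus ?case by (subst call_prog) (simp add: body_half_def run_simps)
next
  case (3 x y xs)
  then obtain T where "T \<le> 10 * length xs + 10" "call Prog 3 [enc_list xs] = Some (enc_list (evens xs), T)"
    by blast
  thus ?case by (subst call_prog) (simp add: body_half_def run_simps)
qed

lemma enc_nat_0: "enc_nat 0 = BLeaf"
  by (simp add: enc_nat.simps)

lemma enc_nat_Suc: "enc_nat (Suc n) = BNode (enc_bool (even n)) (enc_nat (Suc n div 2))"
  by (subst enc_nat.simps) simp

lemma enc_nat_pos: "n > 0 \<Longrightarrow> enc_nat n = BNode (enc_bool (odd n)) (enc_nat (n div 2))"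
  by (subst enc_nat.simps) simp

lemma call_inc: "\<exists>T \<le> 20 * n + 20. call Prog 5 [enc_nat n] = Some (enc_nat (Suc n), T)"
proof (induction n rule: less_induct)
  case (less n)
  show ?case
  proof (cases "n = 0")
    case True
    thus ?thesis
      by (subst call_prog) (simp add: body_inc_def run_simps enc_nat.simps enc_bool_def)
  next
    case False
    then obtain T where T: "T \<le> 20 * (n div 2) + 20"
        "call Prog 5 [enc_nat (n div 2)] = Some (enc_nat (Suc (n div 2)), T)"
      using less.IH[of "n div 2"] by auto
    show ?thesis
    proof (cases "even n")
      case True
      hence "Suc n div 2 = n div 2" by simp
      with True show ?thesis using \<open>n \<noteq> 0\<close>
        by (subst call_prog) (simp add: body_inc_def run_simps enc_bool_def enc_nat_Suc enc_nat_pos)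
    next
      case False
      hence "Suc n div 2 = Suc (n div 2)" by simp
      with False show ?thesis using \<open>n \<noteq> 0\<close> T
        by (subst call_prog) (auto simp: body_inc_def run_simps enc_bool_def enc_nat_Suc enc_nat_pos)
    qed
  qed
qed

lemma size_enc_nat: "size (enc_nat n) \<le> 2 * n"
proof (induction n rule: less_induct)
  case (less n)
  show ?case
  proof (cases "n = 0")
    case False
    have "size (enc_bool b) \<le> (if b then 1 else 0)" for b by (simp add: enc_bool_def)
    from this[of "odd n"] less.IH[of "n div 2"] False show ?thesis
      by (cases "even n") (auto simp: enc_nat_pos elim!: evenE oddE)
  qed (simp add: enc_nat_0)
qed

lemma enc_nat_eq_iff [simp]: "enc_nat a = enc_nat b \<longleftrightarrow> a = b"
  using enc_nat_inj by blast

lemma enc_nats_simps [simp]: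
  "enc_nats [] = BLeaf" "enc_nats (x # xs) = BNode (enc_nat x) (enc_nats xs)"
  by (auto simp: enc_nats_def)

lemma call_eq_nat:
  assumes "a \<le> n"
  shows "\<exists>T \<le> 80 * n + 20. call Prog 1 [enc_nat a, enc_nat b] = Some (enc_bool (a = b), T)"
proof -
  obtain T where "T \<le> 40 * size (enc_nat a) + 20"
      "call Prog 1 [enc_nat a, enc_nat b] = Some (enc_bool (enc_nat a = enc_nat b), T)"
    using call_eq by blast
  thus ?thesis using size_enc_nat[of a] assms by (intro exI[of _ T]) simp
qed

lemma call_mem_nat:
  assumes "x \<le> n"
  shows "\<exists>T \<le> (length M + 1) * (80 * n + 50).
    call Prog 2 [enc_nat x, enc_nats M] = Some (enc_bool (x \<in> set M), T)"
  using call_mem[of "enc_nat x" "2 * n" "map enc_nat M"] size_enc_nat[of x] assms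
  by (auto simp: enc_nats_def image_iff)

definition pt :: "nat set \<Rightarrow> nat \<Rightarrow> int" where
  "pt M i = (if i \<in> M then -1 else 1)"

definition table :: "nat \<Rightarrow> int list set \<Rightarrow> btree" where
  "table e P = enc_list (map (\<lambda>\<sigma>. enc_bool (\<sigma> \<in> P)) (List.n_lists e [-1, 1]))"

lemma evens_table:
  "evens (map f (List.n_lists (Suc e) [a, b])) = map (\<lambda>\<sigma>. f (a # \<sigma>)) (List.n_lists e [a, b])"
  "evens (tl (map f (List.n_lists (Suc e) [a, b]))) = map (\<lambda>\<sigma>. f (b # \<sigma>)) (List.n_lists e [a, b])"
proof -
  have "evens (map f (concat (map (\<lambda>ys. [a # ys, b # ys]) xss))) = map (\<lambda>ys. f (a # ys)) xss" for xss
    by (induction xss) auto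
  thus "evens (map f (List.n_lists (Suc e) [a, b])) = map (\<lambda>\<sigma>. f (a # \<sigma>)) (List.n_lists e [a, b])"
    by simp
  have "evens (tl (map f (concat (map (\<lambda>ys. [a # ys, b # ys]) xss)))) = map (\<lambda>ys. f (b # ys)) xss" for xss
  proof (induction xss rule: induct_list012)
    case (3 x y zs)
    thus ?case by simp
  qed auto
  thus "evens (tl (map f (List.n_lists (Suc e) [a, b]))) = map (\<lambda>\<sigma>. f (b # \<sigma>)) (List.n_lists e [a, b])"
    by simp
qed

lemma call_half_table:
  "\<exists>T \<le> 10 * 2 ^ Suc e + 10. call Prog 3 [table (Suc e) P] = Some (table e {\<sigma>. -1 # \<sigma> \<in> P}, T)"
  "\<exists>T \<le> 10 * 2 ^ Suc e + 10. call Prog 3 [bright (table (Suc e) P)] = Some (table e {\<sigma>. 1 # \<sigma> \<in> P}, T)"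
proof -
  let ?l = "map (\<lambda>\<sigma>. enc_bool (\<sigma> \<in> P)) (List.n_lists (Suc e) [-1, 1])"
  have tl: "bright (enc_list l) = enc_list (tl l)" for l by (cases l) auto
  have len: "length ?l = 2 ^ Suc e" by (simp only: length_map length_n_lists) (simp add: numeral_2_eq_2)
  show "\<exists>T \<le> 10 * 2 ^ Suc e + 10. call Prog 3 [table (Suc e) P] = Some (table e {\<sigma>. -1 # \<sigma> \<in> P}, T)"
    using call_half[of ?l] unfolding len evens_table by (simp add: table_def)
  have "length (tl ?l) \<le> 2 ^ Suc e" using len by (simp only: length_tl)
  moreover obtain T where "T \<le> 10 * length (tl ?l) + 10"
      "call Prog 3 [enc_list (tl ?l)] = Some (enc_list (evens (tl ?l)), T)"
    using call_half[of "tl ?l"] by blast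
  ultimately show "\<exists>T \<le> 10 * 2 ^ Suc e + 10.
      call Prog 3 [bright (table (Suc e) P)] = Some (table e {\<sigma>. 1 # \<sigma> \<in> P}, T)"
    unfolding evens_table unfolding table_def tl by (intro exI[of _ T]) simp
qed

lemma call_sat:
  assumes "length xs = e" "set xs \<subseteq> {..<n}" "length M \<le> n"
    and "(n + 1) * (80 * n + 50) + 10 * 2 ^ e + 100 \<le> B"
  shows "\<exists>T \<le> (e + 1) * B.
    call Prog 4 [enc_nats M, enc_nats xs, table e P] = Some (enc_bool (map (pt (set M)) xs \<in> P), T)"
  using assms
proof (induction e arbitrary: xs P)
  case 0
  thus ?case by (subst call_prog) (simp add: body_sat_def run_simps table_def)
next
  case (Suc e)
  then obtain x ys where xs: "xs = x # ys" by (cases xs) auto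
  have B: "(n + 1) * (80 * n + 50) + 10 * 2 ^ e + 100 \<le> B" using Suc.prems(4) by simp
  obtain T1 where 1: "T1 \<le> (length M + 1) * (80 * n + 50)"
      "call Prog 2 [enc_nat x, enc_nats M] = Some (enc_bool (x \<in> set M), T1)"
    using call_mem_nat[of x n M] Suc.prems(2) xs by auto
  have T1: "T1 \<le> (n + 1) * (80 * n + 50)"
    using 1(1) Suc.prems(3) by (elim order_trans) (intro mult_right_mono, auto)
  define v where "v = pt (set M) x"
  obtain T2 where 2: "T2 \<le> 10 * 2 ^ Suc e + 10"
      "call Prog 3 [if x \<in> set M then table (Suc e) P else bright (table (Suc e) P)]
        = Some (table e {\<sigma>. v # \<sigma> \<in> P}, T2)"
    using call_half_table[of e P] by (cases "x \<in> set M") (auto simp: v_def pt_def)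
  obtain T3 where 3: "T3 \<le> (e + 1) * B"
      "call Prog 4 [enc_nats M, enc_nats ys, table e {\<sigma>. v # \<sigma> \<in> P}]
        = Some (enc_bool (v # map (pt (set M)) ys \<in> P), T3)"
    using Suc.IH[of ys "{\<sigma>. v # \<sigma> \<in> P}"] Suc.prems B xs by auto
  have "T1 + T2 + T3 + 50 \<le> (Suc e + 1) * B"
    using T1 2(1) 3(1) Suc.prems(4) by simp
  thus ?case using 1(2) 2(2) 3(2)
    by (subst call_prog) (cases "x \<in> set M"; simp add: body_sat_def run_simps enc_bool_def xs v_def)
qed

definition count_sat :: "constr list \<Rightarrow> nat set \<Rightarrow> nat" where
  "count_sat cs M = length (filter (\<lambda>(xs, P). map (pt M) xs \<in> P) cs)"

lemma call_count:
  assumes "\<And>xs P. (xs, P) \<in> set cs \<Longrightarrow> length xs = e \<and> set xs \<subseteq> {..<n}" "length M \<le> n"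
    and "(e + 1) * ((n + 1) * (80 * n + 50) + 10 * 2 ^ e + 100) + 20 * m + 100 \<le> B" "length cs \<le> m"
  shows "\<exists>T \<le> (length cs + 1) * B.
    call Prog 6 [enc_nats M, enc_list (map (enc_constr e) cs)] = Some (enc_nat (count_sat cs (set M)), T)"
  using assms
proof (induction cs)
  case Nil
  thus ?case by (subst call_prog) (simp add: body_count_def run_simps count_sat_def enc_nat_0)
next
  case (Cons c cs)
  obtain xs P where c: "c = (xs, P)" by (cases c)
  have "count_sat cs (set M) \<le> length cs" by (simp add: count_sat_def)
  hence le: "count_sat cs (set M) \<le> m" using Cons.prems(4) by simp
  obtain T1 where 1: "T1 \<le> (e + 1) * ((n + 1) * (80 * n + 50) + 10 * 2 ^ e + 100)"
      "call Prog 4 [enc_nats M, enc_nats xs, table e P] = Some (enc_bool (map (pt (set M)) xs \<in> P), T1)"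
    using call_sat[of xs e n M _ P] Cons.prems(1)[of xs P] Cons.prems(2) by (auto simp: c)
  obtain T2 where 2: "T2 \<le> (length cs + 1) * B"
      "call Prog 6 [enc_nats M, enc_list (map (enc_constr e) cs)] = Some (enc_nat (count_sat cs (set M)), T2)"
    using Cons.IH Cons.prems by fastforce
  obtain T3 where 3: "T3 \<le> 20 * count_sat cs (set M) + 20"
      "call Prog 5 [enc_nat (count_sat cs (set M))] = Some (enc_nat (Suc (count_sat cs (set M))), T3)"
    using call_inc by blast
  have "T1 + T2 + T3 + 50 \<le> (length (c # cs) + 1) * B"
    using 1(1) 2(1) 3(1) Cons.prems(3) le by simp
  thus ?case using 1(2) 2(2) 3(2) unfolding table_def
    by (subst call_prog)
      (cases "map (pt (set M)) xs \<in> P";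
        simp add: body_count_def run_simps enc_bool_def c enc_constr_def count_sat_def)
qed

lemma call_swap:
  assumes "a \<le> n" "b \<le> n"
  shows "\<exists>T \<le> (length M + 1) * (160 * n + 100).
    call Prog 7 [enc_nat a, enc_nat b, enc_nats M] = Some (enc_nats (map (transp a b) M), T)"
proof (induction M)
  case Nil
  thus ?case by (subst call_prog) (simp add: body_swap_def run_simps)
next
  case (Cons x M)
  then obtain T1 where 1: "T1 \<le> (length M + 1) * (160 * n + 100)"
      "call Prog 7 [enc_nat a, enc_nat b, enc_nats M] = Some (enc_nats (map (transp a b) M), T1)"
    by blast
  obtain T2 where 2: "T2 \<le> 80 * n + 20" "call Prog 1 [enc_nat a, enc_nat x] = Some (enc_bool (a = x), T2)"
    using call_eq_nat[OF assms(1)] by blast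
  obtain T3 where 3: "T3 \<le> 80 * n + 20" "call Prog 1 [enc_nat b, enc_nat x] = Some (enc_bool (b = x), T3)"
    using call_eq_nat[OF assms(2)] by blast
  have "T1 + T2 + T3 + 50 \<le> (length (x # M) + 1) * (160 * n + 100)"
    using 1(1) 2(1) 3(1) by simp
  thus ?case using 1(2) 2(2) 3(2)
    by (subst call_prog)
      (cases "a = x"; cases "b = x"; simp add: body_swap_def run_simps enc_bool_def transpose_def)
qed

lemma call_fill:
  "\<exists>T \<le> 20 * (length U + k + 1). call Prog 8 [enc_list U, un k, enc_list B]
    = Some (enc_list (U @ take (k - length U) B), T)"
proof (induction U arbitrary: k)
  case Nil
  show ?case
  proof (induction k arbitrary: B)
    case 0
    show ?case by (subst call_prog) (simp add: body_fill_def run_simps)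
  next
    case (Suc k)
    show ?case
    proof (cases B)
      case Nil
      thus ?thesis by (subst call_prog) (simp add: body_fill_def run_simps)
    next
      case (Cons x C)
      from Suc.IH[of C] show ?thesis
        by (subst call_prog) (auto simp: body_fill_def run_simps Cons)
    qed
  qed
next
  case (Cons x U)
  \<comment> \<open>The right subtree of a leaf is a leaf, which matches the truncated difference
    \<open>k - length U\<close>.\<close>
  have [simp]: "bright (un k) = un (k - 1)" by (cases k) auto
  from Cons.IH[of "k - 1"] show ?case
    by (subst call_prog) (auto simp: body_fill_def run_simps)
qed

text \<open>Sums and products may have leading zeros, so arithmetic is specified by value and number
  of digits instead of equality with \<open>enc_nat\<close>.\<close>

fun bval :: "btree \<Rightarrow> nat" where
  "bval BLeaf = 0" | "bval (BNode a b) = (if a = BLeaf then 0 else 1) + 2 * bval b"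

fun blen :: "btree \<Rightarrow> nat" where
  "blen BLeaf = 0" | "blen (BNode a b) = Suc (blen b)"

lemma bval_enc_nat [simp]: "bval (enc_nat n) = n"
proof (induction n rule: less_induct)
  case (less n)
  thus ?case by (cases "n = 0") (auto simp: enc_nat_0 enc_nat_pos enc_bool_def)
qed

lemma bval_bright: "bval x = (if bleft x = BLeaf then 0 else 1) + 2 * bval (bright x)"
  by (cases x) auto

lemma blen_bright: "blen (bright x) = blen x - 1"
  by (cases x) auto

lemma blen_le_size: "blen x \<le> size x"
  by (induction x) auto

lemma call_add:
  assumes "blen x \<le> l" "blen y \<le> l"
  shows "\<exists>v T. T \<le> 50 * l + 50 \<and> call Prog 12 [x, y, c] = Some (v, T) \<and>
    bval v = bval x + bval y + (if c = BLeaf then 0 else 1) \<and> blen v \<le> l + 1"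
  using assms
proof (induction l arbitrary: x y c)
  case 0
  hence "x = BLeaf" "y = BLeaf" by (cases x; cases y; simp)+
  thus ?case by (subst call_prog) (simp add: body_add_def run_simps Let_def)
next
  case (Suc l)
  show ?case
  proof (cases "x = BLeaf \<and> y = BLeaf")
    case True
    thus ?thesis by (subst call_prog) (simp add: body_add_def run_simps Let_def)
  next
    case False
    have le: "blen (bright x) \<le> l" "blen (bright y) \<le> l" using Suc.prems by (simp_all add: blen_bright)
    obtain v T where 1: "T \<le> 50 * l + 50" "call Prog 12 [bright x, bright y, BNode BLeaf BLeaf] = Some (v, T)"
        "bval v = bval (bright x) + bval (bright y) + 1" "blen v \<le> l + 1"
      using Suc.IH[OF le, of "BNode BLeaf BLeaf"] by auto
    obtain v' T' where 2: "T' \<le> 50 * l + 50" "call Prog 12 [bright x, bright y, BLeaf] = Some (v', T')"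
        "bval v' = bval (bright x) + bval (bright y)" "blen v' \<le> l + 1"
      using Suc.IH[OF le, of BLeaf] by auto
    define s where "s = (if (bleft x = BLeaf) = (bleft y = BLeaf) then c
      else if c = BLeaf then BNode BLeaf BLeaf else BLeaf)"
    define r where "r = (if (if bleft x = BLeaf then bleft y \<noteq> BLeaf \<and> c \<noteq> BLeaf
      else bleft y \<noteq> BLeaf \<or> c \<noteq> BLeaf) then v else v')"
    have "\<exists>T'' \<le> 50 * Suc l + 50. call Prog 12 [x, y, c] = Some (BNode s r, T'')"
      using False 1(1,2) 2(1,2) by (subst call_prog, unfold body_add_def Let_def s_def r_def)
        (cases "x = BLeaf"; cases "bleft x = BLeaf"; cases "bleft y = BLeaf"; cases "c = BLeaf"; simp add: run_simps)
    moreover have "bval (BNode s r) = bval x + bval y + (if c = BLeaf then 0 else 1)"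
      unfolding bval_bright[of x] bval_bright[of y] using 1(3) 2(3) by (simp add: s_def r_def)
    moreover have "blen (BNode s r) \<le> Suc l + 1" using 1(4) 2(4) by (simp add: r_def)
    ultimately show ?thesis by blast
  qed
qed

lemma call_mul:
  "\<exists>v T. T \<le> (blen x + 1) * (50 * (blen y + 2 * blen x) + 200) \<and> call Prog 13 [x, y] = Some (v, T) \<and>
    bval v = bval x * bval y \<and> blen v \<le> blen y + 2 * blen x"
proof (induction x)
  case BLeaf
  show ?case by (subst call_prog) (simp add: body_mul_def run_simps)
next
  case (BNode a x)
  let ?l = "blen y + 2 * blen x"
  obtain v T where 1: "T \<le> (blen x + 1) * (50 * ?l + 200)" "call Prog 13 [x, y] = Some (v, T)"
      "bval v = bval x * bval y" "blen v \<le> ?l"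
    using BNode.IH(2) by blast
  obtain w T' where 2: "T' \<le> 50 * (?l + 1) + 50" "call Prog 12 [y, BNode BLeaf v, BLeaf] = Some (w, T')"
      "bval w = bval y + 2 * bval v" "blen w \<le> ?l + 2"
    using call_add[of y "?l + 1" "BNode BLeaf v" BLeaf] 1(4) by auto
  have "T + T' + 50 \<le> (blen (BNode a x) + 1) * (50 * (blen y + 2 * blen (BNode a x)) + 200)"
    using 1(1) 2(1) by (simp add: algebra_simps)
  thus ?case using 1 2
    by (subst call_prog) (cases "a = BLeaf"; simp add: body_mul_def run_simps algebra_simps)
qed

lemma call_umul:
  "\<exists>v T. T \<le> (size u + 1) * (50 * (blen y + size u) + 200) \<and> call Prog 14 [u, y] = Some (v, T) \<and>
    bval v = blen u * bval y \<and> blen v \<le> blen y + size u"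
proof (induction u)
  case BLeaf
  show ?case by (subst call_prog) (simp add: body_umul_def run_simps)
next
  case (BNode a u)
  let ?l = "blen y + size u"
  obtain v T where 1: "T \<le> (size u + 1) * (50 * ?l + 200)" "call Prog 14 [u, y] = Some (v, T)"
      "bval v = blen u * bval y" "blen v \<le> ?l"
    using BNode.IH(2) by blast
  obtain w T' where 2: "T' \<le> 50 * ?l + 50" "call Prog 12 [y, v, BLeaf] = Some (w, T')"
      "bval w = bval y + bval v" "blen w \<le> ?l + 1"
    using call_add[of y "?l" v BLeaf] 1(4) by auto
  have "T + T' + 50 \<le> (size u + 1) * (50 * ?l + 200) + (50 * ?l + 200)"
    using 1(1) 2(1) by simp
  also have "\<dots> = (size u + 2) * (50 * ?l + 200)" by (simp add: algebra_simps)
  also have "\<dots> \<le> (size (BNode a u) + 1) * (50 * (blen y + size (BNode a u)) + 200)"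
    by (intro mult_mono) auto
  finally have T: "T + T' + 50 \<le> \<dots>" .
  have "bval w = blen (BNode a u) * bval y" using 1(3) 2(3) by simp
  thus ?case using 1(2,4) 2(2,4) T
    by (subst call_prog) (simp add: body_umul_def run_simps del: mult_Suc mult_Suc_right blen.simps(2))
qed

lemma call_le:
  assumes "blen x \<le> l" "blen y \<le> l"
  shows "\<exists>T \<le> 50 * l + 50. \<exists>v. call Prog 15 [x, y, c] = Some (v, T) \<and>
    (v \<noteq> BLeaf \<longleftrightarrow> bval x < bval y \<or> bval x = bval y \<and> c \<noteq> BLeaf)"
  using assms
proof (induction l arbitrary: x y c)
  case 0
  hence "x = BLeaf" "y = BLeaf" by (cases x; cases y; simp)+
  thus ?case by (subst call_prog) (simp add: body_le_def run_simps Let_def)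
next
  case (Suc l)
  show ?case
  proof (cases "x = BLeaf \<and> y = BLeaf")
    case True
    thus ?thesis by (subst call_prog) (simp add: body_le_def run_simps Let_def)
  next
    case False
    define c' where "c' = (if bleft x = BLeaf then if bleft y = BLeaf then c else BNode BLeaf BLeaf
       else if bleft y = BLeaf then BLeaf else c)"
    have le: "blen (bright x) \<le> l" "blen (bright y) \<le> l" using Suc.prems by (simp_all add: blen_bright)
    obtain v T where 1: "T \<le> 50 * l + 50" "call Prog 15 [bright x, bright y, c'] = Some (v, T)"
        "v \<noteq> BLeaf \<longleftrightarrow> bval (bright x) < bval (bright y) \<or>
          bval (bright x) = bval (bright y) \<and> c' \<noteq> BLeaf"
      using Suc.IH[OF le, of c'] by auto
    have "v \<noteq> BLeaf \<longleftrightarrow> bval x < bval y \<or> bval x = bval y \<and> c \<noteq> BLeaf"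
      unfolding 1(3) bval_bright[of x] bval_bright[of y] c'_def by (auto split: if_splits)
    moreover have "\<exists>T' \<le> 50 * Suc l + 50. call Prog 15 [x, y, c] = Some (v, T')"
      using False 1(1,2) by (subst call_prog, unfold body_le_def Let_def c'_def)
        (cases "bleft x = BLeaf"; cases "bleft y = BLeaf"; cases "x = BLeaf"; simp add: run_simps)
    ultimately show ?thesis by blast
  qed
qed

lemma call_double: "\<exists>T \<le> 20 * k + 20. call Prog 16 [un k] = Some (un (2 * k), T)"
proof (induction k)
  case 0
  show ?case by (subst call_prog) (simp add: body_double_def run_simps)
next
  case (Suc k)
  thus ?case by (subst call_prog) (auto simp: body_double_def run_simps)
qed

lemma call_unary: "\<exists>T \<le> 50 * k + 50. call Prog 17 [enc_nat k] = Some (un k, T)"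
proof (induction k rule: less_induct)
  case (less k)
  show ?case
  proof (cases "k = 0")
    case True
    thus ?thesis by (subst call_prog) (simp add: body_unary_def run_simps enc_nat_0)
  next
    case False
    then obtain T where 1: "T \<le> 50 * (k div 2) + 50"
        "call Prog 17 [enc_nat (k div 2)] = Some (un (k div 2), T)"
      using less.IH[of "k div 2"] by auto
    obtain T' where 2: "T' \<le> 20 * (k div 2) + 20"
        "call Prog 16 [un (k div 2)] = Some (un (2 * (k div 2)), T')"
      using call_double by blast
    show ?thesis
    proof (cases "even k")
      case True
      thus ?thesis using 1 2 \<open>k \<noteq> 0\<close>
        by (subst call_prog) (auto simp: body_unary_def run_simps enc_nat_pos enc_bool_def elim!: evenE)
    next
      case False
      then obtain j where "k = 2 * j + 1" by (elim oddE)
      thus ?thesis using 1 2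
        by (subst call_prog) (auto simp: body_unary_def run_simps enc_nat_pos enc_bool_def)
    qed
  qed
qed

lemma call_upt:
  "\<exists>T \<le> (k + 1) * (20 * (i + k) + 100). call Prog 18 [un k, enc_nat i] = Some (enc_nats [i..<i + k], T)"
proof (induction k arbitrary: i)
  case 0
  show ?case by (subst call_prog) (simp add: body_upt_def run_simps)
next
  case (Suc k)
  obtain T where 1: "T \<le> (k + 1) * (20 * (i + Suc k) + 100)"
      "call Prog 18 [un k, enc_nat (Suc i)] = Some (enc_nats [Suc i..<i + Suc k], T)"
    using Suc.IH[of "Suc i"] by auto
  obtain T' where 2: "T' \<le> 20 * i + 20" "call Prog 5 [enc_nat i] = Some (enc_nat (Suc i), T')"
    using call_inc by blast
  have T: "T + T' + 50 \<le> (Suc k + 1) * (20 * (i + Suc k) + 100)" using 1(1) 2(1) by simp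
  have "[i..<i + Suc k] = i # [Suc i..<i + Suc k]" by (simp add: upt_conv_Cons)
  thus ?case using 1(2) 2(2) order_trans[OF _ T]
    by (subst call_prog) (simp add: body_upt_def run_simps)
qed

definition enc_pairs :: "(nat \<times> nat) list \<Rightarrow> btree" where
  "enc_pairs Q = enc_list (map (\<lambda>(a, b). BNode (enc_nat a) (enc_nat b)) Q)"

lemma enc_pairs_simps [simp]:
  "enc_pairs [] = BLeaf" "enc_pairs ((a, b) # Q) = BNode (BNode (enc_nat a) (enc_nat b)) (enc_pairs Q)"
  by (auto simp: enc_pairs_def)

lemma call_row:
  "\<exists>T \<le> 50 * length L + 50. call Prog 19 [enc_nat a, enc_nats L, enc_pairs Q]
     = Some (enc_pairs (map (Pair a) L @ Q), T)"
proof (induction L)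
  case Nil
  show ?case by (subst call_prog) (simp add: body_row_def run_simps)
next
  case (Cons x L)
  thus ?case by (subst call_prog) (auto simp: body_row_def run_simps)
qed

lemma call_pairs:
  "\<exists>T \<le> (length L + 1) * (50 * length L' + 100). call Prog 20 [enc_nats L, enc_nats L']
     = Some (enc_pairs (List.product L L'), T)"
proof (induction L)
  case Nil
  show ?case by (subst call_prog) (simp add: body_pairs_def run_simps)
next
  case (Cons x L)
  then obtain T where 1: "T \<le> (length L + 1) * (50 * length L' + 100)"
      "call Prog 20 [enc_nats L, enc_nats L'] = Some (enc_pairs (List.product L L'), T)"
    by blast
  obtain T' where 2: "T' \<le> 50 * length L' + 50" "call Prog 19 [enc_nat x, enc_nats L', enc_pairs (List.product L L')]
     = Some (enc_pairs (map (Pair x) L' @ List.product L L'), T')"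
    using call_row by blast
  have T: "T + T' + 20 \<le> (length (x # L) + 1) * (50 * length L' + 100)" using 1(1) 2(1) by simp
  show ?case using 1(2) 2(2) order_trans[OF _ T]
    by (subst call_prog) (simp add: body_pairs_def run_simps)
qed

lemma call_le_one:
  assumes "blen x \<le> l" "blen y \<le> l"
  shows "\<exists>T \<le> 50 * l + 50. \<exists>v. call Prog 15 [x, y, BNode BLeaf BLeaf] = Some (v, T) \<and>
    (v \<noteq> BLeaf \<longleftrightarrow> bval x \<le> bval y)"
proof -
  have "bval x < bval y \<or> bval x = bval y \<and> BNode BLeaf BLeaf \<noteq> BLeaf \<longleftrightarrow> bval x \<le> bval y" by auto
  thus ?thesis using call_le[OF assms, of "BNode BLeaf BLeaf"] by simp
qed

section \<open>The algorithm as functions of lists and sets, with bounds on its running time\<close>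

fun agree :: "(nat set \<Rightarrow> nat) \<Rightarrow> (nat \<times> nat) list \<Rightarrow> nat \<Rightarrow> nat \<Rightarrow> nat \<Rightarrow> nat set \<Rightarrow> bool" where
  "agree g Q i j 0 M = (g M = g (transp i j ` M))"
| "agree g Q i j (Suc e) M = (\<forall>(a, b)\<in>set Q. agree g Q i j e (transp a b ` M))"

text \<open>Every end of the recursion emits one term: \<open>S\<close> is its monomial,
  \<open>sg\<close> and \<open>q\<close> are the sign and denominator collected from the factors
  \<open>(1 - x) / 2\<close> and the differences, and \<open>U\<close> is the set of negative
  variables at which \<open>g\<close> is evaluated.\<close>

fun terms :: "(nat list \<Rightarrow> nat) \<Rightarrow> nat \<Rightarrow> nat list \<Rightarrow> nat list \<Rightarrow> nat list \<Rightarrow> bool \<Rightarrow> nat \<Rightarrow> mlpoly \<Rightarrow> mlpoly"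
where
  "terms g e [] S U sg q acc = (S, ((if sg then -1 else 1) * int (g U), q)) # acc"
| "terms g 0 (v # W) S U sg q acc = terms g 0 W S U sg q acc"
| "terms g (Suc e) (v # W) S U sg q acc = terms g (Suc e) W S U sg q
     (terms g e W S (v # U) sg (2 * q)
       (terms g e W (v # S) (v # U) (\<not> sg) (2 * q)
         (terms g e W S U (\<not> sg) (2 * q)
           (terms g e W (v # S) U sg (2 * q) acc))))"

abbreviation (input) enc_constrs :: "constr list \<Rightarrow> btree" where
  "enc_constrs cs \<equiv> enc_list (map (enc_constr d) cs)"

definition time_count :: "nat \<Rightarrow> nat \<Rightarrow> nat" where
  "time_count n m =
     (m + 1) * ((d + 1) * ((n + 1) * (80 * n + 50) + 10 * 2 ^ d + 100) + 20 * m + 100)"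

definition time_leaf :: "nat \<Rightarrow> nat \<Rightarrow> nat" where
  "time_leaf n m = 2 * time_count n m + (n + 1) * (160 * n + 100) + 80 * m + 300"

text \<open>Each of the \<open>e\<close> levels tries up to \<open>n * n\<close> pairs; for
  \<open>e = d\<close> this is one of the two sources of a power of \<open>n\<close> with exponent
  growing with \<open>d\<close>, the other being \<open>time_terms\<close>.\<close>

definition time_test :: "nat \<Rightarrow> nat \<Rightarrow> nat \<Rightarrow> nat" where
  "time_test n m e = (2 * (n * n + 1)) ^ e * time_leaf n m"

definition time_terms :: "nat \<Rightarrow> nat \<Rightarrow> nat" where
  "time_terms n m = (n + 1) * (time_leaf n m * (5 * (n + 1)) ^ d)"

definition time_umul :: "nat \<Rightarrow> nat \<Rightarrow> nat" where
  "time_umul n s = (n * (2 * n + 1) + 1) * (50 * (s + n * (2 * n + 1)) + 200)"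

definition time_step :: "nat \<Rightarrow> nat \<Rightarrow> nat \<Rightarrow> nat" where
  "time_step n m s = (n + 1) * (time_test n m d + 50) + time_umul n s
     + (50 * (s + n * (2 * n + 1)) + 50) + time_terms n m + 200"

definition time_decide :: "nat \<Rightarrow> nat \<Rightarrow> nat \<Rightarrow> nat" where
  "time_decide n m s = time_umul n s + (K1 + 1) * (50 * (s + K1) + 200) + (K2 + 1) * (50 * (s + K2) + 200)
     + (50 * (s + n * (2 * n + 1)) + 50) + time_terms n m + 20 * (n + 1)
     + (n + 1) * (50 * n + 100) + (n + 1) * time_step n m s + 10 * (K1 + K2 + d) + 200"

definition kernel_of :: "constr list \<Rightarrow> nat \<Rightarrow> nat list \<Rightarrow> nat list \<Rightarrow> outcome" where
  "kernel_of cs k V B =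
     Kernel V (terms (\<lambda>U. count_sat cs (set (U @ take (k - length U) B))) d V [] [] False 1 [])"

fun search :: "constr list \<Rightarrow> (nat \<Rightarrow> nat \<Rightarrow> bool) \<Rightarrow> nat \<Rightarrow> nat \<Rightarrow> nat \<Rightarrow> nat list \<Rightarrow> nat list \<Rightarrow> outcome" where
  "search cs P k b c L [] = Certified"
| "search cs P k b c L (i # I) = (if length (filter (\<lambda>j. \<not> P i j) L) * b \<le> c
     then kernel_of cs k (filter (\<lambda>j. \<not> P i j) L) (filter (P i) L) else search cs P k b c L I)"

definition decide :: "nat \<Rightarrow> constr list \<Rightarrow> nat \<Rightarrow> nat \<Rightarrow> nat \<Rightarrow> outcome" where
  "decide n cs k a b = (let L = [0..<n] in if n * b \<le> K1 * a then kernel_of cs k L []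
     else search cs (\<lambda>i j. agree (count_sat cs) (List.product L L) i j d {..<k}) k b (K2 * a) L L)"

context
  fixes n :: nat and cs :: "constr list"
  assumes cs: "\<And>xs P. (xs, P) \<in> set cs \<Longrightarrow> length xs = d \<and> set xs \<subseteq> {..<n}"
begin

lemma call_count':
  assumes "length M \<le> n"
  shows "\<exists>T \<le> time_count n (length cs).
    call Prog 6 [enc_nats M, enc_constrs cs] = Some (enc_nat (count_sat cs (set M)), T)"
  using call_count[OF cs assms order_refl order_refl] unfolding time_count_def by simp

lemma call_test_0:
  assumes "length M \<le> n" "i < n" "j < n"
  shows "\<exists>T \<le> time_leaf n (length cs).
    call Prog 9 [BLeaf, enc_nats M, enc_nat i, enc_nat j, q, q', enc_constrs cs]
      = Some (enc_bool (agree (count_sat cs) Q i j 0 (set M)), T)"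
proof -
  let ?M = "map (transp i j) M"
  obtain T1 where 1: "T1 \<le> time_count n (length cs)"
    "call Prog 6 [enc_nats M, enc_constrs cs] = Some (enc_nat (count_sat cs (set M)), T1)"
    using call_count'[of M] assms by auto
  obtain T2 where 2: "T2 \<le> time_count n (length cs)"
    "call Prog 6 [enc_nats ?M, enc_constrs cs] = Some (enc_nat (count_sat cs (set ?M)), T2)"
    using call_count'[of ?M] assms by auto
  obtain T3 where 3: "T3 \<le> (length M + 1) * (160 * n + 100)"
    "call Prog 7 [enc_nat i, enc_nat j, enc_nats M] = Some (enc_nats ?M, T3)"
    using call_swap[of i n j M] assms by auto
  have "(length M + 1) * (160 * n + 100) \<le> (n + 1) * (160 * n + 100)"
    using assms by (intro mult_right_mono) auto
  with 3(1) have T3: "T3 \<le> (n + 1) * (160 * n + 100)" by linarith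
  have "count_sat cs (set M) \<le> length cs" by (simp add: count_sat_def)
  then obtain T4 where 4: "T4 \<le> 80 * length cs + 20"
    "call Prog 1 [enc_nat (count_sat cs (set M)), enc_nat (count_sat cs (set ?M))]
       = Some (enc_bool (count_sat cs (set M) = count_sat cs (set ?M)), T4)"
    using call_eq_nat by blast
  have "T1 + T2 + T3 + T4 + 50 \<le> time_leaf n (length cs)"
    using 1(1) 2(1) T3 4(1) by (simp add: time_leaf_def)
  thus ?thesis using 1(2) 2(2) 3(2) 4(2)
    by (subst call_prog) (simp add: body_test_def run_simps)
qed

lemma call_test:
  assumes "length M \<le> n" "i < n" "j < n" "set Q \<subseteq> {..<n} \<times> {..<n}" "length Q \<le> n * n"
  shows "\<exists>T \<le> time_test n (length cs) e.
    call Prog 9 [un e, enc_nats M, enc_nat i, enc_nat j, enc_pairs Q, enc_pairs Q,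
      enc_constrs cs]
      = Some (enc_bool (agree (count_sat cs) Q i j e (set M)), T)"
  using assms(1)
proof (induction e arbitrary: M)
  case 0
  thus ?case using call_test_0[of M i j _ _ Q] assms by (simp add: time_test_def)
next
  case (Suc e)
  let ?B = "time_test n (length cs) e"
  let ?v = "\<lambda>Q'. enc_bool (\<forall>(a, b)\<in>set Q'. agree (count_sat cs) Q i j e (transp a b ` set M))"
  have B: "(n + 1) * (160 * n + 100) + 100 \<le> ?B"
  proof -
    have "(n + 1) * (160 * n + 100) + 100 \<le> 1 * time_leaf n (length cs)"
      by (simp add: time_leaf_def)
    also have "\<dots> \<le> ?B" unfolding time_test_def by (intro mult_right_mono) auto
    finally show ?thesis .
  qed
  \<comment> \<open>The inner induction runs over the pairs \<open>Q'\<close> still to be tried at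
    this level, while the full list \<open>Q\<close> is passed on to the next level.\<close>
  have *: "\<exists>T \<le> (length Q' + 1) * (2 * ?B).
    call Prog 9 [un (Suc e), enc_nats M, enc_nat i, enc_nat j, enc_pairs Q', enc_pairs Q,
      enc_constrs cs] = Some (?v Q', T)" if "set Q' \<subseteq> set Q" for Q'
    using that
  proof (induction Q')
    case Nil
    thus ?case using B by (subst call_prog) (simp add: body_test_def run_simps enc_bool_def)
  next
    case (Cons ab Q')
    obtain a b where ab: "ab = (a, b)" by (cases ab)
    have le: "a \<le> n" "b \<le> n" using Cons.prems assms(4) ab by auto
    let ?M = "map (transp a b) M"
    obtain T1 where 1: "T1 \<le> (length M + 1) * (160 * n + 100)"
      "call Prog 7 [enc_nat a, enc_nat b, enc_nats M] = Some (enc_nats ?M, T1)"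
      using call_swap[OF le] by blast
    have "(length M + 1) * (160 * n + 100) \<le> (n + 1) * (160 * n + 100)"
      using Suc.prems by (intro mult_right_mono) auto
    with 1(1) have T1: "T1 \<le> (n + 1) * (160 * n + 100)" by linarith
    obtain T2 where 2: "T2 \<le> ?B"
      "call Prog 9 [un e, enc_nats ?M, enc_nat i, enc_nat j, enc_pairs Q, enc_pairs Q,
        enc_constrs cs] = Some (enc_bool (agree (count_sat cs) Q i j e (set ?M)), T2)"
      using Suc.IH[of ?M] Suc.prems by auto
    obtain T3 where 3: "T3 \<le> (length Q' + 1) * (2 * ?B)"
      "call Prog 9 [un (Suc e), enc_nats M, enc_nat i, enc_nat j, enc_pairs Q', enc_pairs Q,
      enc_constrs cs] = Some (?v Q', T3)"
      using Cons.IH Cons.prems by auto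
    have "T1 + T2 + T3 + 80 \<le> (length (ab # Q') + 1) * (2 * ?B)"
      using T1 2(1) 3(1) B by simp
    thus ?case using 1(2) 2(2) 3(2)
      by (subst call_prog)
        (cases "agree (count_sat cs) Q i j e (set ?M)"; simp add: body_test_def run_simps ab enc_bool_def)
  qed
  obtain T where T: "T \<le> (length Q + 1) * (2 * ?B)"
    "call Prog 9 [un (Suc e), enc_nats M, enc_nat i, enc_nat j, enc_pairs Q, enc_pairs Q,
      enc_constrs cs] = Some (?v Q, T)"
    using *[of Q] by blast
  have "(length Q + 1) * (2 * ?B) \<le> (n * n + 1) * (2 * ?B)"
    using assms(5) by (intro mult_right_mono) auto
  also have "\<dots> = time_test n (length cs) (Suc e)"
    by (simp add: time_test_def algebra_simps)
  finally show ?case using T by (intro exI[of _ T]) simp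
qed

lemma call_split:
  fixes e :: nat
  assumes "length M \<le> n" "i < n" "set L \<subseteq> {..<n}" "set Q \<subseteq> {..<n} \<times> {..<n}" "length Q \<le> n * n"
  defines "P \<equiv> \<lambda>j. agree (count_sat cs) Q i j e (set M)"
  shows "\<exists>T \<le> (length L + 1) * (time_test n (length cs) e + 50).
    call Prog 10 [un e, enc_nat i, enc_nats L, enc_nats M, enc_pairs Q, enc_constrs cs]
      = Some (BNode (enc_nats (filter (\<lambda>j. \<not> P j) L)) (enc_nats (filter P L)), T)"
  using assms(3)
proof (induction L)
  case Nil
  show ?case by (subst call_prog) (simp add: body_split_def run_simps)
next
  case (Cons j L)
  then obtain T1 where 1: "T1 \<le> (length L + 1) * (time_test n (length cs) e + 50)"
    "call Prog 10 [un e, enc_nat i, enc_nats L, enc_nats M, enc_pairs Q, enc_constrs cs]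
      = Some (BNode (enc_nats (filter (\<lambda>j. \<not> P j) L)) (enc_nats (filter P L)), T1)" by auto
  obtain T2 where 2: "T2 \<le> time_test n (length cs) e"
    "call Prog 9 [un e, enc_nats M, enc_nat i, enc_nat j, enc_pairs Q, enc_pairs Q,
      enc_constrs cs] = Some (enc_bool (P j), T2)"
    using call_test[of M i j Q e] assms Cons.prems by auto
  show ?case using 1 2
    by (subst call_prog) (cases "P j"; simp add: body_split_def run_simps enc_bool_def)
qed

lemma enc_mlpoly_Cons [simp]:
  "enc_mlpoly ((S, q) # g) = BNode (BNode (enc_nats S) (enc_frac q)) (enc_mlpoly g)"
  "enc_mlpoly [] = BLeaf"
  by (auto simp: enc_mlpoly_def)

lemma call_terms:
  fixes B :: "nat list" and k :: nat
  defines "g \<equiv> \<lambda>U. count_sat cs (set (U @ take (k - length U) B))"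
  assumes "length U + length W \<le> n" "k \<le> n" "q > 0"
  shows "\<exists>T \<le> (length W + 1) * (time_leaf n (length cs) * (5 * (n + 1)) ^ e).
    call Prog 11 [un e, enc_nats W, enc_nats S, enc_nats U, enc_bool sg, enc_nat q, enc_nats B, un k,
      enc_constrs cs, enc_mlpoly acc]
      = Some (enc_mlpoly (terms g e W S U sg q acc), T)"
  using assms(2,4)
proof (induction W arbitrary: e S U sg q acc)
  case Nil
  let ?M = "U @ take (k - length U) B"
  obtain T1 where 1: "T1 \<le> 20 * (length U + k + 1)"
    "call Prog 8 [enc_nats U, un k, enc_nats B] = Some (enc_nats ?M, T1)"
    using call_fill[of "map enc_nat U" k "map enc_nat B"] by (auto simp: enc_nats_def take_map)
  have "length ?M \<le> n" using Nil.prems assms(3) by simp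
  then obtain T2 where 2: "T2 \<le> time_count n (length cs)"
    "call Prog 6 [enc_nats ?M, enc_constrs cs] = Some (enc_nat (g U), T2)"
    using call_count' unfolding g_def by blast
  have "20 * (length U + k + 1) \<le> (n + 1) * (160 * n + 100)"
    using Nil.prems assms(3) by (simp add: algebra_simps)
  hence "T1 + T2 + 50 \<le> time_leaf n (length cs) * 1"
    using 1(1) 2(1) by (simp add: time_leaf_def)
  also have "\<dots> \<le> (length ([] :: nat list) + 1) * (time_leaf n (length cs) * (5 * (n + 1)) ^ e)"
    unfolding list.size add_0 mult_1 by (rule mult_left_mono) auto
  finally have T: "T1 + T2 + 50 \<le> \<dots>" .
  have z: "enc_nat (g U) = BLeaf \<longleftrightarrow> g U = 0"
    by (cases "g U = 0") (auto simp: enc_nat_0 enc_nat_pos)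
  show ?case using 1(2) 2(2) T z
    by (subst call_prog) (cases "g U = 0";
      auto simp: body_terms_def run_simps Let_def enc_frac_def enc_int_def enc_bool_def enc_nat_0)
next
  case (Cons v W)
  let ?c = "\<lambda>e S U sg q acc. call Prog 11 [un e, enc_nats W, enc_nats S, enc_nats U, enc_bool sg,
    enc_nat q, enc_nats B, un k, enc_constrs cs, enc_mlpoly acc]"
  let ?X = "time_leaf n (length cs)" and ?Z = "5 * (n + 1)"
  have IH: "\<exists>T \<le> (length W + 1) * (?X * ?Z ^ e).
    ?c e S U' sg q acc
      = Some (enc_mlpoly (terms g e W S U' sg q acc), T)"
    if "length U' \<le> Suc (length U)" "q > 0" for e S U' sg q acc
    using Cons.IH[of U' q e] Cons.prems that by simp
  have len: "length W < n" using Cons.prems by simp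
  show ?case
  proof (cases e)
    case 0
    obtain T where T: "T \<le> (length W + 1) * ?X"
      "?c 0 S U sg q acc
        = Some (enc_mlpoly (terms g 0 W S U sg q acc), T)"
      using IH[of U q 0 S sg acc] Cons.prems by auto
    have "T + 300 \<le> (length (v # W) + 1) * (?X * ?Z ^ e)"
      using T(1) by (simp add: 0 time_leaf_def)
    thus ?thesis using T(2)
      by (subst call_prog) (simp add: body_terms_def run_simps Let_def 0 call_terms_def)
  next
    case (Suc e')
    define acc1 where "acc1 = terms g e' W (v # S) U sg (2 * q) acc"
    define acc2 where "acc2 = terms g e' W S U (\<not> sg) (2 * q) acc1"
    define acc3 where "acc3 = terms g e' W (v # S) (v # U) (\<not> sg) (2 * q) acc2"
    define acc4 where "acc4 = terms g e' W S (v # U) sg (2 * q) acc3"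
    define Y where "Y = (length W + 1) * (?X * ?Z ^ e')"
    obtain T1 where 1: "T1 \<le> Y"
      "?c e' (v # S) U sg (2 * q) acc
        = Some (enc_mlpoly acc1, T1)"
      using IH[of U "2 * q" e' "v # S" sg acc] Cons.prems unfolding acc1_def Y_def by auto
    obtain T2 where 2: "T2 \<le> Y"
      "?c e' S U (\<not> sg) (2 * q) acc1
        = Some (enc_mlpoly acc2, T2)"
      using IH[of U "2 * q" e' S "\<not> sg" acc1] Cons.prems unfolding acc2_def Y_def by auto
    obtain T3 where 3: "T3 \<le> Y"
      "?c e' (v # S) (v # U) (\<not> sg) (2 * q) acc2
        = Some (enc_mlpoly acc3, T3)"
      using IH[of "v # U" "2 * q" e' "v # S" "\<not> sg" acc2] Cons.prems unfolding acc3_def Y_def by auto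
    obtain T4 where 4: "T4 \<le> Y"
      "?c e' S (v # U) sg (2 * q) acc3
        = Some (enc_mlpoly acc4, T4)"
      using IH[of "v # U" "2 * q" e' S sg acc3] Cons.prems unfolding acc4_def Y_def by auto
    obtain T5 where 5: "T5 \<le> (length W + 1) * (?X * ?Z ^ e)"
      "?c e S U sg q acc4
        = Some (enc_mlpoly (terms g e W S U sg q acc4), T5)"
      using IH[of U q e S sg acc4] Cons.prems by auto
    \<comment> \<open>Four calls of lower degree and the local steps amount to
      \<open>4 * (length W + 1) + 1\<close> shares, at most \<open>?Z\<close>. Each unit of degree
      thus costs a factor \<open>?Z\<close>, whereas skipping a variable costs one more
      summand.\<close>
    have "4 * Y + 300 \<le> 4 * Y + ?X * ?Z ^ e'"
    proof -
      have "300 * 1 \<le> ?X * ?Z ^ e'" by (intro mult_mono) (auto simp: time_leaf_def)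
      thus ?thesis by simp
    qed
    also have "\<dots> = (4 * (length W + 1) + 1) * (?X * ?Z ^ e')" by (simp add: Y_def algebra_simps)
    also have "\<dots> \<le> ?Z * (?X * ?Z ^ e')" using len by (intro mult_right_mono) auto
    also have "\<dots> = ?X * ?Z ^ e" by (simp only: Suc power_Suc mult_ac)
    finally have "4 * Y + 300 \<le> ?X * ?Z ^ e" .
    hence T: "T1 + T2 + T3 + T4 + T5 + 300 \<le> (length (v # W) + 1) * (?X * ?Z ^ e)"
      using 1(1) 2(1) 3(1) 4(1) 5(1) by simp
    \<comment> \<open>The program doubles \<open>q\<close> by prepending a zero digit, which is the
      canonical encoding only because \<open>q > 0\<close>.\<close>
    have q: "enc_nat (2 * q) = BNode BLeaf (enc_nat q)"
      using Cons.prems by (simp add: enc_nat_pos enc_bool_def)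
    have t: "terms g e (v # W) S U sg q acc = terms g e W S U sg q acc4"
      by (simp add: acc1_def acc2_def acc3_def acc4_def Suc)
    have neg: "(if enc_bool sg = BLeaf then BNode BLeaf BLeaf else BLeaf) = enc_bool (\<not> sg)"
      by (simp add: enc_bool_def)
    show ?thesis unfolding t
      using 1(2) 2(2) 3(2) 4(2) 5(2) T
      by (subst call_prog, cases sg)
        (simp_all add: body_terms_def run_simps Let_def Suc call_terms_def q enc_bool_def
          del: mult_Suc mult_Suc_right power_Suc)
  qed
qed

lemma call_kernel:
  assumes "length V \<le> n" "k \<le> n"
  shows "\<exists>T \<le> time_terms n (length cs).
    call Prog 11 [un d, enc_nats V, BLeaf, BLeaf, BLeaf, BNode (BNode BLeaf BLeaf) BLeaf, enc_nats B, un k,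
      enc_constrs cs, BLeaf]
      = Some (enc_mlpoly (terms (\<lambda>U. count_sat cs (set (U @ take (k - length U) B))) d V [] [] False 1 []), T)"
proof -
  have "enc_nat 1 = BNode (BNode BLeaf BLeaf) BLeaf"
    by (simp add: enc_nat_pos enc_bool_def enc_nat_0)
  then obtain T where T: "T \<le> (length V + 1) * (time_leaf n (length cs) * (5 * (n + 1)) ^ d)"
    "call Prog 11 [un d, enc_nats V, BLeaf, BLeaf, BLeaf, BNode (BNode BLeaf BLeaf) BLeaf, enc_nats B, un k,
      enc_constrs cs, BLeaf]
      = Some (enc_mlpoly (terms (\<lambda>U. count_sat cs (set (U @ take (k - length U) B))) d V [] [] False 1 []), T)"
    using call_terms[of "[]" V k 1 d "[]" False B "[]"] assms by (auto simp: enc_bool_def)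
  have "(length V + 1) * (time_leaf n (length cs) * (5 * (n + 1)) ^ d) \<le> time_terms n (length cs)"
    unfolding time_terms_def using assms(1) by (intro mult_right_mono) auto
  with T show ?thesis by (intro exI[of _ T]) simp
qed

lemma size_enc_nats:
  assumes "set V \<subseteq> {..<n}" "length V \<le> n"
  shows "size (enc_nats V) \<le> n * (2 * n + 1)"
proof -
  have "size (enc_nats V) \<le> length V * (2 * n + 1)" using assms(1)
  proof (induction V)
    case (Cons x V)
    thus ?case using size_enc_nat[of x] by auto
  qed simp
  also have "\<dots> \<le> n * (2 * n + 1)" using assms(2) by (intro mult_right_mono) auto
  finally show ?thesis .
qed

lemma blen_enc_nats [simp]: "blen (enc_nats V) = length V"
  by (induction V) auto

lemma call_umul_nats:
  assumes "set V \<subseteq> {..<n}" "length V \<le> n" "blen b \<le> s"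
  shows "\<exists>v T. T \<le> time_umul n s \<and> call Prog 14 [enc_nats V, b] = Some (v, T) \<and>
    bval v = length V * bval b \<and> blen v \<le> s + n * (2 * n + 1)"
proof -
  obtain v T where T: "T \<le> (size (enc_nats V) + 1) * (50 * (blen b + size (enc_nats V)) + 200)"
    "call Prog 14 [enc_nats V, b] = Some (v, T)" "bval v = length V * bval b"
    "blen v \<le> blen b + size (enc_nats V)"
    using call_umul[of "enc_nats V" b] by auto
  have "T \<le> time_umul n s" unfolding time_umul_def
    using size_enc_nats[OF assms(1,2)] assms(3)
    by (intro order_trans[OF T(1)] mult_mono add_mono) auto
  thus ?thesis using T size_enc_nats[OF assms(1,2)] assms(3) by fastforce
qed

lemma call_search:
  assumes "length M \<le> n" "set L \<subseteq> {..<n}" "length L \<le> n" "k \<le> n"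
    and "set Q \<subseteq> {..<n} \<times> {..<n}" "length Q \<le> n * n" "blen b \<le> s" "blen c \<le> s" "set I \<subseteq> {..<n}"
  defines "P \<equiv> \<lambda>i j. agree (count_sat cs) Q i j d (set M)"
  shows "\<exists>T \<le> (length I + 1) * time_step n (length cs) s.
    call Prog 21 [enc_nats I, enc_nats L, un d, enc_nats M, enc_pairs Q,
      enc_constrs cs, un k, b, c]
      = Some (enc_outcome (search cs P k (bval b) (bval c) L I), T)"
  using assms(9)
proof (induction I)
  case Nil
  show ?case by (subst call_prog) (simp add: body_search_def run_simps time_step_def)
next
  case (Cons i I)
  let ?V = "filter (\<lambda>j. \<not> P i j) L" and ?B = "filter (P i) L"
  let ?g = "terms (\<lambda>U. count_sat cs (set (U @ take (k - length U) ?B))) d ?V [] [] False 1 []"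
  obtain T1 where 1: "T1 \<le> (length L + 1) * (time_test n (length cs) d + 50)"
    "call Prog 10 [un d, enc_nat i, enc_nats L, enc_nats M, enc_pairs Q, enc_constrs cs]
      = Some (BNode (enc_nats ?V) (enc_nats ?B), T1)"
    using call_split[of M i L Q d] assms Cons.prems unfolding P_def by auto
  have "(length L + 1) * (time_test n (length cs) d + 50) \<le> (n + 1) * (time_test n (length cs) d + 50)"
    using assms(3) by (intro mult_right_mono) auto
  with 1(1) have T1: "T1 \<le> (n + 1) * (time_test n (length cs) d + 50)" by linarith
  have V: "set ?V \<subseteq> {..<n}" "length ?V \<le> n"
    using assms(2) length_filter_le[of "\<lambda>j. \<not> P i j" L] assms(3) by (auto simp del: length_filter_le)
  obtain v T2 where 2: "T2 \<le> time_umul n s" "call Prog 14 [enc_nats ?V, b] = Some (v, T2)"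
    "bval v = length ?V * bval b" "blen v \<le> s + n * (2 * n + 1)"
    using call_umul_nats[OF V assms(7)] by blast
  obtain w T3 where 3: "T3 \<le> 50 * (s + n * (2 * n + 1)) + 50"
    "call Prog 15 [v, c, BNode BLeaf BLeaf] = Some (w, T3)" "w \<noteq> BLeaf \<longleftrightarrow> length ?V * bval b \<le> bval c"
    using call_le_one[of v "s + n * (2 * n + 1)" c] 2(3,4) assms(8) by auto
  obtain T4 where 4: "T4 \<le> time_terms n (length cs)"
    "call Prog 11 [un d, enc_nats ?V, BLeaf, BLeaf, BLeaf, BNode (BNode BLeaf BLeaf) BLeaf, enc_nats ?B, un k,
      enc_constrs cs, BLeaf] = Some (enc_mlpoly ?g, T4)"
    using call_kernel[OF V(2) assms(4)] by blast
  obtain T5 where 5: "T5 \<le> (length I + 1) * time_step n (length cs) s"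
    "call Prog 21 [enc_nats I, enc_nats L, un d, enc_nats M, enc_pairs Q,
      enc_constrs cs, un k, b, c]
      = Some (enc_outcome (search cs P k (bval b) (bval c) L I), T5)"
    using Cons by auto
  have T: "T1 + T2 + T3 + T4 + T5 + 100 \<le> (length (i # I) + 1) * time_step n (length cs) s"
    using T1 2(1) 3(1) 4(1) 5(1) by (simp add: time_step_def)
  show ?case
  proof (cases "length ?V * bval b \<le> bval c")
    case True
    hence "w \<noteq> BLeaf" using 3(3) by simp
    show ?thesis using 1(2) 2(2) 3(2) 4(2) T True \<open>w \<noteq> BLeaf\<close>
      by (subst call_prog) (simp add: body_search_def run_simps kernel_of_def del: mult_Suc mult_Suc_right)
  next
    case False
    hence "w = BLeaf" using 3(3) by simp
    show ?thesis using 1(2) 2(2) 3(2) 5(2) T False \<open>w = BLeaf\<close>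
      by (subst call_prog) (simp add: body_search_def run_simps del: mult_Suc mult_Suc_right)
  qed
qed

lemma un_size_blen [simp]: "blen (un k) = k"
  by (induction k) auto

lemma call_decide:
  assumes "k \<le> n" "blen a + K1 + K2 \<le> s" "blen b \<le> s"
  shows "\<exists>T \<le> time_decide n (length cs) s.
    call Prog 22 [enc_nats [0..<n], un k, enc_constrs cs, b, a]
      = Some (enc_outcome (decide n cs k (bval a) (bval b)), T)"
proof -
  let ?L = "[0..<n]" and ?M = "[0..<k]"
  let ?g = "terms (\<lambda>U. count_sat cs (set (U @ take (k - length U) []))) d ?L [] [] False 1 []"
  let ?P = "\<lambda>i j. agree (count_sat cs) (List.product ?L ?L) i j d {..<k}"
  have L: "set ?L \<subseteq> {..<n}" "length ?L \<le> n" by auto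
  obtain v1 T1 where 1: "T1 \<le> time_umul n s" "call Prog 14 [enc_nats ?L, b] = Some (v1, T1)"
    "bval v1 = n * bval b" "blen v1 \<le> s + n * (2 * n + 1)"
    using call_umul_nats[OF L assms(3)] by auto
  obtain v2 T2 where 2: "T2 \<le> (K1 + 1) * (50 * (blen a + K1) + 200)"
    "call Prog 14 [un K1, a] = Some (v2, T2)" "bval v2 = K1 * bval a" "blen v2 \<le> blen a + K1"
    using call_umul[of "un K1" a] by auto
  have T2: "T2 \<le> (K1 + 1) * (50 * (s + K1) + 200)"
    using assms(2) by (intro order_trans[OF 2(1)] mult_left_mono) auto
  obtain v3 T3 where 3: "T3 \<le> (K2 + 1) * (50 * (blen a + K2) + 200)"
    "call Prog 14 [un K2, a] = Some (v3, T3)" "bval v3 = K2 * bval a" "blen v3 \<le> blen a + K2"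
    using call_umul[of "un K2" a] by auto
  have T3: "T3 \<le> (K2 + 1) * (50 * (s + K2) + 200)"
    using assms(2) by (intro order_trans[OF 3(1)] mult_left_mono) auto
  obtain w T4 where 4: "T4 \<le> 50 * (s + n * (2 * n + 1)) + 50"
    "call Prog 15 [v1, v2, BNode BLeaf BLeaf] = Some (w, T4)" "w \<noteq> BLeaf \<longleftrightarrow> n * bval b \<le> K1 * bval a"
    using call_le_one[of v1 "s + n * (2 * n + 1)" v2] 1(3,4) 2(3,4) assms(2) by auto
  obtain T5 where 5: "T5 \<le> time_terms n (length cs)"
    "call Prog 11 [un d, enc_nats ?L, BLeaf, BLeaf, BLeaf, BNode (BNode BLeaf BLeaf) BLeaf, BLeaf, un k,
      enc_constrs cs, BLeaf] = Some (enc_mlpoly ?g, T5)"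
    using call_kernel[of ?L k "[]"] assms(1) by auto
  have "take k ?L = ?M" using assms(1) by (simp add: take_upt)
  hence "take k (map enc_nat ?L) = map enc_nat ?M" by (simp add: take_map)
  then obtain T6 where 6: "T6 \<le> 20 * (k + 1)"
    "call Prog 8 [BLeaf, un k, enc_nats ?L] = Some (enc_nats ?M, T6)"
    using call_fill[of "[]" k "map enc_nat ?L"] by (auto simp: enc_nats_def)
  obtain T7 where 7: "T7 \<le> (n + 1) * (50 * n + 100)"
    "call Prog 20 [enc_nats ?L, enc_nats ?L] = Some (enc_pairs (List.product ?L ?L), T7)"
    using call_pairs[of ?L ?L] by auto
  obtain T8 where 8: "T8 \<le> (n + 1) * time_step n (length cs) s"
    "call Prog 21 [enc_nats ?L, enc_nats ?L, un d, enc_nats ?M, enc_pairs (List.product ?L ?L),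
      enc_constrs cs, un k, b, v3]
      = Some (enc_outcome (search cs ?P k (bval b) (K2 * bval a) ?L ?L), T8)"
    using call_search[of ?M ?L k "List.product ?L ?L" b s v3 ?L] assms 3(3,4)
    by (auto simp: lessThan_atLeast0)
  have T: "T1 + T2 + T3 + T4 + T5 + T6 + T7 + T8 + 10 * (K1 + K2 + d) + 200
      \<le> time_decide n (length cs) s"
    using 1(1) T2 T3 4(1) 5(1) 6(1) 7(1) 8(1) assms(1) by (simp add: time_decide_def)
  show ?thesis
  proof (cases "n * bval b \<le> K1 * bval a")
    case True
    hence "w \<noteq> BLeaf" using 4(3) by simp
    show ?thesis using 1(2) 2(2) 4(2) 5(2) T True \<open>w \<noteq> BLeaf\<close>
      by (subst call_prog)
        (simp add: body_decide_def run_simps run_exp_const_exp decide_def kernel_of_def Let_def del: mult_Suc mult_Suc_right)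
  next
    case False
    hence "w = BLeaf" using 4(3) by simp
    show ?thesis using 1(2) 2(2) 3(2) 4(2) 6(2) 7(2) 8(2) T False \<open>w = BLeaf\<close>
      by (subst call_prog)
        (simp add: body_decide_def run_simps run_exp_const_exp decide_def Let_def del: mult_Suc mult_Suc_right)
  qed
qed

end

definition time_main :: "nat \<Rightarrow> nat \<Rightarrow> nat \<Rightarrow> nat" where
  "time_main n m st = 150 * n + 200 + (n + 1) * (20 * n + 100) + 2 * ((st + 1) * (150 * st + 200))
     + time_decide n m (3 * st + K1 + K2)"

lemma runs_main:
  fixes I :: csp and t :: rat
  assumes "csp_wf d I" "k \<le> nvars I" and ab: "quotient_of t = (a, b)"
  shows "\<exists>T \<le> time_main (nvars I) (length (constrs I)) (size (enc_rat t)).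
    runs_in Prog (enc_input d I t k)
      (enc_outcome (decide (nvars I) (constrs I) k ((nat \<bar>a\<bar>)\<^sup>2) ((nat b)\<^sup>2))) T"
proof -
  let ?n = "nvars I" and ?cs = "constrs I" and ?st = "size (enc_rat t)"
  define u where "u = enc_nat (nat \<bar>a\<bar>)"
  define w where "w = enc_nat (nat b)"
  have cs: "length xs = d \<and> set xs \<subseteq> {..<?n}" if "(xs, P) \<in> set ?cs" for xs P
    using assms(1) that by (auto simp: csp_wf_def)
  have rat: "enc_rat t = BNode (BNode (enc_bool (a < 0)) u) w"
    by (simp add: enc_rat_def ab enc_frac_def enc_int_def u_def w_def)
  have st: "blen u \<le> ?st" "blen w \<le> ?st"
    using blen_le_size[of u] blen_le_size[of w] by (auto simp: rat)
  obtain T1 where 1: "T1 \<le> 50 * ?n + 50" "call Prog 17 [enc_nat ?n] = Some (un ?n, T1)"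
    using call_unary by blast
  obtain T2 where 2: "T2 \<le> (?n + 1) * (20 * ?n + 100)" "call Prog 18 [un ?n, BLeaf] = Some (enc_nats [0..<?n], T2)"
    using call_upt[of ?n 0] by (auto simp: enc_nat_0)
  obtain T3 where 3: "T3 \<le> 50 * k + 50" "call Prog 17 [enc_nat k] = Some (un k, T3)"
    using call_unary by blast
  have mul: "\<exists>v T. T \<le> (?st + 1) * (150 * ?st + 200) \<and> call Prog 13 [x, x] = Some (v, T) \<and>
      bval v = (bval x)\<^sup>2 \<and> blen v \<le> 3 * ?st" if "blen x \<le> ?st" for x
  proof -
    obtain v T where T: "T \<le> (blen x + 1) * (50 * (blen x + 2 * blen x) + 200)"
      "call Prog 13 [x, x] = Some (v, T)" "bval v = bval x * bval x" "blen v \<le> blen x + 2 * blen x"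
      using call_mul[of x x] by auto
    have "T \<le> (?st + 1) * (150 * ?st + 200)"
      using that by (intro order_trans[OF T(1)] mult_mono) auto
    thus ?thesis using T that by (auto simp: power2_eq_square)
  qed
  obtain v4 T4 where 4: "T4 \<le> (?st + 1) * (150 * ?st + 200)" "call Prog 13 [w, w] = Some (v4, T4)"
    "bval v4 = (nat b)\<^sup>2" "blen v4 \<le> 3 * ?st"
    using mul[OF st(2)] by (auto simp: w_def)
  obtain v5 T5 where 5: "T5 \<le> (?st + 1) * (150 * ?st + 200)" "call Prog 13 [u, u] = Some (v5, T5)"
    "bval v5 = (nat \<bar>a\<bar>)\<^sup>2" "blen v5 \<le> 3 * ?st"
    using mul[OF st(1)] by (auto simp: u_def)
  obtain T6 where 6: "T6 \<le> time_decide ?n (length ?cs) (3 * ?st + K1 + K2)"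
    "call Prog 22 [enc_nats [0..<?n], un k, enc_constrs ?cs, v4, v5]
      = Some (enc_outcome (decide ?n ?cs k ((nat \<bar>a\<bar>)\<^sup>2) ((nat b)\<^sup>2)), T6)"
    using call_decide[of ?cs ?n k v5 "3 * ?st + K1 + K2" v4] cs assms(2) 4 5 by auto
  have "T1 + T2 + T3 + T4 + T5 + T6 + 100 \<le> time_main ?n (length ?cs) ?st"
    using 1(1) 2(1) 3(1) 4(1) 5(1) 6(1) assms(2) by (simp add: time_main_def)
  moreover have "\<exists>T \<le> T1 + T2 + T3 + T4 + T5 + T6 + 90. call Prog 0 [enc_input d I t k] =
      Some (enc_outcome (decide ?n ?cs k ((nat \<bar>a\<bar>)\<^sup>2) ((nat b)\<^sup>2)), T)"
    using 1(2) 2(2) 3(2) 4(2) 5(2) 6(2)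
    by (subst call_prog) (simp add: body_main_def run_simps Let_def enc_input_def enc_csp_def rat)
  ultimately have "\<exists>T \<le> time_main ?n (length ?cs) ?st. run_exp Prog [enc_input d I t k] (ECall 0 [EVar 0])
      = Some (enc_outcome (decide ?n ?cs k ((nat \<bar>a\<bar>)\<^sup>2) ((nat b)\<^sup>2)), T)"
    by (auto simp: run_simps)
  thus ?thesis by (simp add: runs_in_def run_exp_eq_Some)
qed

end

section \<open>Polynomial running time\<close>

text \<open>The exponent \<open>c\<close> is uniform in all parameters, while the factor \<open>A\<close> may depend on \<open>d\<close> and on the two
  thresholds.\<close>

definition poly_bounded :: "(nat \<Rightarrow> nat \<Rightarrow> nat \<Rightarrow> nat \<Rightarrow> nat \<Rightarrow> nat \<Rightarrow> nat) \<Rightarrow> bool" where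
  "poly_bounded f \<longleftrightarrow> (\<exists>c. \<forall>d K K'. \<exists>A. \<forall>n m s. n \<ge> 1 \<longrightarrow> s \<ge> 1 \<longrightarrow>
     f d K K' n m s \<le> A * n ^ (c * d + c) * ((m + 1) * s) ^ c)"

lemma poly_bounded_const: "poly_bounded (\<lambda>d K K' n m s. a d K K')"
  unfolding poly_bounded_def by (rule exI[of _ 0]) auto

lemma poly_bounded_n: "poly_bounded (\<lambda>d K K' n m s. n)"
  unfolding poly_bounded_def
proof (intro exI[of _ 1] allI exI[of _ 1] impI)
  fix d n m s :: nat
  assume "n \<ge> 1" "s \<ge> 1"
  hence "n * 1 \<le> n ^ (1 * d + 1) * ((m + 1) * s) ^ 1" by (intro mult_mono) auto
  thus "n \<le> 1 * n ^ (1 * d + 1) * ((m + 1) * s) ^ 1" by simp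
qed

lemma poly_bounded_m: "poly_bounded (\<lambda>d K K' n m s. m)"
  unfolding poly_bounded_def
proof (intro exI[of _ 1] allI exI[of _ 1] impI)
  fix d n m s :: nat
  assume "n \<ge> 1" "s \<ge> 1"
  hence "1 * (m * 1) \<le> n ^ (1 * d + 1) * ((m + 1) * s)" by (intro mult_mono) auto
  thus "m \<le> 1 * n ^ (1 * d + 1) * ((m + 1) * s) ^ 1" by simp
qed

lemma poly_bounded_s: "poly_bounded (\<lambda>d K K' n m s. s)"
  unfolding poly_bounded_def
proof (intro exI[of _ 1] allI exI[of _ 1] impI)
  fix d n m s :: nat
  assume "n \<ge> 1" "s \<ge> 1"
  hence "1 * (1 * s) \<le> n ^ (1 * d + 1) * ((m + 1) * s)" by (intro mult_mono) auto
  thus "s \<le> 1 * n ^ (1 * d + 1) * ((m + 1) * s) ^ 1" by simp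
qed

lemma poly_bounded_add:
  assumes "poly_bounded f" "poly_bounded g"
  shows "poly_bounded (\<lambda>d K K' n m s. f d K K' n m s + g d K K' n m s)"
proof -
  obtain c c' where
    c: "\<And>d K K'. \<exists>A. \<forall>n m s. n \<ge> 1 \<longrightarrow> s \<ge> 1 \<longrightarrow>
      f d K K' n m s \<le> A * n ^ (c * d + c) * ((m + 1) * s) ^ c" and
    c': "\<And>d K K'. \<exists>A. \<forall>n m s. n \<ge> 1 \<longrightarrow> s \<ge> 1 \<longrightarrow>
      g d K K' n m s \<le> A * n ^ (c' * d + c') * ((m + 1) * s) ^ c'"
    using assms unfolding poly_bounded_def by blast
  show ?thesis unfolding poly_bounded_def
  proof (rule exI[of _ "c + c'"], intro allI)
    fix d K K' :: nat
    obtain A B where A: "\<And>n m s. n \<ge> 1 \<Longrightarrow> s \<ge> 1 \<Longrightarrow>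
        f d K K' n m s \<le> A * n ^ (c * d + c) * ((m + 1) * s) ^ c"
      and B: "\<And>n m s. n \<ge> 1 \<Longrightarrow> s \<ge> 1 \<Longrightarrow>
        g d K K' n m s \<le> B * n ^ (c' * d + c') * ((m + 1) * s) ^ c'"
      using c[of d K K'] c'[of d K K'] by blast
    show "\<exists>A. \<forall>n m s. n \<ge> 1 \<longrightarrow> s \<ge> 1 \<longrightarrow> f d K K' n m s + g d K K' n m s
        \<le> A * n ^ ((c + c') * d + (c + c')) * ((m + 1) * s) ^ (c + c')"
    proof (intro exI[of _ "A + B"] allI impI)
      fix n m s :: nat assume 1: "n \<ge> 1" "s \<ge> 1"
      hence X: "(m + 1) * s \<ge> 1" by simp
      have "f d K K' n m s \<le> A * n ^ ((c + c') * d + (c + c')) * ((m + 1) * s) ^ (c + c')"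
        using 1 X by (intro order_trans[OF A[OF 1]] mult_mono power_increasing le_refl) (auto simp: algebra_simps)
      moreover have "g d K K' n m s \<le> B * n ^ ((c + c') * d + (c + c')) * ((m + 1) * s) ^ (c + c')"
        using 1 X by (intro order_trans[OF B[OF 1]] mult_mono power_increasing le_refl) (auto simp: algebra_simps)
      ultimately show "f d K K' n m s + g d K K' n m s
          \<le> (A + B) * n ^ ((c + c') * d + (c + c')) * ((m + 1) * s) ^ (c + c')"
        unfolding distrib_right by linarith
    qed
  qed
qed

lemma poly_bounded_mult:
  assumes "poly_bounded f" "poly_bounded g"
  shows "poly_bounded (\<lambda>d K K' n m s. f d K K' n m s * g d K K' n m s)"
proof -
  obtain c c' where
    c: "\<And>d K K'. \<exists>A. \<forall>n m s. n \<ge> 1 \<longrightarrow> s \<ge> 1 \<longrightarrow>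
      f d K K' n m s \<le> A * n ^ (c * d + c) * ((m + 1) * s) ^ c" and
    c': "\<And>d K K'. \<exists>A. \<forall>n m s. n \<ge> 1 \<longrightarrow> s \<ge> 1 \<longrightarrow>
      g d K K' n m s \<le> A * n ^ (c' * d + c') * ((m + 1) * s) ^ c'"
    using assms unfolding poly_bounded_def by blast
  show ?thesis unfolding poly_bounded_def
  proof (rule exI[of _ "c + c'"], intro allI)
    fix d K K' :: nat
    obtain A B where A: "\<And>n m s. n \<ge> 1 \<Longrightarrow> s \<ge> 1 \<Longrightarrow>
        f d K K' n m s \<le> A * n ^ (c * d + c) * ((m + 1) * s) ^ c"
      and B: "\<And>n m s. n \<ge> 1 \<Longrightarrow> s \<ge> 1 \<Longrightarrow>
        g d K K' n m s \<le> B * n ^ (c' * d + c') * ((m + 1) * s) ^ c'"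
      using c[of d K K'] c'[of d K K'] by blast
    show "\<exists>A. \<forall>n m s. n \<ge> 1 \<longrightarrow> s \<ge> 1 \<longrightarrow> f d K K' n m s * g d K K' n m s
        \<le> A * n ^ ((c + c') * d + (c + c')) * ((m + 1) * s) ^ (c + c')"
    proof (intro exI[of _ "A * B"] allI impI)
      fix n m s :: nat assume 1: "n \<ge> 1" "s \<ge> 1"
      have "f d K K' n m s * g d K K' n m s \<le> (A * n ^ (c * d + c) * ((m + 1) * s) ^ c) *
          (B * n ^ (c' * d + c') * ((m + 1) * s) ^ c')"
        by (intro mult_mono A B 1) auto
      also have "\<dots> = A * B * (n ^ (c * d + c) * n ^ (c' * d + c')) *
          (((m + 1) * s) ^ c * ((m + 1) * s) ^ c')" by (simp only: mult_ac)
      also have "\<dots> = A * B * n ^ ((c + c') * d + (c + c')) * ((m + 1) * s) ^ (c + c')"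
        unfolding power_add[symmetric] by (simp add: algebra_simps)
      finally show "f d K K' n m s * g d K K' n m s \<le> \<dots>" .
    qed
  qed
qed

text \<open>For the factors with exponent \<open>d\<close>: the powers of \<open>n\<close> fit into
  the exponent \<open>2 * d + 2\<close>, and \<open>a ^ d\<close> goes into the factor
  \<open>A\<close>.\<close>

lemma poly_bounded_power:
  assumes "\<And>n. n \<ge> 1 \<Longrightarrow> f n \<le> a * n\<^sup>2"
  shows "poly_bounded (\<lambda>d K K' n m s. f n ^ d)"
  unfolding poly_bounded_def
proof (rule exI[of _ 2], intro allI)
  fix d :: nat
  show "\<exists>A. \<forall>n m s. n \<ge> 1 \<longrightarrow> s \<ge> 1 \<longrightarrow> f n ^ d \<le> A * n ^ (2 * d + 2) * ((m + 1) * s) ^ 2"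
  proof (intro exI[of _ "a ^ d"] allI impI)
    fix n m s :: nat assume 1: "n \<ge> 1" "s \<ge> 1"
    have "f n ^ d \<le> (a * n\<^sup>2) ^ d" using assms[OF 1(1)] by (intro power_mono) auto
    also have "\<dots> = a ^ d * n ^ (2 * d) * 1" by (simp add: power_mult_distrib power_mult)
    also have "\<dots> \<le> a ^ d * n ^ (2 * d + 2) * ((m + 1) * s) ^ 2"
      using 1 by (intro mult_mono power_increasing le_refl) auto
    finally show "f n ^ d \<le> \<dots>" .
  qed
qed

lemma poly_bounded_time_main:
  "poly_bounded (\<lambda>d K1 K2 n m s. time_main d K1 K2 n m s)"
proof -
  have *: "poly_bounded (\<lambda>d K K' n m s. (2 * (n * n + 1)) ^ d)"
    by (rule poly_bounded_power[of _ 4]) (auto simp: power2_eq_square)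
  have **: "poly_bounded (\<lambda>d K K' n m s. (5 * (n + 1)) ^ d)"
  proof (rule poly_bounded_power[of _ 10])
    fix n :: nat assume "n \<ge> 1"
    hence "n * 1 \<le> n * n" by (intro mult_mono) auto
    hence "n \<le> n\<^sup>2" by (simp add: power2_eq_square)
    moreover have "5 * (n + 1) \<le> 10 * n" using \<open>n \<ge> 1\<close> by simp
    ultimately show "5 * (n + 1) \<le> 10 * n\<^sup>2" using \<open>n \<ge> 1\<close> by (simp add: algebra_simps)
  qed
  show ?thesis
    unfolding time_main_def time_decide_def time_step_def time_umul_def time_terms_def time_test_def
      time_leaf_def time_count_def
    by (intro poly_bounded_add poly_bounded_mult poly_bounded_n poly_bounded_m poly_bounded_s * **
        poly_bounded_const)
qed

section \<open>Kernels\<close>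

text \<open>The iterated difference of \<open>G\<close> at \<open>X\<close> in the directions of
  \<open>T\<close>; for empty \<open>X\<close> it is the coefficient of the monomial
  \<open>T\<close> in the indicator variables. The sum of the cardinalities has the parity of their
  difference.\<close>

definition moebius :: "('a set \<Rightarrow> real) \<Rightarrow> 'a set \<Rightarrow> 'a set \<Rightarrow> real" where
  "moebius G X T = (\<Sum>U\<in>Pow T. (-1) ^ (card T + card U) * G (X \<union> U))"

lemma moebius_empty [simp]: "moebius G X {} = G X"
  by (simp add: moebius_def)

lemma moebius_insert:
  assumes "finite T" "v \<notin> T"
  shows "moebius G X (insert v T) = moebius G (insert v X) T - moebius G X T"
proof -
  have "moebius G X (insert v T) = (\<Sum>U\<in>Pow T. (-1) ^ (card (insert v T) + card U) * G (X \<union> U) +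
      (-1) ^ (card (insert v T) + card (insert v U)) * G (X \<union> insert v U))"
    unfolding moebius_def using assms by (intro sum_Pow_insert)
  also have "\<dots> = (\<Sum>U\<in>Pow T. (-1) ^ (card T + card U) * G (insert v X \<union> U) -
      (-1) ^ (card T + card U) * G (X \<union> U))"
  proof (intro sum.cong refl)
    fix U assume U: "U \<in> Pow T"
    hence "finite U" "v \<notin> U" using assms finite_subset by auto
    thus "(-1) ^ (card (insert v T) + card U) * G (X \<union> U) +
        (-1) ^ (card (insert v T) + card (insert v U)) * G (X \<union> insert v U)
      = (-1) ^ (card T + card U) * G (insert v X \<union> U) - (-1) ^ (card T + card U) * G (X \<union> U)"
      using assms by simp
  qed
  finally show ?thesis by (simp add: moebius_def sum_subtractf)
qed

lemma moebius_inversion: "finite W \<Longrightarrow> (\<Sum>T\<in>Pow W. moebius G X T) = G (X \<union> W)"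
proof (induction W arbitrary: X rule: finite_induct)
  case (insert v W)
  have "(\<Sum>T\<in>Pow (insert v W). moebius G X T)
      = (\<Sum>T\<in>Pow W. moebius G X T + moebius G X (insert v T))"
    using insert.hyps by (intro sum_Pow_insert)
  also have "\<dots> = (\<Sum>T\<in>Pow W. moebius G (insert v X) T)"
  proof (intro sum.cong refl)
    fix T assume "T \<in> Pow W"
    hence "finite T" "v \<notin> T" using insert.hyps finite_subset by auto
    thus "moebius G X T + moebius G X (insert v T) = moebius G (insert v X) T"
      by (simp add: moebius_insert)
  qed
  also have "\<dots> = G (insert v X \<union> W)" by (rule insert.IH)
  finally show ?case by simp
qed simp

text \<open>The value of the polynomial built by \<open>terms\<close>. At points of the cube
  \<open>(1 - x v) / 2\<close> indicates that \<open>v\<close> is negative, and it multiplies a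
  difference along \<open>v\<close>; exhausted degree discards the remaining variables.\<close>

fun expand :: "(nat list \<Rightarrow> nat) \<Rightarrow> (nat \<Rightarrow> real) \<Rightarrow> nat \<Rightarrow> nat list \<Rightarrow> nat list \<Rightarrow> real" where
  "expand g x e [] U = g U"
| "expand g x 0 (v # W) U = expand g x 0 W U"
| "expand g x (Suc e) (v # W) U =
     expand g x (Suc e) W U + (1 - x v) / 2 * (expand g x e W (v # U) - expand g x e W U)"

lemma mlpoly_eval_Nil: "mlpoly_eval [] x = 0"
  by (simp add: mlpoly_eval_def)

lemma mlpoly_eval_Cons:
  "mlpoly_eval ((S, q) # g) x = frac_val q * (\<Prod>i\<in>set S. x i) + mlpoly_eval g x"
  by (simp add: mlpoly_eval_def)

lemma mlpoly_eval_terms: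
  assumes "distinct (S @ W)" "q > 0"
  shows "mlpoly_eval (terms g e W S U sg q acc) x =
    (if sg then -1 else 1) / q * (\<Prod>i\<in>set S. x i) * expand g x e W U + mlpoly_eval acc x"
  using assms
proof (induction g e W S U sg q acc rule: terms.induct)
  case (1 g e S U sg q acc)
  thus ?case by (simp add: mlpoly_eval_Cons frac_val_def)
next
  case (2 g v W S U sg q acc)
  thus ?case by simp
next
  case (3 g e v W S U sg q acc)
  let ?p = "\<Prod>i\<in>set S. x i"
  have d: "distinct ((v # S) @ W)" "distinct (S @ W)" "v \<notin> set S" "q > 0" "2 * q > 0"
    using "3.prems" by auto
  have s: "(if \<not> sg then - 1 else 1) = - (if sg then - 1 else (1 :: real))" by simp
  have "mlpoly_eval (terms g (Suc e) (v # W) S U sg q acc) x =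
      (if sg then -1 else 1) / q * ?p * expand g x (Suc e) W U
      + ((if sg then -1 else 1) / real (2 * q) * ?p * expand g x e W (v # U)
      + (- (if sg then -1 else 1) / real (2 * q) * (x v * ?p) * expand g x e W (v # U)
      + (- (if sg then -1 else 1) / real (2 * q) * ?p * expand g x e W U
      + ((if sg then -1 else 1) / real (2 * q) * (x v * ?p) * expand g x e W U + mlpoly_eval acc x))))"
    using "3.IH" d by (simp only: terms.simps s) (simp only: list.set prod.insert finite_set not_False_eq_True)
  also have "\<dots> = (if sg then -1 else 1) / q * ?p * expand g x (Suc e) (v # W) U + mlpoly_eval acc x"
    using d(4) by (simp add: field_simps)
  finally show ?case .
qed

lemma terms_wf:
  assumes "distinct (S @ W)" "q > 0"
    and "(S', c) \<in> set (terms g e W S U sg q acc)"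
  shows "(S', c) \<in> set acc \<or>
    distinct S' \<and> length S' \<le> length S + e \<and> set S' \<subseteq> set S \<union> set W \<and> snd c > 0"
  using assms
proof (induction g e W S U sg q acc rule: terms.induct)
  case (3 g e v W S U sg q acc)
  have d: "distinct ((v # S) @ W)" "distinct (S @ W)" "2 * q > 0" using "3.prems" by auto
  define acc1 where "acc1 = terms g e W (v # S) U sg (2 * q) acc"
  define acc2 where "acc2 = terms g e W S U (\<not> sg) (2 * q) acc1"
  define acc3 where "acc3 = terms g e W (v # S) (v # U) (\<not> sg) (2 * q) acc2"
  define acc4 where "acc4 = terms g e W S (v # U) sg (2 * q) acc3"
  let ?P = "distinct S' \<and> length S' \<le> length S + Suc e \<and> set S' \<subseteq> set S \<union> set (v # W) \<and> snd c > 0"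
  have 1: "(S', c) \<in> set acc \<or> ?P" if "(S', c) \<in> set acc1"
    using "3.IH"(1)[OF d(1,3) that[unfolded acc1_def]] by auto
  have 2: "(S', c) \<in> set acc1 \<or> ?P" if "(S', c) \<in> set acc2"
    using "3.IH"(2)[folded acc1_def, OF d(2,3) that[unfolded acc2_def]] by auto
  have 3: "(S', c) \<in> set acc2 \<or> ?P" if "(S', c) \<in> set acc3"
    using "3.IH"(3)[folded acc1_def acc2_def, folded acc2_def, OF d(1,3) that[unfolded acc3_def]] by auto
  have 4: "(S', c) \<in> set acc3 \<or> ?P" if "(S', c) \<in> set acc4"
    using "3.IH"(4)[folded acc1_def, folded acc2_def, folded acc3_def, OF d(2,3) that[unfolded acc4_def]] by auto
  have "(S', c) \<in> set acc4 \<or> ?P"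
    using "3.IH"(5)[folded acc1_def, folded acc2_def, folded acc3_def, folded acc4_def, OF d(2)] "3.prems"(2,3)
    by (auto simp: acc1_def acc2_def acc3_def acc4_def)
  thus ?case using 1 2 3 4 by blast
qed auto

text \<open>A nonnegative \<open>v\<close> contributes no \<open>T\<close>. A negative one splits
  the sets by \<open>v \<in> T\<close>; those containing \<open>v\<close> have one unit of degree
  less and correspond to the difference by \<open>moebius_insert\<close>.\<close>

lemma expand_eq_moebius:
  assumes "distinct (U @ W)" "\<And>U. distinct U \<Longrightarrow> real (g U) = G (set U)"
    and "\<And>v. v \<in> set W \<Longrightarrow> x v = (if v \<in> M then -1 else 1)"
  shows "expand g x e W U = (\<Sum>T | T \<subseteq> M \<inter> set W \<and> card T \<le> e. moebius G (set U) T)"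
  using assms(1,3)
proof (induction W arbitrary: e U)
  case Nil
  have "{T. T \<subseteq> M \<inter> set [] \<and> card T \<le> e} = {{}}" by auto
  thus ?case using assms(2) Nil by simp
next
  case (Cons v W)
  let ?A = "M \<inter> set W"
  have d: "distinct (U @ W)" "distinct ((v # U) @ W)" "v \<notin> ?A" using Cons.prems by auto
  note IH = Cons.IH[OF d(1)] Cons.IH[OF d(2)]
  have x: "\<And>u. u \<in> set W \<Longrightarrow> x u = (if u \<in> M then -1 else 1)" using Cons.prems(2) by simp
  show ?case
  proof (cases "v \<in> M")
    case False
    hence "M \<inter> set (v # W) = ?A" by auto
    moreover have "expand g x e (v # W) U = expand g x e W U"
      using False Cons.prems(2) by (cases e) auto
    ultimately show ?thesis using IH(1) x by simp
  next
    case True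
    have M: "M \<inter> set (v # W) = insert v ?A" using True by auto
    show ?thesis
    proof (cases e)
      case 0
      have "{T. T \<subseteq> M \<inter> set (v # W) \<and> card T \<le> e} = {{}}" "{T. T \<subseteq> ?A \<and> card T \<le> e} = {{}}"
        using 0 finite_subset[of _ "M \<inter> set (v # W)"] finite_subset[of _ ?A] by fastforce+
      thus ?thesis using IH(1)[of e] x 0 by simp
    next
      case (Suc e')
      have eq: "{T. T \<subseteq> insert v ?A \<and> card T \<le> Suc e'} =
          {T. T \<subseteq> ?A \<and> card T \<le> Suc e'} \<union> insert v ` {T. T \<subseteq> ?A \<and> card T \<le> e'}" (is "?L = ?R")
      proof (intro equalityI subsetI)
        fix T assume T: "T \<in> ?L"
        show "T \<in> ?R"
        proof (cases "v \<in> T")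
          case True
          have "finite T" using T finite_subset[of T "insert v ?A"] by auto
          hence "T - {v} \<in> {T. T \<subseteq> ?A \<and> card T \<le> e'}" using T True by auto
          moreover have "T = insert v (T - {v})" using True by auto
          ultimately show ?thesis by blast
        qed (use T in auto)
      next
        fix T assume "T \<in> ?R"
        thus "T \<in> ?L"
        proof
          assume "T \<in> insert v ` {T. T \<subseteq> ?A \<and> card T \<le> e'}"
          then obtain T' where T': "T' \<subseteq> ?A" "card T' \<le> e'" "T = insert v T'" by blast
          have "card T \<le> Suc (card T')" unfolding T'(3) by (rule card_insert_le_m1) auto
          thus ?thesis using T' by auto
        qed auto
      qed
      have fin: "finite {T. T \<subseteq> ?A \<and> card T \<le> c}" for c
        by (rule finite_subset[of _ "Pow ?A"]) auto
      have "(\<Sum>T | T \<subseteq> M \<inter> set (v # W) \<and> card T \<le> e. moebius G (set U) T)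
          = (\<Sum>T | T \<subseteq> ?A \<and> card T \<le> Suc e'. moebius G (set U) T)
          + (\<Sum>T\<in>insert v ` {T. T \<subseteq> ?A \<and> card T \<le> e'}. moebius G (set U) T)"
        unfolding M Suc eq using d(3) by (intro sum.union_disjoint fin finite_imageI) auto
      also have "(\<Sum>T\<in>insert v ` {T. T \<subseteq> ?A \<and> card T \<le> e'}. moebius G (set U) T)
          = (\<Sum>T | T \<subseteq> ?A \<and> card T \<le> e'. moebius G (set U) (insert v T))"
        using d(3) by (subst sum.reindex) (auto simp: inj_on_def)
      also have "\<dots> = (\<Sum>T | T \<subseteq> ?A \<and> card T \<le> e'.
          moebius G (set (v # U)) T - moebius G (set U) T)"
      proof (intro sum.cong refl)
        fix T assume T: "T \<in> {T. T \<subseteq> ?A \<and> card T \<le> e'}"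
        hence "finite T" "v \<notin> T" using d(3) finite_subset[of T ?A] by auto
        thus "moebius G (set U) (insert v T) = moebius G (set (v # U)) T - moebius G (set U) T"
          by (simp add: moebius_insert)
      qed
      finally have "(\<Sum>T | T \<subseteq> M \<inter> set (v # W) \<and> card T \<le> e. moebius G (set U) T)
          = expand g x e W U + (expand g x e' W (v # U) - expand g x e' W U)"
        using IH x by (simp add: sum_subtractf Suc)
      thus ?thesis using True Cons.prems(2) by (simp add: Suc)
    qed
  qed
qed

text \<open>Truncation loses nothing if the higher coefficients vanish. This is asked only for
  \<open>T\<close> inside the negative set \<open>M\<close>: on the slice such \<open>T\<close> have
  at most \<open>k\<close> elements, which is the range of \<open>fill_moebius\<close>.\<close>

lemma mlpoly_eval_kernel:
  assumes "distinct V" "\<And>U. distinct U \<Longrightarrow> real (g U) = G (set U)"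
    and "\<And>v. v \<in> set V \<Longrightarrow> x v = (if v \<in> M then -1 else 1)"
    and "\<And>T. T \<subseteq> M \<inter> set V \<Longrightarrow> card T > d \<Longrightarrow> moebius G {} T = 0"
  shows "mlpoly_eval (terms g d V [] [] False 1 []) x = G (M \<inter> set V)"
proof -
  let ?A = "M \<inter> set V"
  have "mlpoly_eval (terms g d V [] [] False 1 []) x = expand g x d V []"
    using assms(1) by (simp add: mlpoly_eval_terms mlpoly_eval_Nil)
  also have "\<dots> = (\<Sum>T | T \<subseteq> ?A \<and> card T \<le> d. moebius G (set []) T)"
    by (intro expand_eq_moebius assms) (use assms(1) in simp)
  also have "\<dots> = (\<Sum>T\<in>Pow ?A. moebius G {} T)"
  proof (rule sum.mono_neutral_cong_left)
    show "\<forall>T\<in>Pow ?A - {T. T \<subseteq> ?A \<and> card T \<le> d}. moebius G {} T = 0"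
      by (intro ballI assms(4)) auto
  qed auto
  also have "\<dots> = G ({} \<union> ?A)" by (rule moebius_inversion) simp
  finally show ?thesis by simp
qed

text \<open>This serves the case in which all variables are kept and nothing is filled in.\<close>

lemma junta_sum_moebius:
  assumes "junta_sum d f" "finite T" "card T > d"
  shows "moebius f {} T = 0"
proof -
  have "(\<Sum>U\<in>Pow T. (-1) ^ card U * f U) = 0"
    using assms(1)
  proof induction
    case (junta S f)
    have "\<not> T \<subseteq> S" using card_mono[OF junta(1), of T] junta(2) assms(3) by linarith
    then obtain a where a: "a \<in> T" "a \<notin> S" by blast
    show ?case
    proof (rule alternating_sum_eq_0[OF assms(2) a(1)])
      fix Y
      have "insert a Y \<inter> S = Y \<inter> S" using a by auto
      thus "f (insert a Y) = f Y" using junta(3) by metis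
    qed
  next
    case (add f g)
    thus ?case by (simp add: algebra_simps sum.distrib)
  qed
  thus ?thesis by (simp add: moebius_def power_add mult.assoc flip: sum_distrib_left)
qed

section \<open>Invariance under a class, and the finite test for interchangeability\<close>

text \<open>Points with the same trace on \<open>V\<close> are joined by swaps of two variables
  outside \<open>V\<close>, and any two such variables are interchangeable through
  \<open>i\<close>.\<close>

lemma interchangeable_invariant:
  assumes "i < n" "M \<in> kslice n k" "M' \<in> kslice n k"
    and "M \<inter> V = M' \<inter> V" "V = {j. j < n \<and> asymmetric n k f i j}"
  shows "f M = f M'"
  using assms(2-4)
proof (induction "card (M - M')" arbitrary: M rule: less_induct)
  case less
  have M: "M \<subseteq> {..<n}" "card M = k" "finite M" and M': "M' \<subseteq> {..<n}" "card M' = k" "finite M'"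
    using less.prems kslice_finite[OF less.prems(1)] kslice_finite[OF less.prems(2)]
    by (simp_all add: kslice_def)
  show ?case
  proof (cases "M \<subseteq> M'")
    case True
    hence "M = M'" using M M' card_subset_eq by metis
    thus ?thesis by simp
  next
    case False
    then obtain a where a: "a \<in> M" "a \<notin> M'" by blast
    have "\<not> M' \<subseteq> M" using M M' False card_subset_eq by metis
    then obtain b where b: "b \<in> M'" "b \<notin> M" by blast
    have lt: "a < n" "b < n" using a b M M' by auto
    have "a \<notin> V" "b \<notin> V" using a b less.prems(3) by blast+
    hence "\<not> asymmetric n k f i a" "\<not> asymmetric n k f i b" using lt assms(5) by auto
    hence ab: "\<not> asymmetric n k f a b" using not_asymmetric_trans assms(1) lt by blast
    let ?M = "insert b (M - {a})"
    have eq: "?M = transp a b ` M" using a b by (simp add: transpose_image_in_out)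
    have "?M \<in> kslice n k" unfolding eq by (intro transpose_kslice lt less.prems)
    moreover have "?M - M' \<subset> M - M'" using a b by auto
    hence "card (?M - M') < card (M - M')" using M by (intro psubset_card_mono) auto
    moreover have "?M \<inter> V = M' \<inter> V" using less.prems(3) \<open>a \<notin> V\<close> \<open>b \<notin> V\<close> by auto
    ultimately have "f ?M = f M'" using less.hyps less.prems(2) by blast
    moreover have "f ?M = f M" using ab less.prems(1) unfolding eq asymmetric_def by auto
    ultimately show ?thesis by simp
  qed
qed

text \<open>The difference of \<open>f\<close> and its transposed version has degree at most
  \<open>d\<close> on the slice. The test makes it vanish within \<open>d\<close> swaps of
  \<open>{..<k}\<close>, and by \<open>deg_le_hitting\<close> it then vanishes everywhere on the
  slice.\<close>

lemma agree_iff: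
  assumes "junta_sum d (\<lambda>M. real (g M))" "k \<le> n" "n \<ge> 1" "i < n" "j < n"
  shows "agree g (List.product [0..<n] [0..<n]) i j d {..<k} \<longleftrightarrow> \<not> asymmetric n k (\<lambda>M. real (g M)) i j"
proof
  let ?Q = "List.product [0..<n] [0..<n]"
  assume asym: "\<not> asymmetric n k (\<lambda>M. real (g M)) i j"
  have "agree g ?Q i j e M" if "M \<in> kslice n k" for e M
    using that
  proof (induction e arbitrary: M)
    case 0
    thus ?case using asym by (auto simp: asymmetric_def)
  next
    case (Suc e)
    thus ?case using transpose_kslice by auto
  qed
  moreover have "{..<k} \<in> kslice n k" using assms(2) by (auto simp: kslice_def)
  ultimately show "agree g ?Q i j d {..<k}" by blast
next
  let ?Q = "List.product [0..<n] [0..<n]"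
  let ?h = "\<lambda>M. real (g (transp i j ` M)) - real (g M)"
  assume agree: "agree g ?Q i j d {..<k}"
  have near: "?h M' = 0" if "agree g ?Q i j e M" "M \<in> kslice n k" "M' \<in> kslice n k" "card (M - M') \<le> e"
    for e M M'
    using that
  proof (induction e arbitrary: M)
    case 0
    have fin: "finite M" "finite M'" "card M = card M'"
      using "0.prems" kslice_finite[OF "0.prems"(2)] kslice_finite[OF "0.prems"(3)]
      by (simp_all add: kslice_def)
    hence "M \<subseteq> M'" using "0.prems" by auto
    hence "M = M'" using fin card_subset_eq by metis
    thus ?case using "0.prems" by simp
  next
    case (Suc e)
    have fin: "finite M" "finite M'" "card M = card M'" "M \<subseteq> {..<n}" "M' \<subseteq> {..<n}"
      using Suc.prems kslice_finite[OF Suc.prems(2)] kslice_finite[OF Suc.prems(3)]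
      by (simp_all add: kslice_def)
    have step: "agree g ?Q i j e (transp a b ` M)" if "a < n" "b < n" for a b
      using Suc.prems(1) that by auto
    show ?case
    proof (cases "M \<subseteq> M'")
      case True
      \<comment> \<open>The pair \<open>(0, 0)\<close> is among the candidates and changes nothing,
        so exactly \<open>e\<close> swaps also cover fewer.\<close>
      have "agree g ?Q i j e M" using step[of 0 0] assms(3) by simp
      moreover have "card (M - M') \<le> e" using True by (simp add: Diff_eq_empty_iff[THEN iffD2])
      ultimately show ?thesis using Suc.IH Suc.prems by blast
    next
      case False
      then obtain a where a: "a \<in> M" "a \<notin> M'" by blast
      have "\<not> M' \<subseteq> M" using fin False card_subset_eq by metis
      then obtain b where b: "b \<in> M'" "b \<notin> M" by blast
      have lt: "a < n" "b < n" using a b fin by auto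
      let ?M = "insert b (M - {a})"
      have eq: "transp a b ` M = ?M" using a b by (simp add: transpose_image_in_out)
      have "?M - M' \<subset> M - M'" using a b by auto
      hence "card (?M - M') < card (M - M')" using fin by (intro psubset_card_mono) auto
      hence "card (?M - M') \<le> e" using Suc.prems(4) by linarith
      moreover have "?M \<in> kslice n k" using transpose_kslice[OF lt Suc.prems(2)] eq by simp
      ultimately show ?thesis using Suc.IH[of ?M] step[OF lt] eq Suc.prems(3) by simp
    qed
  qed
  have k: "{..<k} \<in> kslice n k" using assms(2) by (auto simp: kslice_def)
  have deg: "deg_le d {..<n} k ?h"
    by (intro junta_sum_deg_le junta_sum_diff assms(1) junta_sum_image[OF assms(1)]) auto
  have "?h M = 0" if "M \<in> kslice n k" for M
  proof (rule deg_le_hitting[OF _ deg, of "{..<k}"])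
    fix M' assume "M' \<subseteq> {..<n}" "card M' = k" "card ({..<k} - M') \<le> d"
    thus "?h M' = 0" using near[OF agree k] by (simp add: kslice_def)
  qed (use that k in \<open>auto simp: kslice_def\<close>)
  thus "\<not> asymmetric n k (\<lambda>M. real (g M)) i j" by (auto simp: asymmetric_def)
qed

section \<open>Constants\<close>

text \<open>The right side exceeds the left by \<open>j * (k - j - 1)\<close>.\<close>

lemma le_Suc_times_diff: "j < k \<Longrightarrow> k \<le> (j + 1) * (k - j)"
  for j k :: nat
proof -
  assume "j < k"
  then obtain r where "k = Suc (j + r)" using less_imp_Suc_add by blast
  thus ?thesis by (simp add: algebra_simps)
qed

text \<open>With \<open>N = n - 2 * j\<close> and \<open>K = k - j\<close> the ratio of the two
  coefficients is \<open>K * (N - K)\<close> over \<open>N * (N - 1)\<close>. The larger of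
  \<open>K\<close> and \<open>N - K\<close> is at least half of \<open>N\<close>, and the smaller at
  least \<open>p0 * N / d\<close> because \<open>j < d\<close>.\<close>

lemma binomial_ratio_step:
  fixes p0 :: real and d :: nat
  assumes "j < k" "j < n - k" "j < d" "p0 * n \<le> k" "p0 * n \<le> real (n - k)" "p0 \<ge> 0"
  shows "p0 / (2 * d) * ((n - 2 * j) choose (k - j)) \<le> (n - 2 * Suc j) choose (k - Suc j)"
proof -
  define N K where "N = n - 2 * j" and "K = k - j"
  have NK: "0 < K" "K < N" "1 \<le> d" using assms(1-3) by (auto simp: N_def K_def)
  have "N * (N - 1) * ((N - 2) choose (K - 1)) = N * ((N - 1 - (K - 1)) * ((N - 1) choose (K - 1)))"
    using binomial_absorb_comp[of "N - 1" "K - 1"] by (simp add: numeral_2_eq_2)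
  also have "\<dots> = (N - K) * (K * (N choose K))"
    using NK times_binomial_minus1_eq[of K N] by simp
  finally have "real (N * (N - 1) * ((N - 2) choose (K - 1))) = real ((N - K) * (K * (N choose K)))"
    by (simp only:)
  hence eq: "real N * real (N - 1) * ((N - 2) choose (K - 1)) = real (N - K) * K * (N choose K)"
    by simp
  have small: "p0 * N \<le> d * x" if "p0 * n \<le> y" "y \<le> (j + 1) * x" for x y :: nat
  proof -
    have "p0 * N \<le> p0 * n" using assms(6) by (intro mult_left_mono) (auto simp: N_def)
    also have "\<dots> \<le> y" by fact
    also have "\<dots> \<le> real ((j + 1) * x)" using that(2) by (simp only: of_nat_le_iff)
    also have "\<dots> \<le> real (d * x)" using assms(3) by (intro of_nat_mono mult_right_mono) auto
    finally show ?thesis by simp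
  qed
  have "p0 * N * (N - 1) \<le> 2 * d * (real K * real (N - K))"
  proof (cases "K \<le> N - K")
    case True
    have "p0 * N \<le> d * K" using small[OF assms(4)] le_Suc_times_diff[OF assms(1)] by (simp add: K_def)
    moreover have "real (N - 1) \<le> 2 * real (N - K)" using True NK by linarith
    ultimately have "p0 * N * (N - 1) \<le> (d * K) * (2 * real (N - K))"
      by (rule mult_mono) auto
    thus ?thesis by (simp add: mult_ac)
  next
    case False
    have "N - K = n - k - j" using assms(1,2) by (simp add: N_def K_def)
    hence "p0 * N \<le> d * real (N - K)"
      using small[of "n - k" "N - K"] assms(5) le_Suc_times_diff[OF assms(2)] by simp
    moreover have "real (N - 1) \<le> 2 * real K" using False NK by linarith
    ultimately have "p0 * N * (N - 1) \<le> (d * real (N - K)) * (2 * real K)"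
      by (rule mult_mono) auto
    thus ?thesis by (simp add: mult_ac)
  qed
  hence "(p0 * N * (N - 1)) * (N choose K) \<le> (2 * d * (real K * real (N - K))) * (N choose K)"
    by (intro mult_right_mono) auto
  also have "\<dots> = 2 * d * (real N * real (N - 1) * ((N - 2) choose (K - 1)))"
    unfolding eq by (simp add: mult_ac)
  finally have "(real N * real (N - 1)) * (p0 * (N choose K))
      \<le> (real N * real (N - 1)) * (2 * d * ((N - 2) choose (K - 1)))"
    by (simp add: mult_ac)
  moreover have "real N * real (N - 1) > 0" using NK by simp
  ultimately have "p0 * (N choose K) \<le> 2 * d * ((N - 2) choose (K - 1))"
    by (simp only: mult_le_cancel_left_pos)
  moreover have "N - 2 = n - 2 * Suc j" "K - 1 = k - Suc j" by (auto simp: N_def K_def)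
  ultimately show ?thesis using NK by (simp add: N_def K_def divide_le_eq mult_ac)
qed

lemma binomial_ratio:
  fixes p0 :: real and d :: nat
  assumes "D \<le> k" "D \<le> n - k" "D \<le> d" "p0 * n \<le> k" "p0 * n \<le> real (n - k)" "p0 \<ge> 0"
  shows "(p0 / (2 * d)) ^ D * (n choose k) \<le> (n - 2 * D) choose (k - D)"
  using assms(1-3)
proof (induction D)
  case (Suc j)
  have "(p0 / (2 * d)) ^ Suc j * (n choose k) = p0 / (2 * d) * ((p0 / (2 * d)) ^ j * (n choose k))"
    by simp
  also have "\<dots> \<le> p0 / (2 * d) * ((n - 2 * j) choose (k - j))"
    using Suc assms(6) by (intro mult_left_mono) auto
  also have "\<dots> \<le> (n - 2 * Suc j) choose (k - Suc j)"
    using Suc.prems assms(4-6) by (intro binomial_ratio_step) auto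
  finally show ?case .
qed simp

lemma max_minus_avg_ge:
  fixes f :: "nat set \<Rightarrow> real" and p0 opt :: real
  assumes f: "junta_sum d f" "\<And>M. f M \<in> \<int>" and dk: "d \<ge> 1" "0 < k" "k < n"
    and p0: "0 < p0" "p0 \<le> 1" "p0 * n \<le> k" "p0 * n \<le> real (n - k)"
    and s: "\<And>i. i < n \<Longrightarrow> s \<le> card {j. j < n \<and> asymmetric n k f i j}"
    and i0: "i0 < n" "card {j. j < n \<and> asymmetric n k f i0 j} = s" and "s > 0"
    and opt: "\<And>M. M \<in> kslice n k \<Longrightarrow> f M \<le> opt"
  shows "sqrt s * ((p0 / (2 * d)) ^ d / (4 * sqrt d * 3 ^ d)) \<le> opt - kslice_avg n k f"
proof -
  define D where "D = min d (min k (n - k))"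
  define \<mu> where "\<mu> = kslice_avg n k f"
  have pos: "real (n choose k) > 0" using dk by simp
  have sum\<mu>: "(\<Sum>M\<in>kslice n k. f M) = (n choose k) * \<mu>"
    using pos by (simp add: \<mu>_def kslice_avg_def)
  have "(\<Sum>M\<in>kslice n k. f M) \<le> (\<Sum>M\<in>kslice n k. opt)" by (intro sum_mono opt)
  hence \<mu>: "\<mu> \<le> opt" using pos unfolding sum\<mu> by (simp add: card_kslice)
  have x: "0 \<le> p0 / (2 * d)" "p0 / (2 * d) \<le> 1" using p0 dk by auto
  \<comment> \<open>The base is at most 1, so \<open>D\<close> may be replaced by \<open>d\<close>,
    which does not depend on \<open>k\<close>.\<close>
  have "(p0 / (2 * d)) ^ d * (n choose k) \<le> (p0 / (2 * d)) ^ D * (n choose k)"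
    using x by (intro mult_right_mono power_decreasing) (auto simp: D_def)
  also have "\<dots> \<le> (n - 2 * D) choose (k - D)"
    using p0 by (intro binomial_ratio) (auto simp: D_def)
  finally have "(p0 / (2 * d)) ^ d \<le> ((n - 2 * D) choose (k - D)) / (n choose k)"
    using pos by (simp add: pos_le_divide_eq)
  hence "sqrt s * (p0 / (2 * d)) ^ d / (2 * sqrt d * 3 ^ d)
      \<le> sqrt s * (((n - 2 * D) choose (k - D)) / (n choose k)) / (2 * sqrt d * 3 ^ d)"
    by (intro divide_right_mono mult_left_mono) auto
  also have "\<dots> \<le> kslice_avg n k (\<lambda>M. \<bar>f M - \<mu>\<bar>)"
    unfolding D_def by (rule abs_deviation_ge[OF f dk s i0 \<open>s > 0\<close>])
  \<comment> \<open>Since \<open>f M - \<mu>\<close> averages to 0, this pointwise bound expresses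
    that the deviations below the average weigh no more than those above it.\<close>
  also have "\<dots> \<le> kslice_avg n k (\<lambda>M. 2 * (opt - \<mu>) - (f M - \<mu>))"
    unfolding kslice_avg_def
  proof (intro divide_right_mono sum_mono)
    fix M assume "M \<in> kslice n k"
    hence "f M \<le> opt" by (rule opt)
    thus "\<bar>f M - \<mu>\<bar> \<le> 2 * (opt - \<mu>) - (f M - \<mu>)" using \<mu> by (simp add: abs_if)
  qed simp
  also have "\<dots> = 2 * (opt - \<mu>)"
    using pos by (simp add: kslice_avg_def sum_subtractf sum.distrib sum\<mu> card_kslice field_simps)
  finally have "sqrt s * (p0 / (2 * d)) ^ d / (2 * sqrt d * 3 ^ d) / 2 \<le> opt - \<mu>" by simp
  thus ?thesis by (simp add: \<mu>_def mult_ac)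
qed

text \<open>The inverse square of the constant in \<open>max_minus_avg_ge\<close>.\<close>

definition threshold :: "real \<Rightarrow> nat \<Rightarrow> real" where
  "threshold p0 d = 16 * d * 9 ^ d * (2 * d / p0) ^ (2 * d)"

text \<open>Squares are compared, for which only the right side has to be nonnegative; so negative
  \<open>t\<close> is covered.\<close>

lemma threshold_le:
  fixes p0 t :: real and s d :: nat
  assumes "threshold p0 d * t\<^sup>2 \<le> s" "p0 > 0" "d \<ge> 1"
  shows "t \<le> sqrt s * ((p0 / (2 * d)) ^ d / (4 * sqrt d * 3 ^ d))"
proof -
  let ?x = "(p0 / (2 * d)) ^ d / (4 * sqrt d * 3 ^ d)"
  have "((3::real) ^ d)\<^sup>2 = 9 ^ d" by (simp add: power2_eq_square flip: power_mult_distrib)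
  hence "?x\<^sup>2 = (p0 / (2 * d)) ^ (2 * d) / (16 * d * 9 ^ d)"
    by (simp add: power_divide power_mult_distrib power_mult mult.commute[of 2 d])
  also have "\<dots> = 1 / threshold p0 d"
    by (simp add: threshold_def power_divide)
  finally have x: "?x\<^sup>2 = 1 / threshold p0 d" .
  have pos: "threshold p0 d > 0" using assms by (simp add: threshold_def)
  have "t\<^sup>2 \<le> s / threshold p0 d" using assms(1) pos by (simp add: pos_le_divide_eq mult.commute)
  also have "\<dots> = (sqrt s * ?x)\<^sup>2" unfolding power_mult_distrib x by simp
  finally have "t\<^sup>2 \<le> (sqrt s * ?x)\<^sup>2" .
  moreover have "sqrt s * ?x \<ge> 0" using assms by simp
  ultimately show ?thesis by (rule power2_le_imp_le)
qed

definition kernel_const :: "real \<Rightarrow> nat \<Rightarrow> real" where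
  "kernel_const p0 d = 160 * (real d)\<^sup>2 * 30 ^ d * (((1 - p0) / p0)\<^sup>2 + (p0 / (1 - p0))\<^sup>2) ^ d
     * fact d ^ (3 * d\<^sup>2) * (1 / (2 * p0)) ^ (4 * d)"

text \<open>For \<open>d \<ge> 2\<close> both 2 and \<open>d\<close> are at most
  \<open>fact d\<close>, and \<open>6 * d \<le> 3 * d\<^sup>2\<close>. The factor 3 is for
  \<open>d = 1\<close>, where the claim is \<open>144 \<le> 180\<close>.\<close>

lemma fact_power_ge:
  assumes "d \<ge> 1"
  shows "9 ^ d * (4 * real d) ^ (2 * d) \<le> 3 * (60 ^ d * fact d ^ (3 * d\<^sup>2))"
proof (cases "d = 1")
  case False
  hence d: "d \<ge> 2" using assms by simp
  have "real d \<le> real (fact d)" using fact_ge_self[of d] by (simp only: of_nat_le_iff)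
  hence f: "real d \<le> fact d" by simp
  hence f2: "(2::real) \<le> fact d" using d by linarith
  have "(4 * real d) ^ (2 * d) = 2 ^ (4 * d) * real d ^ (2 * d)"
    by (simp add: power_mult_distrib power_mult)
  also have "\<dots> \<le> fact d ^ (4 * d) * fact d ^ (2 * d)"
    using f f2 by (intro mult_mono power_mono) auto
  also have "\<dots> = fact d ^ (6 * d)" by (simp flip: power_add)
  also have "\<dots> \<le> fact d ^ (3 * d\<^sup>2)"
    using d f2 by (intro power_increasing) (auto simp: power2_eq_square)
  finally have "9 ^ d * (4 * real d) ^ (2 * d) \<le> 60 ^ d * fact d ^ (3 * d\<^sup>2)"
    by (intro mult_mono power_mono) auto
  also have "\<dots> \<le> 3 * (60 ^ d * fact d ^ (3 * d\<^sup>2))" by simp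
  finally show ?thesis .
qed (simp add: power2_eq_square)

text \<open>The two units pay for rounding the threshold up to \<open>K2\<close> and the constant
  down to \<open>K1\<close>. Multiplied by \<open>2 * u = 1 / p0\<close>, the left side is at most
  98 \<open>W\<close>, and one more \<open>W\<close> covers the unit on the right;
  \<open>160 * W\<close> is available.\<close>

lemma kernel_const_ge:
  assumes "0 < p0" "p0 \<le> 1 / 2" "d \<ge> 1"
  shows "threshold p0 d + 1 \<le> p0 * (kernel_const p0 d - 1)"
proof -
  define u where "u = 1 / (2 * p0)"
  define W where "W = real d * (60 ^ d * fact d ^ (3 * d\<^sup>2) * u ^ (4 * d))"
  have u: "u \<ge> 1" "p0 = 1 / (2 * u)" using assms by (auto simp: u_def)
  have fac: "(1::real) \<le> 60 ^ d * fact d ^ (3 * d\<^sup>2)"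
    using mult_mono[of 1 "60 ^ d" 1 "fact d ^ (3 * d\<^sup>2) :: real"]
    by (simp add: one_le_power fact_ge_1)
  have "1 * u \<le> (60 ^ d * fact d ^ (3 * d\<^sup>2)) * u ^ (4 * d)"
    using u(1) assms(3) fac power_increasing[of 1 "4 * d" u] by (intro mult_mono) auto
  moreover have "1 * (60 ^ d * fact d ^ (3 * d\<^sup>2) * u ^ (4 * d)) \<le> W"
    unfolding W_def using assms(3) u(1) by (intro mult_right_mono) auto
  ultimately have uW: "u \<le> W" by simp
  have "threshold p0 d * (2 * u) = 32 * real d * (9 ^ d * (4 * real d) ^ (2 * d)) * u ^ (2 * d + 1)"
    unfolding threshold_def u(2) by (simp add: power_mult_distrib)
  also have "\<dots> \<le> 32 * real d * (3 * (60 ^ d * fact d ^ (3 * d\<^sup>2))) * u ^ (4 * d)"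
    using u(1) assms(3)
    by (intro mult_mono[OF mult_left_mono[OF fact_power_ge]] power_increasing) auto
  also have "\<dots> = 96 * W" by (simp add: W_def)
  finally have 1: "threshold p0 d * (2 * u) \<le> 96 * W" .
  \<comment> \<open>The two squares are reciprocal, so their sum is at least 2; together with
    \<open>30 ^ d\<close> this gives the factor \<open>60 ^ d\<close> in \<open>W\<close>.\<close>
  have "2 \<le> ((1 - p0) / p0)\<^sup>2 + (p0 / (1 - p0))\<^sup>2"
  proof -
    have 1: "((1 - p0) / p0) * (p0 / (1 - p0)) = 1" using assms by simp
    show ?thesis using sum_squares_bound[of "(1 - p0) / p0" "p0 / (1 - p0)"]
      by (simp only: mult.assoc 1 mult_1_right)
  qed
  hence "2 ^ d \<le> (((1 - p0) / p0)\<^sup>2 + (p0 / (1 - p0))\<^sup>2) ^ d" by (intro power_mono) auto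
  hence "160 * (real d)\<^sup>2 * 30 ^ d * 2 ^ d * fact d ^ (3 * d\<^sup>2) * u ^ (4 * d) \<le> kernel_const p0 d"
    unfolding kernel_const_def u_def[symmetric] using u(1)
    by (intro mult_right_mono mult_left_mono) auto
  moreover have "160 * W \<le> 160 * (real d)\<^sup>2 * 30 ^ d * 2 ^ d * fact d ^ (3 * d\<^sup>2) * u ^ (4 * d)"
  proof -
    have "160 * W * 1 \<le> 160 * W * d" using assms(3) u uW by (intro mult_left_mono) auto
    also have "\<dots> = 160 * (real d)\<^sup>2 * (30 ^ d * 2 ^ d) * fact d ^ (3 * d\<^sup>2) * u ^ (4 * d)"
      by (simp add: W_def power2_eq_square flip: power_mult_distrib)
    finally show ?thesis by (simp add: mult_ac)
  qed
  ultimately have "160 * W \<le> kernel_const p0 d" by linarith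
  hence "(threshold p0 d + 1) * (2 * u) \<le> kernel_const p0 d - 1"
    using 1 uW u(1) by (simp add: algebra_simps)
  hence "(threshold p0 d + 1) * (2 * u) / (2 * u) \<le> (kernel_const p0 d - 1) / (2 * u)"
    using u(1) by (intro divide_right_mono) auto
  thus ?thesis using u by simp
qed

section \<open>Correctness of the algorithm\<close>

lemma count_sat_eq_val: "csp_val I (pt M) = count_sat (constrs I) M"
  by (simp add: csp_val_def count_sat_def)

lemma csp_val_cong:
  assumes "csp_wf d I" "\<And>i. i < nvars I \<Longrightarrow> \<alpha> i = \<beta> i"
  shows "csp_val I \<alpha> = csp_val I \<beta>"
proof -
  have "map \<alpha> xs \<in> P \<longleftrightarrow> map \<beta> xs \<in> P" if "(xs, P) \<in> set (constrs I)" for xs P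
  proof -
    have "map \<alpha> xs = map \<beta> xs" using that assms by (force simp: csp_wf_def)
    thus ?thesis by (rule arg_cong[where f = "\<lambda>ys. ys \<in> P"])
  qed
  thus ?thesis unfolding csp_val_def by (intro arg_cong[where f = length] filter_cong) auto
qed

lemma junta_sum_count_sat:
  assumes "\<And>xs P. (xs, P) \<in> set cs \<Longrightarrow> length xs = d"
  shows "junta_sum d (\<lambda>M. real (count_sat cs M))"
  using assms
proof (induction cs)
  case Nil
  show ?case by (rule junta_sum.junta[of "{}"]) (auto simp: count_sat_def)
next
  case (Cons c cs)
  obtain xs P where c: "c = (xs, P)" by (cases c)
  have "junta_sum d (\<lambda>M. if map (pt M) xs \<in> P then 1 else 0)"
  proof (rule junta_sum.junta[of "set xs"])
    show "card (set xs) \<le> d" using card_length[of xs] Cons.prems[of xs P] by (simp add: c)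
    fix M
    have "map (pt M) xs = map (pt (M \<inter> set xs)) xs" by (auto simp: pt_def)
    thus "(if map (pt M) xs \<in> P then 1 else 0) = (if map (pt (M \<inter> set xs)) xs \<in> P then 1 else 0 :: real)"
      by (rule arg_cong)
  qed simp
  moreover have "junta_sum d (\<lambda>M. real (count_sat cs M))" using Cons by auto
  ultimately have "junta_sum d (\<lambda>M. (if map (pt M) xs \<in> P then 1 else 0) + real (count_sat cs M))"
    by (rule junta_sum.add)
  moreover have "real (count_sat (c # cs) M) = (if map (pt M) xs \<in> P then 1 else 0) + real (count_sat cs M)" for M
    by (simp add: count_sat_def c)
  ultimately show ?case by simp
qed

lemma slice_bij:
  assumes "p * real n = real k"
  shows "bij_betw (\<lambda>M. restrict (pt M) {..<n}) (kslice n k) (slice n p)"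
proof (rule bij_betw_byWitness[of _ "\<lambda>\<alpha>. {i. i < n \<and> \<alpha> i = -1}"])
  have sum: "(\<Sum>i<n. pt M i) = int n - 2 * int (card M)" if "M \<subseteq> {..<n}" for M
  proof -
    have "(\<Sum>i<n. pt M i) = (\<Sum>i<n. 1 - 2 * (if i \<in> M then 1 else 0))"
      by (intro sum.cong) (auto simp: pt_def)
    also have "\<dots> = int n - 2 * (\<Sum>i<n. if i \<in> M then 1 else 0)"
      by (simp add: sum_subtractf sum_distrib_left)
    also have "(\<Sum>i<n. if i \<in> M then 1 else 0 :: int) = int (card ({..<n} \<inter> M))"
      by (simp add: sum.If_cases)
    also have "{..<n} \<inter> M = M" using that by auto
    finally show ?thesis .
  qed
  show "(\<lambda>M. restrict (pt M) {..<n}) ` kslice n k \<subseteq> slice n p"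
  proof (rule image_subsetI)
    fix M assume M: "M \<in> kslice n k"
    have "(\<Sum>i<n. restrict (pt M) {..<n} i) = int n - 2 * int k"
      using sum[of M] M by (simp add: kslice_def)
    hence "real_of_int (\<Sum>i<n. restrict (pt M) {..<n} i) = real n - 2 * real k"
      by (simp only: of_int_diff of_int_mult of_int_of_nat_eq of_int_numeral)
    also have "\<dots> = (1 - 2 * p) * real n" using assms by (simp add: algebra_simps)
    finally show "restrict (pt M) {..<n} \<in> slice n p"
      unfolding slice_def by (intro CollectI conjI) (auto simp: pt_def)
  qed
  have eq: "restrict (pt {i. i < n \<and> \<alpha> i = -1}) {..<n} = \<alpha>" if "\<alpha> \<in> slice n p" for \<alpha>
  proof (rule extensionalityI[of _ "{..<n}"])
    show "\<alpha> \<in> extensional {..<n}" using that by (auto simp: slice_def PiE_def)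
    fix i assume i: "i \<in> {..<n}"
    hence "\<alpha> i \<in> {-1, 1}" using that by (auto simp: slice_def)
    thus "restrict (pt {i. i < n \<and> \<alpha> i = -1}) {..<n} i = \<alpha> i" using i by (auto simp: pt_def)
  qed auto
  thus "\<forall>\<alpha>\<in>slice n p. restrict (pt {i. i < n \<and> \<alpha> i = -1}) {..<n} = \<alpha>" by blast
  show "(\<lambda>\<alpha>. {i. i < n \<and> \<alpha> i = -1}) ` slice n p \<subseteq> kslice n k"
  proof (rule image_subsetI)
    fix \<alpha> assume \<alpha>: "\<alpha> \<in> slice n p"
    let ?M = "{i. i < n \<and> \<alpha> i = -1}"
    have "(\<Sum>i<n. \<alpha> i) = (\<Sum>i<n. pt ?M i)"
      by (rule sum.cong[OF refl]) (subst eq[OF \<alpha>, symmetric], simp)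
    also have "\<dots> = int n - 2 * int (card ?M)" by (rule sum) auto
    finally have "real_of_int (\<Sum>i<n. \<alpha> i) = real n - 2 * real (card ?M)"
      by (simp only: of_int_diff of_int_mult of_int_of_nat_eq of_int_numeral)
    moreover have "real_of_int (\<Sum>i<n. \<alpha> i) = (1 - 2 * p) * real n"
      using \<alpha> unfolding slice_def by blast
    ultimately have "real n - 2 * real (card ?M) = (1 - 2 * p) * real n" by (simp only:)
    hence "real (card ?M) = real k" using assms by (simp add: algebra_simps)
    thus "?M \<in> kslice n k" by (auto simp: kslice_def)
  qed
  show "\<forall>M\<in>kslice n k. {i. i < n \<and> restrict (pt M) {..<n} i = -1} = M"
    by (auto simp: kslice_def pt_def split: if_splits)
qed

text \<open>With \<open>k \<le> length B\<close> the filler never runs out, not even for empty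
  \<open>X\<close>.\<close>

lemma fill_kslice:
  assumes "X \<subseteq> V" "V \<subseteq> {..<n}" "card X \<le> k" "distinct B" "set B = {..<n} - V" "k \<le> length B"
  shows "X \<union> set (take (k - card X) B) \<in> kslice n k" "(X \<union> set (take (k - card X) B)) \<inter> V = X"
proof -
  let ?R = "set (take (k - card X) B)"
  have R: "?R \<subseteq> {..<n} - V" using set_take_subset assms(5) by fastforce
  have "card ?R = k - card X" using assms(4,6) by (simp add: distinct_card)
  moreover have "finite X" using assms(1,2) finite_subset[of X "{..<n}"] by auto
  moreover have "X \<inter> ?R = {}" using R assms(1) by auto
  ultimately have "card (X \<union> ?R) = k" using assms(3) by (simp add: card_Un_disjoint)
  thus "X \<union> ?R \<in> kslice n k" using R assms(1,2) by (auto simp: kslice_def)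
  show "(X \<union> ?R) \<inter> V = X" using R assms(1) by auto
qed

text \<open>Filling up from \<open>B\<close> can be imitated by swaps: a filled subset of
  \<open>T\<close> has the same trace on \<open>V\<close> as the first \<open>k\<close> elements of
  \<open>B\<close> with some exchanged for that subset, hence the same value. Up to sign the
  coefficient is therefore an alternating sum over more than \<open>d\<close> swaps.\<close>

lemma fill_moebius:
  assumes f: "junta_sum d f" and i: "i < n" and V: "V = {j. j < n \<and> asymmetric n k f i j}"
    and B: "distinct B" "set B = {..<n} - V" "k \<le> length B"
    and T: "T \<subseteq> V" "card T \<le> k" "d < card T"
  shows "moebius (\<lambda>X. f (X \<union> set (take (k - card X) B))) {} T = 0"
proof -
  let ?G = "\<lambda>X. f (X \<union> set (take (k - card X) B))"
  have Vn: "V \<subseteq> {..<n}" using V by auto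
  have finT: "finite T" using T(3) by (cases "finite T") auto
  let ?M0 = "set (take k B)"
  have M0: "?M0 \<in> kslice n k" "?M0 \<inter> V = {}" using fill_kslice[of "{}" V n k B] Vn B by auto
  \<comment> \<open>These elements are exchanged for \<open>T\<close>; \<open>card T \<le> k\<close>
    puts them inside \<open>?M0\<close>.\<close>
  let ?A = "set (take (card T) B)"
  have A: "?A \<subseteq> ?M0" using T(2) by (rule set_take_subset_set_take)
  have cA: "card ?A = card T" using B(1,3) T(2) by (simp add: distinct_card)
  then obtain \<beta> where \<beta>: "bij_betw \<beta> ?A T" using finT finite_same_card_bij[of ?A T] by auto
  have img: "\<beta> ` ?A = T" and inj: "inj_on \<beta> ?A" using \<beta> by (auto simp: bij_betw_def)
  have MA: "?M0 \<subseteq> {..<n}" "card ?M0 = k" using M0(1) by (auto simp: kslice_def)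
  have "(\<Sum>Y\<in>Pow ?A. (-1) ^ card Y * f ((?M0 - Y) \<union> \<beta> ` Y)) = 0"
  proof (rule deg_leD[OF junta_sum_deg_le[OF _ f] MA A])
    show "\<beta> ` ?A \<subseteq> {..<n} - ?M0" using img T(1) Vn M0(2) by auto
  qed (use cA T inj in auto)
  also have "(\<Sum>Y\<in>Pow ?A. (-1) ^ card Y * f ((?M0 - Y) \<union> \<beta> ` Y))
      = (\<Sum>Y\<in>Pow ?A. (-1) ^ card (\<beta> ` Y) * ?G (\<beta> ` Y))"
  proof (intro sum.cong refl)
    fix Y assume Y: "Y \<in> Pow ?A"
    have card: "card (\<beta> ` Y) = card Y" using Y inj by (intro card_image) (auto intro: inj_on_subset)
    have sub: "\<beta> ` Y \<subseteq> V" using Y img T(1) by blast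
    have "card Y \<le> card ?A" using Y by (intro card_mono) auto
    hence le: "card (\<beta> ` Y) \<le> k" using card cA T(2) by linarith
    note fill = fill_kslice[OF sub Vn le B]
    have finY: "finite Y" using Y finite_subset[of Y ?A] by auto
    have "(?M0 - Y) \<inter> \<beta> ` Y = {}" using sub M0(2) by auto
    hence "card ((?M0 - Y) \<union> \<beta> ` Y) = card (?M0 - Y) + card (\<beta> ` Y)"
      using finY by (intro card_Un_disjoint) auto
    also have "card (?M0 - Y) = k - card Y" using Y A finY MA(2) by (subst card_Diff_subset) auto
    finally have "card ((?M0 - Y) \<union> \<beta> ` Y) = k" using card le by simp
    hence "(?M0 - Y) \<union> \<beta> ` Y \<in> kslice n k" using MA sub Vn by (auto simp: kslice_def)
    moreover have "((?M0 - Y) \<union> \<beta> ` Y) \<inter> V = \<beta> ` Y" using M0(2) sub by auto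
    ultimately have "f ((?M0 - Y) \<union> \<beta> ` Y) = ?G (\<beta> ` Y)"
      using interchangeable_invariant[OF i _ fill(1) _ V, of "(?M0 - Y) \<union> \<beta> ` Y"] fill(2) by simp
    thus "(-1) ^ card Y * f ((?M0 - Y) \<union> \<beta> ` Y) = (-1) ^ card (\<beta> ` Y) * ?G (\<beta> ` Y)"
      using card by simp
  qed
  also have "\<dots> = (\<Sum>U\<in>Pow T. (-1) ^ card U * ?G U)"
    by (rule sum.reindex_bij_betw[OF bij_betw_Pow[OF \<beta>]])
  finally show ?thesis
    by (simp add: moebius_def power_add mult.assoc flip: sum_distrib_left)
qed

text \<open>Either all \<open>n\<close> variables are kept and \<open>B\<close> is empty, or \<open>B\<close> is a class of interchangeable variables
  that is large enough to complete every set of negative variables outside \<open>B\<close>.\<close>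

lemma is_kernel_kernel_of:
  fixes I :: csp
  defines "n \<equiv> nvars I" and "f \<equiv> \<lambda>M. real (count_sat (constrs I) M)"
  assumes wf: "csp_wf d I" and pk: "p * real n = real k"
    and V: "distinct V" "set V \<subseteq> {..<n}"
    and B: "B = [] \<and> set V = {..<n} \<or>
      distinct B \<and> set B = {..<n} - set V \<and> k \<le> length B \<and>
      (\<exists>i<n. set V = {j. j < n \<and> asymmetric n k f i j})"
    and ker: "kernel_of d (constrs I) k V B = Kernel V' g"
  shows "V' = V \<and> is_kernel d I p (set V) g"
proof -
  let ?g = "\<lambda>U. count_sat (constrs I) (set (U @ take (k - length U) B))"
  let ?G = "\<lambda>X. f (X \<union> set (take (k - card X) B))"
  have g: "V' = V" "g = terms ?g d V [] [] False 1 []" using ker by (auto simp: kernel_of_def)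
  have f: "junta_sum d f" unfolding f_def using wf by (intro junta_sum_count_sat) (auto simp: csp_wf_def)
  have "is_mlpoly d (set V) g"
    unfolding is_mlpoly_def
  proof (intro ballI, clarify)
    fix S a b assume "(S, a, b) \<in> set g"
    thus "distinct S \<and> length S \<le> d \<and> set S \<subseteq> set V \<and> 0 < snd (a, b)"
      using terms_wf[of "[]" V 1 S "(a, b)" ?g d "[]" False "[]"] V(1) unfolding g by auto
  qed
  moreover have "mlpoly_eval g (\<lambda>i. real_of_int (\<alpha> i)) = csp_poly d I (\<lambda>i. real_of_int (\<alpha> i))"
    if "\<alpha> \<in> slice n p" for \<alpha>
  proof -
    obtain M where M: "M \<in> kslice n k" "\<alpha> = restrict (pt M) {..<n}"
      using bij_betw_imp_surj_on[OF slice_bij[OF pk]] \<open>\<alpha> \<in> slice n p\<close> by auto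
    have \<alpha>: "\<alpha> i = (if i \<in> M then -1 else 1)" if "i < n" for i using that by (simp add: M(2) pt_def)
    have finM: "finite M" "card M = k" "M \<subseteq> {..<n}" using kslice_finite[OF M(1)] M(1) by (auto simp: kslice_def)
    have small: "card T \<le> k" "finite T" if "T \<subseteq> M" for T
      using that finM card_mono[of M T] by (auto intro: finite_subset)
    have "mlpoly_eval g (\<lambda>i. real_of_int (\<alpha> i)) = ?G (M \<inter> set V)"
      unfolding g
    proof (rule mlpoly_eval_kernel[OF V(1)])
      show "real (?g U) = ?G (set U)" if "distinct U" for U
        using that by (simp add: f_def distinct_card)
      show "real_of_int (\<alpha> v) = (if v \<in> M then -1 else 1)" if "v \<in> set V" for v
        using \<alpha>[of v] that V(2) by auto
      show "moebius ?G {} T = 0" if T: "T \<subseteq> M \<inter> set V" "d < card T" for T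
        using B
      proof (elim disjE conjE exE)
        assume "B = []"
        thus ?thesis using junta_sum_moebius[OF f _ T(2)] small[of T] T(1) by simp
      next
        fix i assume "distinct B" "set B = {..<n} - set V" "k \<le> length B" "i < n"
          "set V = {j. j < n \<and> asymmetric n k f i j}"
        thus ?thesis using small[of T] T by (intro fill_moebius[OF f]) auto
      qed
    qed
    also have "\<dots> = f M"
      using B
    proof (elim disjE conjE exE)
      assume "B = []" "set V = {..<n}"
      thus ?thesis using finM by (simp add: Int_absorb2)
    next
      fix i assume *: "distinct B" "set B = {..<n} - set V" "k \<le> length B" "i < n"
        "set V = {j. j < n \<and> asymmetric n k f i j}"
      have le: "card (M \<inter> set V) \<le> k" by (rule small) auto
      note fill = fill_kslice[OF Int_lower2 V(2) le *(1-3)]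
      show ?thesis
        using interchangeable_invariant[OF *(4) fill(1) M(1) _ *(5)] fill(2) by simp
    qed
    also have "\<dots> = csp_val I (pt M)" by (simp add: f_def count_sat_eq_val)
    also have "csp_val I (pt M) = csp_val I \<alpha>"
      by (rule csp_val_cong[OF wf]) (simp add: M(2) n_def)
    also have "real (csp_val I \<alpha>) = csp_poly d I (\<lambda>i. real_of_int (\<alpha> i))"
      using \<alpha> by (intro csp_poly_eq_val[symmetric] wf) (auto simp: n_def)
    finally show ?thesis .
  qed
  ultimately show ?thesis using V(2) g(1) by (simp add: is_kernel_def n_def)
qed

lemma csp_OPT_AVG:
  fixes I :: csp
  defines "n \<equiv> nvars I" and "f \<equiv> \<lambda>M. real (count_sat (constrs I) M)"
  assumes wf: "csp_wf d I" and pk: "p * real n = real k" and "k \<le> n"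
  shows "M \<in> kslice n k \<Longrightarrow> f M \<le> csp_OPT I p" and "csp_AVG I p = kslice_avg n k f"
proof -
  let ?\<phi> = "\<lambda>M. restrict (pt M) {..<n}"
  have bij: "bij_betw ?\<phi> (kslice n k) (slice n p)" by (rule slice_bij[OF pk])
  have val: "real (csp_val I (?\<phi> M)) = f M" for M
    using csp_val_cong[OF wf, of "?\<phi> M" "pt M"] by (simp add: f_def count_sat_eq_val n_def)
  have fin: "finite (slice n p)" using bij finite_kslice bij_betw_finite by blast
  show "f M \<le> csp_OPT I p" if "M \<in> kslice n k"
  proof -
    have "?\<phi> M \<in> slice n p" using bij that by (auto simp: bij_betw_def)
    hence "csp_val I (?\<phi> M) \<le> csp_OPT I p" unfolding csp_OPT_def n_def[symmetric] using fin by (intro Max_ge) auto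
    thus ?thesis using val[of M] by linarith
  qed
  have card: "card (slice n p) = n choose k" using bij_betw_same_card[OF bij] by (simp add: card_kslice)
  hence "slice n p \<noteq> {}" using \<open>k \<le> n\<close> by auto
  hence "csp_AVG I p = (\<Sum>\<alpha>\<in>slice n p. real (csp_val I \<alpha>)) / (n choose k)"
    unfolding csp_AVG_def n_def[symmetric] using fin by (simp add: integral_pmf_of_set card)
  also have "(\<Sum>\<alpha>\<in>slice n p. real (csp_val I \<alpha>)) = (\<Sum>M\<in>kslice n k. f M)"
    using sum.reindex_bij_betw[OF bij, of "\<lambda>\<alpha>. real (csp_val I \<alpha>)"] val by simp
  finally show "csp_AVG I p = kslice_avg n k f" by (simp add: kslice_avg_def)
qed

lemma search_cases:
  obtains "search d cs P k b c L I = Certified" "\<forall>i\<in>set I. c < length (filter (\<lambda>j. \<not> P i j) L) * b"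
  | i where "i \<in> set I" "length (filter (\<lambda>j. \<not> P i j) L) * b \<le> c"
      "search d cs P k b c L I = kernel_of d cs k (filter (\<lambda>j. \<not> P i j) L) (filter (P i) L)"
proof (induction I arbitrary: thesis)
  case (Cons i I)
  show ?case
  proof (cases "length (filter (\<lambda>j. \<not> P i j) L) * b \<le> c")
    case True
    thus ?thesis using Cons.prems(2)[of i] by simp
  next
    case False
    show ?thesis
    proof (rule Cons.IH)
      assume "search d cs P k b c L I = Certified" "\<forall>i\<in>set I. c < length (filter (\<lambda>j. \<not> P i j) L) * b"
      thus ?thesis using Cons.prems(1) False by simp
    next
      fix i' assume "i' \<in> set I" "length (filter (\<lambda>j. \<not> P i' j) L) * b \<le> c"
        "search d cs P k b c L I = kernel_of d cs k (filter (\<lambda>j. \<not> P i' j) L) (filter (P i') L)"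
      thus ?thesis using Cons.prems(2)[of i'] False by simp
    qed
  qed
qed simp

lemma correct_outcome_decide:
  fixes I :: csp and t :: rat and p0 :: real
  defines "n \<equiv> nvars I"
  assumes wf: "csp_wf d I" and d: "d \<ge> 1" and p0: "0 < p0" "p0 \<le> p" "p \<le> 1 - p0"
    and pk: "p * real n = real k" and ab: "quotient_of t = (a, b)"
    and K: "real K1 \<le> C" "real K2 \<le> p0 * K1" "threshold p0 d \<le> K2"
  shows "correct_outcome d C I t p
    (decide d K1 K2 n (constrs I) k ((nat \<bar>a\<bar>)\<^sup>2) ((nat b)\<^sup>2))"
proof -
  let ?cs = "constrs I" and ?L = "[0..<n]" and ?t = "of_rat t :: real"
  define f where "f = (\<lambda>M. real (count_sat ?cs M))"
  define P where "P = (\<lambda>i j. agree (count_sat ?cs) (List.product ?L ?L) i j d {..<k})"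
  have n1: "n \<ge> 1" using wf by (simp add: csp_wf_def n_def)
  have pn: "p0 * n \<le> k" "p0 * n \<le> real n - k"
  proof -
    have "p0 * n \<le> p * n" "p0 * n \<le> (1 - p) * n" using p0 by (intro mult_right_mono; simp)+
    thus "p0 * n \<le> k" "p0 * n \<le> real n - k" using pk by (simp_all add: algebra_simps)
  qed
  have "p0 * n > 0" using p0 n1 by simp
  hence k: "0 < k" "k < n" using pn by linarith+
  have f: "junta_sum d f" unfolding f_def using wf by (intro junta_sum_count_sat) (auto simp: csp_wf_def)
  have P: "P i j \<longleftrightarrow> \<not> asymmetric n k f i j" if "i < n" "j < n" for i j
    unfolding P_def f_def using f k n1 that by (intro agree_iff) (auto simp: f_def)
  have b: "b > 0" using ab quotient_of_denom_pos by blast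
  have t: "?t = of_int a / of_int b" using quotient_of_div[OF ab] by (simp add: of_rat_divide)
  \<comment> \<open>Clearing the denominator of \<open>t = a / b\<close> turns the integer tests of
    the program into comparisons with multiples of \<open>t\<^sup>2\<close>.\<close>
  have le_iff: "x * (nat b)\<^sup>2 \<le> K * (nat \<bar>a\<bar>)\<^sup>2 \<longleftrightarrow> real x \<le> K * ?t\<^sup>2" for x K :: nat
  proof -
    have "x * (nat b)\<^sup>2 \<le> K * (nat \<bar>a\<bar>)\<^sup>2 \<longleftrightarrow> real (x * (nat b)\<^sup>2) \<le> real (K * (nat \<bar>a\<bar>)\<^sup>2)"
      by (simp only: of_nat_le_iff)
    also have "\<dots> \<longleftrightarrow> real x * (of_int b)\<^sup>2 \<le> K * (of_int a)\<^sup>2"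
      using b by simp
    also have "\<dots> \<longleftrightarrow> real x \<le> K * ?t\<^sup>2"
      using b by (simp add: t power_divide pos_le_divide_eq)
    finally show ?thesis .
  qed
  have t2: "0 \<le> ?t\<^sup>2" by simp
  have K2C: "K2 \<le> C"
  proof -
    have "p0 * K1 \<le> 1 * real K1" using p0 by (intro mult_right_mono) auto
    thus ?thesis using K by linarith
  qed
  have kernel: "correct_outcome d C I t p (kernel_of d ?cs k V B)"
    if "distinct V" "set V \<subseteq> {..<n}" "real (length V) \<le> K * ?t\<^sup>2" "real K \<le> C"
      "B = [] \<and> set V = {..<n} \<or> distinct B \<and> set B = {..<n} - set V \<and> k \<le> length B \<and>
        (\<exists>i<n. set V = {j. j < n \<and> asymmetric n k f i j})" for V B and K :: nat
  proof -
    obtain V' g where ker: "kernel_of d ?cs k V B = Kernel V' g" by (simp add: kernel_of_def)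
    have "V' = V \<and> is_kernel d I p (set V) g"
      using is_kernel_kernel_of[OF wf pk[unfolded n_def] that(1) that(2)[unfolded n_def] _ ker] that(5)
      by (simp add: n_def f_def)
    moreover have "real (card (set V)) \<le> C * ?t\<^sup>2"
    proof -
      have "K * ?t\<^sup>2 \<le> C * ?t\<^sup>2" using that(4) t2 by (rule mult_right_mono)
      thus ?thesis using that(1,3) by (simp add: distinct_card)
    qed
    ultimately show ?thesis by (simp add: ker)
  qed
  show ?thesis
  proof (cases "real n \<le> K1 * ?t\<^sup>2")
    case True
    have "correct_outcome d C I t p (kernel_of d ?cs k ?L [])"
      by (rule kernel[of _ K1]) (use True K in auto)
    thus ?thesis using True le_iff[of n K1] by (simp add: decide_def Let_def)
  next
    case False
    let ?V = "\<lambda>i. filter (\<lambda>j. \<not> P i j) ?L"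
    have set_V: "set (?V i) = {j. j < n \<and> asymmetric n k f i j}" if "i < n" for i
      using P[OF that] by auto
    have len_V: "length (?V i) = card {j. j < n \<and> asymmetric n k f i j}" if "i < n" for i
      using distinct_card[of "?V i"] set_V[OF that] by simp
    have dec: "decide d K1 K2 n ?cs k ((nat \<bar>a\<bar>)\<^sup>2) ((nat b)\<^sup>2)
        = search d ?cs P k ((nat b)\<^sup>2) (K2 * (nat \<bar>a\<bar>)\<^sup>2) ?L ?L"
      using False le_iff[of n K1] unfolding P_def by (simp add: decide_def Let_def)
    \<comment> \<open>The purpose of the first test: at most \<open>p0 * n \<le> n - k\<close>
      variables outside a class leave at least \<open>k\<close> inside.\<close>
    have pK: "K2 * ?t\<^sup>2 \<le> p0 * n"
    proof -
      have "K2 * ?t\<^sup>2 \<le> p0 * K1 * ?t\<^sup>2" using K(2) t2 by (rule mult_right_mono)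
      also have "\<dots> = p0 * (K1 * ?t\<^sup>2)" by simp
      also have "\<dots> \<le> p0 * n" using False p0 by (intro mult_left_mono) auto
      finally show ?thesis .
    qed
    show ?thesis unfolding dec
    proof (rule search_cases[of d ?cs P k "(nat b)\<^sup>2" "K2 * (nat \<bar>a\<bar>)\<^sup>2" ?L ?L])
      fix i assume i: "i \<in> set ?L" "length (?V i) * (nat b)\<^sup>2 \<le> K2 * (nat \<bar>a\<bar>)\<^sup>2"
        and s: "search d ?cs P k ((nat b)\<^sup>2) (K2 * (nat \<bar>a\<bar>)\<^sup>2) ?L ?L
          = kernel_of d ?cs k (?V i) (filter (P i) ?L)"
      have V: "real (length (?V i)) \<le> K2 * ?t\<^sup>2" using i(2) le_iff by blast
      have "length (?V i) + length (filter (P i) ?L) = n"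
        using sum_length_filter_compl[of "P i" ?L] by simp
      hence "k \<le> length (filter (P i) ?L)" using V pK pn by linarith
      moreover have "set (filter (P i) ?L) = {..<n} - set (?V i)" by auto
      moreover have "i < n" using i by simp
      ultimately have "correct_outcome d C I t p (kernel_of d ?cs k (?V i) (filter (P i) ?L))"
        using set_V[of i] V K2C by (intro kernel[of _ K2]) auto
      thus "correct_outcome d C I t p (search d ?cs P k ((nat b)\<^sup>2) (K2 * (nat \<bar>a\<bar>)\<^sup>2) ?L ?L)"
        by (simp only: s)
    next
      assume s: "search d ?cs P k ((nat b)\<^sup>2) (K2 * (nat \<bar>a\<bar>)\<^sup>2) ?L ?L = Certified"
        and large: "\<forall>i\<in>set ?L. K2 * (nat \<bar>a\<bar>)\<^sup>2 < length (?V i) * (nat b)\<^sup>2"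
      let ?card = "\<lambda>i. card {j. j < n \<and> asymmetric n k f i j}"
      have large': "K2 * ?t\<^sup>2 < ?card i" if "i < n" for i
      proof -
        have "\<not> length (?V i) * (nat b)\<^sup>2 \<le> K2 * (nat \<bar>a\<bar>)\<^sup>2" using large that by (simp add: not_le)
        thus ?thesis unfolding le_iff using len_V[OF that] by simp
      qed
      define m where "m = Min (?card ` {..<n})"
      have "m \<in> ?card ` {..<n}" unfolding m_def using n1 by (intro Min_in) (auto simp: lessThan_empty_iff)
      then obtain i0 where i0: "i0 < n" "?card i0 = m" by auto
      have m: "m \<le> ?card i" if "i < n" for i unfolding m_def using that by (intro Min_le) auto
      have mt: "K2 * ?t\<^sup>2 < m" using large'[OF i0(1)] i0(2) by simp
      \<comment> \<open>Strict failure of the test makes \<open>m\<close> positive even for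
        \<open>t = 0\<close>, where \<open>m = 0\<close> would have led to a kernel without
        variables.\<close>
      hence "real m > 0" using t2 by (smt (verit) mult_nonneg_nonneg of_nat_0_le_iff)
      hence m0: "m > 0" by simp
      have "threshold p0 d * ?t\<^sup>2 \<le> K2 * ?t\<^sup>2" using K(3) t2 by (rule mult_right_mono)
      hence "threshold p0 d * ?t\<^sup>2 \<le> m" using mt by linarith
      hence "?t \<le> sqrt m * ((p0 / (2 * real d)) ^ d / (4 * sqrt d * 3 ^ d))"
        using threshold_le[of p0 d ?t m] p0 d by simp
      also have "\<dots> \<le> csp_OPT I p - kslice_avg n k f"
      proof (rule max_minus_avg_ge[OF f _ d k])
        show "f M \<in> \<int>" for M by (simp add: f_def)
        show "p0 * n \<le> real (n - k)" using pn k by simp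
        show "f M \<le> csp_OPT I p" if "M \<in> kslice n k" for M
          using csp_OPT_AVG(1)[OF wf pk[unfolded n_def]] that k by (simp add: f_def n_def)
      qed (use p0 pn m i0 m0 in auto)
      also have "kslice_avg n k f = csp_AVG I p"
        using csp_OPT_AVG(2)[OF wf pk[unfolded n_def]] k by (simp add: f_def[abs_def] n_def)
      finally show "correct_outcome d C I t p (search d ?cs P k ((nat b)\<^sup>2) (K2 * (nat \<bar>a\<bar>)\<^sup>2) ?L ?L)"
        by (simp add: s)
    qed
  qed
qed

theorem theorem6p1:
  "\<exists>c::nat. \<forall>(p0::real) (d::nat). 0 < p0 \<and> p0 < 1 \<and> d \<ge> 1 \<longrightarrow>
    (\<exists>(F::program) (A::nat). \<forall>(I::csp) (t::rat) (p::real) (k::nat).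
      csp_wf d I \<and> p0 \<le> p \<and> p \<le> 1 - p0 \<and> p * real (nvars I) = real k \<longrightarrow>
      (\<exists>r T. runs_in F (enc_input d I t k) (enc_outcome r) T \<and>
        T \<le> A * nvars I ^ (c * d) * ((length (constrs I) + 1) * size (enc_rat t)) ^ c \<and>
        correct_outcome d
          (160 * (real d)\<^sup>2 * 30 ^ d * (((1 - p0) / p0)\<^sup>2 + (p0 / (1 - p0))\<^sup>2) ^ d
            * fact d ^ (3 * d\<^sup>2) * (1 / (2 * p0)) ^ (4 * d))
          I t p r))"
proof -
  obtain c where c: "\<And>d K K'. \<exists>A. \<forall>n m s. n \<ge> 1 \<longrightarrow> s \<ge> 1 \<longrightarrow>
      time_main d K K' n m s \<le> A * n ^ (c * d + c) * ((m + 1) * s) ^ c"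
    using poly_bounded_time_main unfolding poly_bounded_def by blast
  show ?thesis
  proof (rule exI[of _ "2 * c"], intro allI impI, elim conjE)
    fix p0 :: real and d :: nat
    assume p0: "0 < p0" "p0 < 1" and d: "d \<ge> 1"
    \<comment> \<open>\<open>K1\<close> is rounded down to stay below the allowed constant,
      \<open>K2\<close> up to stay above the threshold.\<close>
    define K1 where "K1 = nat \<lfloor>kernel_const p0 d\<rfloor>"
    define K2 where "K2 = nat \<lceil>threshold p0 d\<rceil>"
    obtain A where A: "\<And>n m s. n \<ge> 1 \<Longrightarrow> s \<ge> 1 \<Longrightarrow>
        time_main d K1 K2 n m s \<le> A * n ^ (c * d + c) * ((m + 1) * s) ^ c"
      using c[of d K1 K2] by blast
    have "\<exists>r T. runs_in (prog d K1 K2) (enc_input d I t k) (enc_outcome r) T \<and>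
        T \<le> A * nvars I ^ (2 * c * d) * ((length (constrs I) + 1) * size (enc_rat t)) ^ (2 * c) \<and>
        correct_outcome d (kernel_const p0 d) I t p r"
      if wf: "csp_wf d I" and p: "p0 \<le> p" "p \<le> 1 - p0" and pk: "p * real (nvars I) = real k"
      for I t p k
    proof -
      obtain a b where ab: "quotient_of t = (a, b)" by fastforce
      let ?n = "nvars I" and ?s = "size (enc_rat t)"
      let ?r = "decide d K1 K2 ?n (constrs I) k ((nat \<bar>a\<bar>)\<^sup>2) ((nat b)\<^sup>2)"
      have n1: "?n \<ge> 1" using wf by (simp add: csp_wf_def)
      have s1: "?s \<ge> 1" by (simp add: enc_rat_def ab enc_frac_def)
      have "p * real ?n \<le> 1 * real ?n" using p p0 by (intro mult_right_mono) auto
      hence "k \<le> ?n" using pk by simp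
      then obtain T where T: "T \<le> time_main d K1 K2 ?n (length (constrs I)) ?s"
        "runs_in (prog d K1 K2) (enc_input d I t k) (enc_outcome ?r) T"
        using runs_main[OF wf _ ab] by blast
      have "T \<le> A * ?n ^ (c * d + c) * ((length (constrs I) + 1) * ?s) ^ c"
        using T(1) A[OF n1 s1] by (rule order_trans)
      also have "\<dots> \<le> A * ?n ^ (2 * c * d) * ((length (constrs I) + 1) * ?s) ^ (2 * c)"
      proof (intro mult_mono power_increasing le_refl)
        \<comment> \<open>As \<open>d \<ge> 1\<close>, doubling \<open>c\<close> absorbs the
          additive part and leaves an exponent proportional to \<open>d\<close>.\<close>
        show "c * d + c \<le> 2 * c * d" using d by (cases d) auto
      qed (use n1 s1 in auto)
      finally have time: "T \<le> \<dots>" .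
      \<comment> \<open>The bound \<open>p0 \<le> 1 / 2\<close> required here follows from
        \<open>p0 \<le> p\<close> and \<open>p \<le> 1 - p0\<close>.\<close>
      have ge: "threshold p0 d + 1 \<le> p0 * (kernel_const p0 d - 1)"
        using p0 p d by (intro kernel_const_ge) auto
      have th: "threshold p0 d \<ge> 0" using p0 by (simp add: threshold_def)
      hence "0 < p0 * (kernel_const p0 d - 1)" using ge by linarith
      hence C: "kernel_const p0 d > 1" using p0 by (simp add: zero_less_mult_iff)
      have "real K1 = of_int \<lfloor>kernel_const p0 d\<rfloor>" using C by (simp add: K1_def)
      hence K1: "real K1 \<le> kernel_const p0 d" "kernel_const p0 d - 1 \<le> real K1" by linarith+
      have "real K2 = of_int \<lceil>threshold p0 d\<rceil>" using th by (simp add: K2_def)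
      hence K2: "threshold p0 d \<le> real K2" "real K2 \<le> threshold p0 d + 1" by linarith+
      have "p0 * (kernel_const p0 d - 1) \<le> p0 * real K1" using K1(2) p0 by (intro mult_left_mono) auto
      hence "real K2 \<le> p0 * real K1" using K2(2) ge by linarith
      hence "correct_outcome d (kernel_const p0 d) I t p ?r"
        using correct_outcome_decide[OF wf d p0(1) p pk ab K1(1) _ K2(1)] by simp
      with T(2) time show ?thesis by blast
    qed
    thus "\<exists>(F::program) (A::nat). \<forall>(I::csp) (t::rat) (p::real) (k::nat).
      csp_wf d I \<and> p0 \<le> p \<and> p \<le> 1 - p0 \<and> p * real (nvars I) = real k \<longrightarrow>
      (\<exists>r T. runs_in F (enc_input d I t k) (enc_outcome r) T \<and>
        T \<le> A * nvars I ^ (2 * c * d) * ((length (constrs I) + 1) * size (enc_rat t)) ^ (2 * c) \<and>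
        correct_outcome d
          (160 * (real d)\<^sup>2 * 30 ^ d * (((1 - p0) / p0)\<^sup>2 + (p0 / (1 - p0))\<^sup>2) ^ d
            * fact d ^ (3 * d\<^sup>2) * (1 / (2 * p0)) ^ (4 * d))
          I t p r)"
      unfolding kernel_const_def by blast
  qed
qed

end
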